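(* Let $\lambda$ be the $k$-th eigenvalue of the mixed eigenvalue problem $a(U,W)=\lambda\,b(U,W)$ for all $W\in V$ (thus also of the biharmonic problem $\int_\Omega\nabla^2u:\nabla^2v=\lambda\int_\Omega uv$ for all $v\in H^2_0(\Omega)$), with $M(\lambda)\subset V$ its invariant subspace (eigenspace); let $(\lambda_h,U_h)$, $U_h=(u_h,\boldsymbol\varphi_h,p_h,w_h)\in V_h$, $\|U_h\|_V=1$, be the $k$-th eigenpair of the discrete problem $a(U_h,W_h)=\lambda_h\,b(U_h,W_h)$ for all $W_h\in V_h$. Then $\lambda_h\to\lambda$ as $h\to0$. Further, there is a constant $C$ such that for $h$ sufficiently small, $$|\lambda_h-\lambda|\le C\,\delta(M(\lambda),V_h)^2,\qquad \delta(U_h,M(\lambda))\le C\,\delta(M(\lambda),V_h).$$ Moreover, there exists $u\in H^2_0(\Omega)$, an eigenvector of the biharmonic eigenvalue problem belonging to $\lambda$, such that $$\|u_h-u\|_{1,\Omega}\le C\,\delta(M(\lambda),V_h).$$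
   Context: Let $\Omega\subset\mathbb{R}^2$ be a polygonal domain (with the property $\nabla H^2_0(\Omega)=\{\boldsymbol\psi\in (H^1_0(\Omega))^2:\mathrm{rot}\,\boldsymbol\psi=0\}$, $\mathrm{rot}\,\boldsymbol\psi=\partial_1\psi_2-\partial_2\psi_1$). Let $V=H^1_0(\Omega)\times (H^1_0(\Omega))^2\times L^2_0(\Omega)\times H^1_0(\Omega)$, $L^2_0$ being the mean-zero functions, with norm $\|(u,\boldsymbol\varphi,p,w)\|_V=(\|u\|_{1,\Omega}^2+\|\boldsymbol\varphi\|_{1,\Omega}^2+\|p\|_{0,\Omega}^2+\|w\|_{1,\Omega}^2)^{1/2}$. Define $$a((u,\boldsymbol\varphi,p,w),(v,\boldsymbol\psi,q,s))=(\nabla w,\nabla v)+(\nabla\boldsymbol\varphi,\nabla\boldsymbol\psi)+(p,\mathrm{rot}\,\boldsymbol\psi)+(\nabla w,\boldsymbol\psi)+(\mathrm{rot}\,\boldsymbol\varphi,q)+(\nabla u,\nabla s)+(\boldsymbol\varphi,\nabla s),$$ $b((u,\boldsymbol\varphi,p,w),(v,\boldsymbol\psi,q,s))=(u,v)$, with $(\cdot,\cdot)$ the $L^2$ inner product. Eigenvalues are counted with multiplicity in increasing order. For closed subspaces $M,N$ of $V$, $\delta(M,N)=\sup_{x\in M,\|x\|_V=1}\mathrm{dist}(x,N)$; $\delta(U_h,M(\lambda))$ means $\delta(\mathrm{span}\{U_h\},M(\lambda))$. $V_h=H^1_{h0}\times\boldsymbol H^1_{h0}\times L^2_{h0}\times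 H^1_{h0}\subset V$ ($h\to0$) are finite element subspaces (first and fourth factors being the same space), satisfying uniformly in $h$, with a constant $c>0$, $\inf_{q_h\in L^2_{h0}}\sup_{\boldsymbol\psi_h\in \boldsymbol H^1_{h0}}\frac{(\mathrm{rot}\,\boldsymbol\psi_h,q_h)}{\|\nabla\boldsymbol\psi_h\|_{0,\Omega}\|q_h\|_{0,\Omega}}\ge c$, and providing approximation of $V$: $\mathrm{dist}(U,V_h)\to0$ as $h\to0$ for each $U\in V$. *)

theory Defs
  imports "HOL-Analysis.Analysis"
begin

section \<open>The Hilbert space of square-integrable functions\<close>

definition square_integrable :: "('a::euclidean_space \<Rightarrow> real) \<Rightarrow> bool" where
  "square_integrable f \<longleftrightarrow> f \<in> borel_measurable lborel \<and> integrable lborel (\<lambda>x. (f x)\<^sup>2)"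

lemma square_integrable_mult:
  assumes "square_integrable f" "square_integrable g"
  shows "integrable lborel (\<lambda>x. f x * g x)"
proof (rule Bochner_Integration.integrable_bound)
  show "integrable lborel (\<lambda>x. (f x)\<^sup>2 + (g x)\<^sup>2)"
    using assms by (auto simp: square_integrable_def)
  show "(\<lambda>x. f x * g x) \<in> borel_measurable lborel"
    using assms by (auto simp: square_integrable_def)
  have "\<bar>s * t\<bar> \<le> s\<^sup>2 + t\<^sup>2" for s t :: real
    using sum_squares_bound[of "\<bar>s\<bar>" "\<bar>t\<bar>"] mult_nonneg_nonneg[of "\<bar>s\<bar>" "\<bar>t\<bar>"]
    unfolding abs_mult power2_abs by linarith
  then show "AE x in lborel. norm (f x * g x) \<le> norm ((f x)\<^sup>2 + (g x)\<^sup>2)"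
    by simp
qed

lemma square_integrable_add:
  assumes "square_integrable f" "square_integrable g"
  shows "square_integrable (\<lambda>x. f x + g x)"
  using assms square_integrable_mult[OF assms]
  by (auto simp: square_integrable_def power2_sum mult.assoc)

lemma square_integrable_scale: "square_integrable f \<Longrightarrow> square_integrable (\<lambda>x. c * f x)"
  by (auto simp: square_integrable_def power_mult_distrib)

lemma square_integrable_zero: "square_integrable (\<lambda>x. 0)"
  by (simp add: square_integrable_def)

definition l2_eq :: "('a::euclidean_space \<Rightarrow> real) \<Rightarrow> ('a \<Rightarrow> real) \<Rightarrow> bool" where
  "l2_eq f g \<longleftrightarrow> square_integrable f \<and> square_integrable g \<and> (AE x in lborel. f x = g x)"

quotient_type (overloaded) 'a l2 = "'a::euclidean_space \<Rightarrow> real" / partial: l2_eq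
proof (rule part_equivpI)
  show "\<exists>f :: 'a \<Rightarrow> real. l2_eq f f"
    using square_integrable_zero by (auto simp: l2_eq_def)
  show "symp l2_eq"
    by (auto simp: symp_def l2_eq_def elim: AE_mp)
  show "transp l2_eq"
    unfolding transp_def l2_eq_def by (auto elim: AE_mp)
qed

instantiation l2 :: (euclidean_space) real_vector
begin

lift_definition zero_l2 :: "'a l2" is "\<lambda>x. 0"
  by (simp add: l2_eq_def square_integrable_zero)

lift_definition plus_l2 :: "'a l2 \<Rightarrow> 'a l2 \<Rightarrow> 'a l2" is "\<lambda>f g x. f x + g x"
  by (auto simp: l2_eq_def intro: square_integrable_add)

lift_definition scaleR_l2 :: "real \<Rightarrow> 'a l2 \<Rightarrow> 'a l2" is "\<lambda>c f x. c * f x"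
  by (auto simp: l2_eq_def intro: square_integrable_scale)

lift_definition uminus_l2 :: "'a l2 \<Rightarrow> 'a l2" is "\<lambda>f x. - f x"
  by (auto simp: l2_eq_def square_integrable_def)

definition minus_l2 :: "'a l2 \<Rightarrow> 'a l2 \<Rightarrow> 'a l2" where
  "minus_l2 f g = f + (- g)"

instance
proof
  fix f g h :: "'a l2" and r s :: real
  show "f + g + h = f + (g + h)"
    by transfer (auto simp: l2_eq_def add.assoc intro!: square_integrable_add)
  show "f + g = g + f"
    by transfer (auto simp: l2_eq_def add.commute intro!: square_integrable_add)
  show "0 + f = f"
    by transfer (auto simp: l2_eq_def)
  show "- f + f = 0"
    by transfer (auto simp: l2_eq_def square_integrable_zero)
  show "f - g = f + - g"
    by (simp add: minus_l2_def)
  show "r *\<^sub>R (f + g) = r *\<^sub>R f + r *\<^sub>R g"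
    by transfer (auto simp: l2_eq_def distrib_left
        intro!: square_integrable_add square_integrable_scale)
  show "(r + s) *\<^sub>R f = r *\<^sub>R f + s *\<^sub>R f"
    by transfer (auto simp: l2_eq_def distrib_right
        intro!: square_integrable_add square_integrable_scale)
  show "r *\<^sub>R s *\<^sub>R f = (r * s) *\<^sub>R f"
    by transfer (auto simp: l2_eq_def mult.assoc intro!: square_integrable_scale)
  show "1 *\<^sub>R f = f"
    by transfer (auto simp: l2_eq_def)
qed

end

instantiation l2 :: (euclidean_space) real_inner
begin

lift_definition inner_l2 :: "'a l2 \<Rightarrow> 'a l2 \<Rightarrow> real" is "\<lambda>f g. LINT x|lborel. f x * g x"
proof -
  fix f1 f2 g1 g2 :: "'a \<Rightarrow> real"
  assume "l2_eq f1 f2" "l2_eq g1 g2"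
  then show "(LINT x|lborel. f1 x * g1 x) = (LINT x|lborel. f2 x * g2 x)"
    by (intro integral_cong_AE) (auto simp: l2_eq_def square_integrable_def)
qed

definition norm_l2 :: "'a l2 \<Rightarrow> real" where
  "norm_l2 f = sqrt (inner f f)"

definition dist_l2 :: "'a l2 \<Rightarrow> 'a l2 \<Rightarrow> real" where
  "dist_l2 f g = norm (f - g)"

definition sgn_l2 :: "'a l2 \<Rightarrow> 'a l2" where
  "sgn_l2 f = f /\<^sub>R norm f"

definition uniformity_l2 :: "('a l2 \<times> 'a l2) filter" where
  "uniformity_l2 = (INF e\<in>{0<..}. principal {(f, g). dist f g < e})"

definition open_l2 :: "'a l2 set \<Rightarrow> bool" where
  "open_l2 U \<longleftrightarrow> (\<forall>f\<in>U. eventually (\<lambda>(f', g). f' = f \<longrightarrow> g \<in> U) uniformity)"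

instance
proof
  fix f g h :: "'a l2" and r s :: real
  show "dist f g = norm (f - g)"
    by (simp add: dist_l2_def)
  show "sgn f = f /\<^sub>R norm f"
    by (simp add: sgn_l2_def)
  show "uniformity = (INF e\<in>{0<..}. principal {(f, g :: 'a l2). dist f g < e})"
    by (simp add: uniformity_l2_def)
  show "open U \<longleftrightarrow> (\<forall>f\<in>U. eventually (\<lambda>(f', g). f' = f \<longrightarrow> g \<in> U) uniformity)"
    for U :: "'a l2 set"
    by (simp add: open_l2_def)
  show "inner f g = inner g f"
    by transfer (simp add: mult.commute)
  show "inner (f + g) h = inner f h + inner g h"
    by transfer (auto simp: l2_eq_def distrib_right square_integrable_mult)
  show "inner (r *\<^sub>R f) g = r * inner f g"
    by transfer (simp add: mult.assoc)
  show "0 \<le> inner f f"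
    by transfer simp
  show "inner f f = 0 \<longleftrightarrow> f = 0"
  proof transfer
    fix f :: "'a \<Rightarrow> real"
    assume "l2_eq f f"
    then have f: "square_integrable f" by (simp add: l2_eq_def)
    then have "integrable lborel (\<lambda>x. f x * f x)" by (rule square_integrable_mult[OF _ f])
    then have "(LINT x|lborel. f x * f x) = 0 \<longleftrightarrow> (AE x in lborel. f x * f x = 0)"
      by (intro integral_nonneg_eq_0_iff_AE) auto
    also have "\<dots> \<longleftrightarrow> l2_eq f (\<lambda>x. 0)"
      using f by (simp add: l2_eq_def square_integrable_zero)
    finally show "(LINT x|lborel. f x * f x) = 0 \<longleftrightarrow> l2_eq f (\<lambda>x. 0)" .
  qed
  show "norm f = sqrt (inner f f)"
    by (simp add: norm_l2_def)
qed

end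

section \<open>Sobolev spaces on a planar domain\<close>

type_synonym plane = "real^2"

definition polygonal_domain :: "plane set \<Rightarrow> bool" where
  "polygonal_domain \<Omega> \<longleftrightarrow> open \<Omega> \<and> connected \<Omega> \<and> bounded \<Omega> \<and> \<Omega> \<noteq> {} \<and>
     (\<exists>S. finite S \<and> (\<forall>(a, b)\<in>S. a \<noteq> b) \<and> frontier \<Omega> = (\<Union>(a, b)\<in>S. closed_segment a b))"

definition partial :: "2 \<Rightarrow> (plane \<Rightarrow> real) \<Rightarrow> plane \<Rightarrow> real" where
  "partial i f x = frechet_derivative f (at x) (axis i 1)"

primrec Ck :: "nat \<Rightarrow> (plane \<Rightarrow> real) \<Rightarrow> bool" where
  "Ck 0 f \<longleftrightarrow> continuous_on UNIV f"
| "Ck (Suc n) f \<longleftrightarrow> f differentiable_on UNIV \<and> (\<forall>i. Ck n (partial i f))"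

definition test_function :: "plane set \<Rightarrow> (plane \<Rightarrow> real) \<Rightarrow> bool" where
  "test_function \<Omega> f \<longleftrightarrow> (\<forall>n. Ck n f) \<and>
     compact (closure {x. f x \<noteq> 0}) \<and> closure {x. f x \<noteq> 0} \<subseteq> \<Omega>"

text \<open>
  Functions on \<open>\<Omega>\<close> are identified with their extensions by zero to the whole plane. Thus
  \<open>L2 \<Omega>\<close> is a closed subspace of the space of square-integrable functions on the plane, and the
  inner product of the latter restricts to the inner product over \<open>\<Omega>\<close>.
\<close>

definition L2 :: "plane set \<Rightarrow> plane l2 set" where
  "L2 \<Omega> = {f. AE x in lborel. x \<notin> \<Omega> \<longrightarrow> rep_l2 f x = 0}"

definition L2_0 :: "plane set \<Rightarrow> plane l2 set" where
  "L2_0 \<Omega> = {f \<in> L2 \<Omega>. (LINT x:\<Omega>|lborel. rep_l2 f x) = 0}"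

text \<open>
  The test functions live on \<open>\<Omega>\<close> only, so these are the distributional derivatives on \<open>\<Omega>\<close>
  (extended by zero), not those of the zero extension on the whole plane.
\<close>

definition has_weak_deriv :: "plane set \<Rightarrow> 2 \<Rightarrow> plane l2 \<Rightarrow> plane l2 \<Rightarrow> bool" where
  "has_weak_deriv \<Omega> i u g \<longleftrightarrow> g \<in> L2 \<Omega> \<and>
     (\<forall>\<phi>. test_function \<Omega> \<phi> \<longrightarrow> inner u (abs_l2 (partial i \<phi>)) = - inner g (abs_l2 \<phi>))"

definition weak_deriv :: "plane set \<Rightarrow> 2 \<Rightarrow> plane l2 \<Rightarrow> plane l2" where
  "weak_deriv \<Omega> i u = (THE g. has_weak_deriv \<Omega> i u g)"

definition grad :: "plane set \<Rightarrow> plane l2 \<Rightarrow> (plane l2)^2" where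
  "grad \<Omega> u = (\<chi> i. weak_deriv \<Omega> i u)"

definition Grad :: "plane set \<Rightarrow> (plane l2)^2 \<Rightarrow> (plane l2)^2^2" where
  "Grad \<Omega> \<psi> = (\<chi> i. grad \<Omega> (\<psi> $ i))"

definition rot :: "plane set \<Rightarrow> (plane l2)^2 \<Rightarrow> plane l2" where
  "rot \<Omega> \<psi> = weak_deriv \<Omega> 1 (\<psi> $ 2) - weak_deriv \<Omega> 2 (\<psi> $ 1)"

definition H1 :: "plane set \<Rightarrow> plane l2 set" where
  "H1 \<Omega> = {u \<in> L2 \<Omega>. \<forall>i. \<exists>g. has_weak_deriv \<Omega> i u g}"

definition H2 :: "plane set \<Rightarrow> plane l2 set" where
  "H2 \<Omega> = {u \<in> H1 \<Omega>. \<forall>i. weak_deriv \<Omega> i u \<in> H1 \<Omega>}"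

definition H1_norm :: "plane set \<Rightarrow> plane l2 \<Rightarrow> real" where
  "H1_norm \<Omega> u = sqrt ((norm u)\<^sup>2 + (norm (grad \<Omega> u))\<^sup>2)"

definition H1_vec_norm :: "plane set \<Rightarrow> (plane l2)^2 \<Rightarrow> real" where
  "H1_vec_norm \<Omega> \<psi> = sqrt ((norm \<psi>)\<^sup>2 + (norm (Grad \<Omega> \<psi>))\<^sup>2)"

definition H2_norm :: "plane set \<Rightarrow> plane l2 \<Rightarrow> real" where
  "H2_norm \<Omega> u = sqrt ((norm u)\<^sup>2 + (norm (grad \<Omega> u))\<^sup>2 + (norm (Grad \<Omega> (grad \<Omega> u)))\<^sup>2)"

definition H1_0 :: "plane set \<Rightarrow> plane l2 set" where
  "H1_0 \<Omega> = {u \<in> H1 \<Omega>. \<forall>e>0. \<exists>\<phi>. test_function \<Omega> \<phi> \<and> H1_norm \<Omega> (u - abs_l2 \<phi>) < e}"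

definition H2_0 :: "plane set \<Rightarrow> plane l2 set" where
  "H2_0 \<Omega> = {u \<in> H2 \<Omega>. \<forall>e>0. \<exists>\<phi>. test_function \<Omega> \<phi> \<and> H2_norm \<Omega> (u - abs_l2 \<phi>) < e}"

definition H1_0_vec :: "plane set \<Rightarrow> ((plane l2)^2) set" where
  "H1_0_vec \<Omega> = {\<psi>. \<forall>i. \<psi> $ i \<in> H1_0 \<Omega>}"

section \<open>Variational eigenvalue problems\<close>

definition eigenspace ::
    "'v::real_vector set \<Rightarrow> ('v \<Rightarrow> 'v \<Rightarrow> real) \<Rightarrow> ('v \<Rightarrow> 'v \<Rightarrow> real) \<Rightarrow> real \<Rightarrow> 'v set" where
  "eigenspace X a b lam = {U \<in> X. \<forall>W\<in>X. a U W = lam * b U W}"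

definition eigenpair ::
    "'v::real_vector set \<Rightarrow> ('v \<Rightarrow> 'v \<Rightarrow> real) \<Rightarrow> ('v \<Rightarrow> 'v \<Rightarrow> real) \<Rightarrow> real \<Rightarrow> 'v \<Rightarrow> bool" where
  "eigenpair X a b lam U \<longleftrightarrow> U \<in> eigenspace X a b lam \<and> U \<noteq> 0"

definition eigenvalues ::
    "'v::real_vector set \<Rightarrow> ('v \<Rightarrow> 'v \<Rightarrow> real) \<Rightarrow> ('v \<Rightarrow> 'v \<Rightarrow> real) \<Rightarrow> real set" where
  "eigenvalues X a b = {lam. \<exists>U. eigenpair X a b lam U}"

definition finite_dimensional :: "'v::real_vector set \<Rightarrow> bool" where
  "finite_dimensional X \<longleftrightarrow> (\<exists>B. finite B \<and> X \<subseteq> span B)"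

text \<open>
  The eigenvalues are enumerated in increasing order, each repeated according to its multiplicity,
  starting with index 1: \<open>lam\<close> occupies the positions between the number of eigenvalues below
  \<open>lam\<close> (exclusive) and the number of eigenvalues up to \<open>lam\<close> (inclusive). The finiteness
  conditions exclude the default value 0 of \<open>sum\<close> and \<open>dim\<close>.
\<close>

definition kth_eigenvalue ::
    "'v::real_vector set \<Rightarrow> ('v \<Rightarrow> 'v \<Rightarrow> real) \<Rightarrow> ('v \<Rightarrow> 'v \<Rightarrow> real) \<Rightarrow> nat \<Rightarrow> real \<Rightarrow> bool" where
  "kth_eigenvalue X a b k lam \<longleftrightarrow>
     lam \<in> eigenvalues X a b \<and>
     finite {\<mu> \<in> eigenvalues X a b. \<mu> \<le> lam} \<and>
     (\<forall>\<mu>\<le>lam. finite_dimensional (eigenspace X a b \<mu>)) \<and>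
     (\<Sum>\<mu> | \<mu> \<in> eigenvalues X a b \<and> \<mu> < lam. dim (eigenspace X a b \<mu>)) < k \<and>
     k \<le> (\<Sum>\<mu> | \<mu> \<in> eigenvalues X a b \<and> \<mu> \<le> lam. dim (eigenspace X a b \<mu>))"

definition biharmonic_form :: "plane set \<Rightarrow> plane l2 \<Rightarrow> plane l2 \<Rightarrow> real" where
  "biharmonic_form \<Omega> u v = inner (Grad \<Omega> (grad \<Omega> u)) (Grad \<Omega> (grad \<Omega> v))"

section \<open>The mixed formulation\<close>

type_synonym mixed = "plane l2 \<times> ((plane l2)^2) \<times> plane l2 \<times> plane l2"

definition mixed_space :: "plane set \<Rightarrow> mixed set" where
  "mixed_space \<Omega> = H1_0 \<Omega> \<times> H1_0_vec \<Omega> \<times> L2_0 \<Omega> \<times> H1_0 \<Omega>"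

text \<open>This is not the \<open>norm\<close> of the product type, which does not involve derivatives.\<close>

fun mixed_norm :: "plane set \<Rightarrow> mixed \<Rightarrow> real" where
  "mixed_norm \<Omega> (u, \<phi>, p, w) =
     sqrt ((H1_norm \<Omega> u)\<^sup>2 + (H1_vec_norm \<Omega> \<phi>)\<^sup>2 + (norm p)\<^sup>2 + (H1_norm \<Omega> w)\<^sup>2)"

fun mixed_a :: "plane set \<Rightarrow> mixed \<Rightarrow> mixed \<Rightarrow> real" where
  "mixed_a \<Omega> (u, \<phi>, p, w) (v, \<psi>, q, s) =
     inner (grad \<Omega> w) (grad \<Omega> v) + inner (Grad \<Omega> \<phi>) (Grad \<Omega> \<psi>) + inner p (rot \<Omega> \<psi>)
     + inner (grad \<Omega> w) \<psi> + inner (rot \<Omega> \<phi>) q + inner (grad \<Omega> u) (grad \<Omega> s)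
     + inner \<phi> (grad \<Omega> s)"

fun mixed_b :: "mixed \<Rightarrow> mixed \<Rightarrow> real" where
  "mixed_b (u, \<phi>, p, w) (v, \<psi>, q, s) = inner u v"

definition mixed_dist :: "plane set \<Rightarrow> mixed \<Rightarrow> mixed set \<Rightarrow> real" where
  "mixed_dist \<Omega> U N = (INF W\<in>N. mixed_norm \<Omega> (U - W))"

definition gap :: "plane set \<Rightarrow> mixed set \<Rightarrow> mixed set \<Rightarrow> real" where
  "gap \<Omega> M N = (SUP U\<in>{U \<in> M. mixed_norm \<Omega> U = 1}. mixed_dist \<Omega> U N)"

text \<open>
  Infimum and supremum run over the nonzero elements. They are taken in \<open>ereal\<close>, where they
  exist unconditionally (\<open>\<infinity>\<close> and \<open>-\<infinity>\<close> for empty index sets).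
\<close>

definition inf_sup_const :: "plane set \<Rightarrow> ((plane l2)^2) set \<Rightarrow> plane l2 set \<Rightarrow> ereal" where
  "inf_sup_const \<Omega> \<Psi> Q =
     (INF q\<in>Q - {0}. SUP \<psi>\<in>\<Psi> - {0}. ereal (inner (rot \<Omega> \<psi>) q / (norm (Grad \<Omega> \<psi>) * norm q)))"

end

theory Submission
  imports Defs "HOL-Computational_Algebra.Polynomial" "HOL-Library.Diagonal_Subsequence"
begin

text \<open>
  The norm and the form \<open>a\<close> of the mixed problem only involve components in \<open>L\<^sup>2\<close>, so that \<open>V\<close> embeds
  isometrically onto a closed subspace of a product of copies of \<open>L\<^sup>2\<close>, with \<open>a(U, W) = (A U, W)\<close> and
  \<open>b(U, W) = (B U, B W)\<close> for a bounded symmetric \<open>A\<close> and the projection \<open>B\<close> onto the first component.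
  By the inf-sup condition, \<open>A\<close> is stable on \<open>V\<^sub>h\<close> uniformly in \<open>h\<close>, and by approximation also on \<open>V\<close>.
  Hence the source problems have self-adjoint solution operators \<open>T\<close> and \<open>T\<^sub>h\<close> on \<open>L\<^sup>2\<close>, whose eigenvalues
  are the reciprocals of those of the mixed problems. They are nonnegative because \<open>a(U, U)\<close> equals the squared norm
  of \<open>\<nabla>\<phi>\<close> at a solution \<open>U\<close>, compact by Rellich's theorem, and \<open>T\<^sub>h\<close> converges to \<open>T\<close> pointwise, so that
  the eigenvalues converge by the min-max principle and compactness. Since there are exactly \<open>dim M(\<lambda>)\<close> discrete
  eigenvalues near \<open>\<lambda>\<close>, the Galerkin projection of \<open>M(\<lambda>)\<close> comes close to every discrete
  eigenvector. Symmetry makes the eigenvalue error quadratic in the eigenvector error.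
\<close>

section \<open>Orthonormal systems and symmetric operators\<close>

text \<open>The form \<open>a\<close> is an indefinite saddle-point form and \<open>b\<close> is
  degenerate on \<open>V\<close>, so neither can carry a min-max argument on \<open>V\<close>
  itself. On the pivot space \<open>L\<^sup>2\<close> both become harmless: \<open>b\<close> turns
  into the inner product, and \<open>a\<close> is met only at solutions of source problems.
  Multiplicities are counted there as well: the presence of \<open>k\<close> eigenvalues in a set is
  witnessed by \<open>k\<close> orthonormal images of eigenvectors, a statement that survives strong
  limits, while sums of dimensions do not. Pointwise convergence of the solution operators is enough
  because it is only ever applied to finitely many fixed vectors. Convergence of the eigenvalues has
  to precede the rates: it places the discrete eigenvalue in a window around \<lambda> of limited
  multiplicity, and only then can the Galerkin projection, truncated to that window, be inverted on
  the eigenspace.\<close>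

definition orthonormal :: "'a::real_inner set \<Rightarrow> bool" where
  "orthonormal D \<longleftrightarrow> (\<forall>e\<in>D. norm e = 1) \<and> pairwise orthogonal D"

lemma orthonormal_inner:
  assumes "orthonormal D" "e \<in> D" "e' \<in> D"
  shows "inner e e' = (if e = e' then 1 else 0)"
  using assms by (auto simp: orthonormal_def pairwise_def orthogonal_def norm_eq_1)

lemma orthonormal_subset: "orthonormal D \<Longrightarrow> D' \<subseteq> D \<Longrightarrow> orthonormal D'"
  by (auto simp: orthonormal_def pairwise_def)

lemma orthonormal_independent: "orthonormal D \<Longrightarrow> independent D"
  by (rule pairwise_orthogonal_independent) (auto simp: orthonormal_def)

lemma orthonormal_expand:
  assumes "orthonormal D" "finite D" "x \<in> span D"
  shows "(\<Sum>e\<in>D. inner x e *\<^sub>R e) = x"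
  using assms by (intro orthonormal_basis_expand) (auto simp: orthonormal_def)

lemma orthonormal_inner_sum:
  assumes "orthonormal D" "finite D" "e \<in> D"
  shows "inner (\<Sum>d\<in>D. c d *\<^sub>R d) e = c e"
proof -
  have "inner (\<Sum>d\<in>D. c d *\<^sub>R d) e = (\<Sum>d\<in>D. if d = e then c d else 0)"
    unfolding inner_sum_left using assms by (intro sum.cong) (auto simp: orthonormal_inner)
  then show ?thesis using assms by simp
qed

lemma orthonormal_norm_sum:
  assumes "orthonormal D" "finite D"
  shows "(norm (\<Sum>d\<in>D. c d *\<^sub>R d))\<^sup>2 = (\<Sum>d\<in>D. (c d)\<^sup>2)"
proof -
  have "inner s (\<Sum>d\<in>D. c d *\<^sub>R d) = (\<Sum>d\<in>D. c d * inner s d)" for s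
    by (simp add: inner_sum_right)
  then have "(norm (\<Sum>d\<in>D. c d *\<^sub>R d))\<^sup>2 = (\<Sum>d\<in>D. c d * inner (\<Sum>d\<in>D. c d *\<^sub>R d) d)"
    unfolding power2_norm_eq_inner by blast
  also have "\<dots> = (\<Sum>d\<in>D. (c d)\<^sup>2)"
    by (intro sum.cong) (auto simp: orthonormal_inner_sum[OF assms] power2_eq_square)
  finally show ?thesis .
qed

lemma orthonormal_residual:
  assumes "orthonormal D" "finite D" "e \<in> D"
  shows "inner (f - (\<Sum>d\<in>D. inner f d *\<^sub>R d)) e = 0"
  using orthonormal_inner_sum[OF assms, of "inner f"] by (simp add: inner_diff_left)

lemma orthonormal_residual_span:
  assumes "orthonormal D" "finite D" "g \<in> span D"
  shows "inner (f - (\<Sum>d\<in>D. inner f d *\<^sub>R d)) g = 0"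
proof -
  have "inner (f - (\<Sum>d\<in>D. inner f d *\<^sub>R d)) (\<Sum>e\<in>D. inner g e *\<^sub>R e) = 0"
    unfolding inner_sum_right using orthonormal_residual[OF assms(1,2)]
    by (intro sum.neutral) auto
  then show ?thesis using orthonormal_expand[OF assms] by simp
qed

lemma bessel:
  assumes "orthonormal D" "finite D"
  shows "(\<Sum>d\<in>D. (inner f d)\<^sup>2) \<le> (norm f)\<^sup>2"
proof -
  define g where "g = (\<Sum>d\<in>D. inner f d *\<^sub>R d)"
  have "g \<in> span D" by (auto simp: g_def intro: span_sum span_scale span_base)
  then have "inner (f - g) g = 0"
    using orthonormal_residual_span[OF assms] by (simp add: g_def)
  then have "(norm f)\<^sup>2 = (norm (f - g))\<^sup>2 + (norm g)\<^sup>2"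
    by (simp add: power2_norm_eq_inner inner_diff inner_commute)
  then show ?thesis using orthonormal_norm_sum[OF assms, of "inner f"] by (simp add: g_def)
qed

lemma finite_dimensional_basis:
  fixes W :: "'a::real_vector set"
  assumes "finite_dimensional W" "subspace W"
  obtains S where "finite S" "independent S" "span S = W" "card S = dim W" "S \<subseteq> W"
proof -
  obtain F where F: "finite F" "W \<subseteq> span F" using assms by (auto simp: finite_dimensional_def)
  obtain S where S: "S \<subseteq> W" "independent S" "W \<subseteq> span S" "card S = dim W"
    using basis_exists[of W] by blast
  have "finite S" using independent_span_bound[OF F(1) S(2)] S(1) F(2) by auto
  moreover have "span S = W" using S assms(2) by (simp add: span_minimal subset_antisym)
  ultimately show ?thesis using S that by blast
qed

text \<open>\<open>dim\<close> carries information only when a finite basis exists;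
  finite-dimensionality is what turns it into a bound on arbitrary independent sets.\<close>

lemma card_independent_le_dim:
  assumes "finite_dimensional W" "subspace W" "independent D" "D \<subseteq> W"
  shows "finite D" "card D \<le> dim W"
proof -
  obtain S where S: "finite S" "span S = W" "card S = dim W"
    using finite_dimensional_basis[OF assms(1,2)] by metis
  then show "finite D" "card D \<le> dim W"
    using independent_span_bound[OF S(1) assms(3)] assms(4) by auto
qed

lemma finite_dimensional_subset:
  "finite_dimensional W \<Longrightarrow> W' \<subseteq> W \<Longrightarrow> finite_dimensional W'"
  by (auto simp: finite_dimensional_def)

lemma finite_dimensional_linear_image:
  assumes "finite_dimensional W" "linear f"
  shows "finite_dimensional (f ` W)"
proof -
  obtain F where F: "finite F" "W \<subseteq> span F" using assms by (auto simp: finite_dimensional_def)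
  then have "f ` W \<subseteq> span (f ` F)" using linear_span_image[OF assms(2)] by auto
  then show ?thesis using F by (auto simp: finite_dimensional_def)
qed

lemma orthonormal_basis_exists:
  fixes W :: "'a::real_inner set"
  assumes "finite_dimensional W" "subspace W"
  obtains D where "finite D" "orthonormal D" "span D = W" "card D = dim W"
proof -
  obtain S where S: "finite S" "span S = W"
    using finite_dimensional_basis[OF assms] by metis
  obtain C where C: "finite C" "span C = span S" "pairwise orthogonal C"
    using basis_orthogonal[OF S(1)] by blast
  define D where "D = (\<lambda>x. (1 / norm x) *\<^sub>R x) ` (C - {0})"
  have fin: "finite D" using C by (simp add: D_def)
  have "span D = span (C - {0})"
    unfolding D_def by (rule span_image_scale) (use C in auto)
  then have sp: "span D = W" using C S by (simp add: span_delete_0)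
  have on: "orthonormal D"
    using C(3) unfolding orthonormal_def pairwise_def D_def orthogonal_def by auto
  have "dim W = card D"
    using dim_eq_card[of D W] sp orthonormal_independent[OF on] assms(2) by (metis span_eq_iff)
  then show ?thesis using that fin sp on by auto
qed

text \<open>The ambient space may have infinite dimension, so Heine-Borel is not at hand.
  Coefficients with respect to an orthonormal \<open>D\<close> are bounded by the norm, hence the
  ball is a closed part of a coordinate cube, and the cube is compact by adding one segment at a
  time.\<close>

lemma compact_finite_span_cball:
  fixes D :: "'a::real_inner set"
  assumes "finite D" "orthonormal D"
  shows "compact {x \<in> span D. norm x \<le> r}"
proof -
  define K where "K D = {\<Sum>e\<in>D. c e *\<^sub>R e | c. \<forall>e\<in>D. \<bar>c e\<bar> \<le> r}" for D :: "'a set"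
  have "compact (K D)" using assms(1)
  proof (induction D rule: finite_induct)
    case empty
    then show ?case by (simp add: K_def)
  next
    case (insert x D)
    have "K (insert x D) = {a + b | a b. a \<in> (\<lambda>t. t *\<^sub>R x) ` {-r..r} \<and> b \<in> K D}" (is "_ = ?R")
    proof (intro set_eqI iffI)
      fix y assume "y \<in> K (insert x D)"
      then obtain c where c: "y = (\<Sum>e\<in>insert x D. c e *\<^sub>R e)" "\<forall>e\<in>insert x D. \<bar>c e\<bar> \<le> r"
        unfolding K_def by blast
      have "y = c x *\<^sub>R x + (\<Sum>e\<in>D. c e *\<^sub>R e)" using insert(1,2) c(1) by simp
      moreover have "c x \<in> {-r..r}" using c(2) by (simp add: abs_le_iff)
      moreover have "(\<Sum>e\<in>D. c e *\<^sub>R e) \<in> K D" using c(2) unfolding K_def by blast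
      ultimately show "y \<in> ?R" by blast
    next
      fix y assume "y \<in> ?R"
      then obtain t c where c: "y = t *\<^sub>R x + (\<Sum>e\<in>D. c e *\<^sub>R e)" "t \<in> {-r..r}" "\<forall>e\<in>D. \<bar>c e\<bar> \<le> r"
        unfolding K_def by blast
      have "(\<Sum>e\<in>D. (c(x := t)) e *\<^sub>R e) = (\<Sum>e\<in>D. c e *\<^sub>R e)"
        using insert(2) by (intro sum.cong) auto
      then have "y = (\<Sum>e\<in>insert x D. (c(x := t)) e *\<^sub>R e)" using insert(1,2) c(1) by simp
      moreover have "\<forall>e\<in>insert x D. \<bar>(c(x := t)) e\<bar> \<le> r" using c(2,3) by (simp add: abs_le_iff)
      ultimately show "y \<in> K (insert x D)" unfolding K_def by blast
    qed
    moreover have "compact ((\<lambda>t. t *\<^sub>R x) ` {-r..r})"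
      by (intro compact_continuous_image continuous_intros compact_Icc)
    ultimately show ?case using compact_sums[OF _ insert.IH, of "(\<lambda>t. t *\<^sub>R x) ` {-r..r}"] by simp
  qed
  moreover have "{x \<in> span D. norm x \<le> r} = K D \<inter> cball 0 r"
  proof (intro set_eqI iffI)
    fix x assume x: "x \<in> {x \<in> span D. norm x \<le> r}"
    then have "x = (\<Sum>e\<in>D. inner x e *\<^sub>R e)" using orthonormal_expand assms by force
    moreover have "\<forall>e\<in>D. \<bar>inner x e\<bar> \<le> r"
    proof
      fix e assume "e \<in> D"
      then show "\<bar>inner x e\<bar> \<le> r"
        using Cauchy_Schwarz_ineq2[of x e] x assms by (simp add: orthonormal_def)
    qed
    ultimately show "x \<in> K D \<inter> cball 0 r" using x unfolding K_def by auto
  next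
    fix x assume "x \<in> K D \<inter> cball 0 r"
    then show "x \<in> {x \<in> span D. norm x \<le> r}"
      by (auto simp: K_def intro: span_sum span_scale span_base)
  qed
  ultimately show ?thesis using compact_Int_closed[of "K D" "cball 0 r"] by simp
qed

text \<open>A convergent sequence is bounded, so all its terms lie in one of the compact balls of
  the preceding lemma.\<close>

lemma closed_finite_dimensional:
  fixes W :: "'a::real_inner set"
  assumes "finite_dimensional W" "subspace W"
  shows "closed W"
proof -
  obtain D where D: "finite D" "orthonormal D" "span D = W"
    using orthonormal_basis_exists[OF assms] by metis
  show ?thesis unfolding closed_sequential_limits
  proof (intro allI impI, elim conjE)
    fix x l assume x: "\<forall>n. x n \<in> W" "x \<longlonglongrightarrow> l"
    then obtain r where r: "\<And>n. norm (x n) \<le> r"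
      using convergent_imp_bounded[OF x(2)] by (auto simp: bounded_iff)
    have "closed {y \<in> span D. norm y \<le> r}"
      by (rule compact_imp_closed[OF compact_finite_span_cball[OF D(1,2)]])
    then have "l \<in> {y \<in> span D. norm y \<le> r}"
      by (rule closed_sequentially[OF _ _ x(2)]) (use x r D in auto)
    then show "l \<in> W" using D by simp
  qed
qed

text \<open>First-variation argument: a nonzero linear term cannot stay below a multiple of
  \<open>t\<^sup>2\<close> for all \<open>t\<close>. It yields the Euler equations of the two
  extremal problems below, the Rayleigh quotient and the nearest point.\<close>

lemma linear_le_quadratic_imp_zero:
  fixes g q :: real
  assumes "\<And>t. 2 * t * g \<le> t\<^sup>2 * q"
  shows "g = 0"
proof (cases "q > 0")
  case True
  have "2 * (g / q) * g \<le> (g / q)\<^sup>2 * q" by (rule assms)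
  also have "\<dots> = (g / q) * g" using True by (simp add: power2_eq_square)
  finally have "g * g / q \<le> 0" by simp
  then have "g * g \<le> 0" using True by (simp add: divide_le_0_iff)
  then show ?thesis by (simp add: mult_le_0_iff) linarith
next
  case False
  have "2 * g * g \<le> g\<^sup>2 * q" by (rule assms)
  also have "\<dots> \<le> 0" using False by (simp add: mult_nonneg_nonpos)
  finally have "g * g \<le> 0" by simp
  then show ?thesis by (simp add: mult_le_0_iff) linarith
qed

text \<open>A maximiser of the Rayleigh quotient on the unit sphere of \<open>W\<close> is an
  eigenvector. It is compared with \<open>e + t y\<close> for every direction \<open>y\<close> in
  \<open>W\<close>; symmetry merges the two mixed terms into \<open>2 t (T e, y)\<close>.\<close>

lemma symmetric_eigenvector_exists:
  fixes T :: "'a::real_inner \<Rightarrow> 'a"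
  assumes "finite_dimensional W" "subspace W" "W \<noteq> {0}" "bounded_linear T" "T ` W \<subseteq> W"
    and sym: "\<And>x y. x \<in> W \<Longrightarrow> y \<in> W \<Longrightarrow> inner (T x) y = inner x (T y)"
  obtains e l where "e \<in> W" "norm e = 1" "T e = l *\<^sub>R e"
proof -
  interpret T: bounded_linear T by fact
  obtain D where D: "finite D" "orthonormal D" "span D = W"
    using orthonormal_basis_exists[OF assms(1,2)] by metis
  define S where "S = {x \<in> span D. norm x \<le> 1} \<inter> {x. norm x = 1}"
  have S: "compact S" unfolding S_def
    by (intro compact_Int_closed compact_finite_span_cball D closed_Collect_eq continuous_intros)
  obtain x where "x \<in> W" "x \<noteq> 0" using assms(2,3) subspace_0 by blast
  then have "(1 / norm x) *\<^sub>R x \<in> S" using D assms(2) by (auto simp: S_def intro: subspace_scale)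
  then have "S \<noteq> {}" by blast
  moreover have "continuous_on S (\<lambda>x. inner (T x) x)"
    by (intro continuous_intros T.continuous_on)
  ultimately obtain e where e: "e \<in> S" "\<And>x. x \<in> S \<Longrightarrow> inner (T x) x \<le> inner (T e) e"
    using continuous_attains_sup[OF S] by blast
  define l where "l = inner (T e) e"
  have eW: "e \<in> W" "norm e = 1" using e D by (auto simp: S_def)
  \<comment> \<open>Homogeneous form of maximality, so that \<open>e + t y\<close> need not be
    normalised below.\<close>
  have ray: "inner (T x) x \<le> l * (norm x)\<^sup>2" if "x \<in> W" for x
  proof (cases "x = 0")
    case False
    then have "(1 / norm x) *\<^sub>R x \<in> S" using D assms(2) that by (auto simp: S_def intro: subspace_scale)
    from e(2)[OF this] False show ?thesis
      by (simp add: T.scaleR l_def power2_eq_square field_simps)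
  qed (simp add: T.zero)
  have "inner (T e - l *\<^sub>R e) y = 0" if y: "y \<in> W" for y
  proof (rule linear_le_quadratic_imp_zero)
    fix t
    have "e + t *\<^sub>R y \<in> W" using eW y assms(2) by (auto intro: subspace_add subspace_scale)
    from ray[OF this] have "inner (T e) e + 2 * t * inner (T e) y + t\<^sup>2 * inner (T y) y
      \<le> l * (inner e e + 2 * t * inner e y + t\<^sup>2 * inner y y)"
      using sym[OF y eW(1)]
      by (simp add: T.add T.scaleR power2_norm_eq_inner inner_simps inner_commute power2_eq_square[of t] algebra_simps)
    then show "2 * t * inner (T e - l *\<^sub>R e) y \<le> t\<^sup>2 * (l * inner y y - inner (T y) y)"
      using eW(2) by (simp add: l_def inner_diff_left norm_eq_1 algebra_simps)
  qed
  moreover have "T e - l *\<^sub>R e \<in> W" using assms(2,5) eW by (blast intro: subspace_diff subspace_scale)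
  ultimately have "T e = l *\<^sub>R e" by (metis inner_eq_zero_iff right_minus_eq)
  then show ?thesis using that eW by blast
qed

text \<open>Instead of an induction on the dimension, an orthonormal set of eigenvectors of greatest
  cardinality is taken. If it failed to span, its orthogonal complement in \<open>W\<close> would be
  invariant by symmetry and would contribute one more eigenvector.\<close>

lemma symmetric_eigenbasis_exists:
  fixes T :: "'a::real_inner \<Rightarrow> 'a"
  assumes "finite_dimensional W" "subspace W" "bounded_linear T" "T ` W \<subseteq> W"
    and sym: "\<And>x y. x \<in> W \<Longrightarrow> y \<in> W \<Longrightarrow> inner (T x) y = inner x (T y)"
  obtains D l where "finite D" "orthonormal D" "span D = W" "\<And>e. e \<in> D \<Longrightarrow> T e = l e *\<^sub>R e"
proof -
  define P where "P D \<longleftrightarrow> orthonormal D \<and> D \<subseteq> W \<and> (\<forall>e\<in>D. \<exists>l. T e = l *\<^sub>R e)" for D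
  have bd: "finite D \<and> card D \<le> dim W" if "P D" for D
    using card_independent_le_dim[OF assms(1,2) orthonormal_independent] that by (auto simp: P_def)
  have "\<exists>D. P D \<and> (\<forall>D'. P D' \<longrightarrow> card D' \<le> card D)"
  proof -
    have "P {}" by (simp add: P_def orthonormal_def)
    then show ?thesis using ex_has_greatest_nat[of P "{}" card "Suc (dim W)"] bd le_imp_less_Suc by blast
  qed
  then obtain D where D: "P D" "\<And>D'. P D' \<Longrightarrow> card D' \<le> card D" by blast
  have fin: "finite D" using bd D by blast
  have on: "orthonormal D" using D by (simp add: P_def)
  have DW: "span D \<subseteq> W" using D assms(2) by (simp add: P_def span_minimal)
  have "span D = W"
  proof (rule ccontr)
    assume "span D \<noteq> W"
    then obtain f where f: "f \<in> W" "f \<notin> span D" using DW by blast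
    define W' where "W' = {x \<in> W. \<forall>e\<in>D. inner x e = 0}"
    have sub: "subspace W'" using assms(2)
      by (auto simp: W'_def subspace_def inner_simps)
    define g where "g = f - (\<Sum>d\<in>D. inner f d *\<^sub>R d)"
    have "(\<Sum>d\<in>D. inner f d *\<^sub>R d) \<in> span D" by (auto intro: span_sum span_scale span_base)
    then have "g \<noteq> 0" "g \<in> W" using f DW assms(2) by (auto simp: g_def intro: subspace_diff)
    then have g: "g \<in> W'" "g \<noteq> 0" using orthonormal_residual[OF on fin] by (auto simp: g_def W'_def)
    have inv: "T ` W' \<subseteq> W'"
    proof (clarsimp simp: W'_def, intro conjI ballI)
      fix x assume x: "x \<in> W" "\<forall>e\<in>D. inner x e = 0"
      show "T x \<in> W" using x assms by auto
      fix e assume e: "e \<in> D"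
      then obtain l where "T e = l *\<^sub>R e" using D(1) unfolding P_def by blast
      then show "inner (T x) e = 0" using sym[OF x(1), of e] e D(1) x by (auto simp: P_def)
    qed
    obtain e l where e: "e \<in> W'" "norm e = 1" "T e = l *\<^sub>R e"
    proof (rule symmetric_eigenvector_exists[OF _ sub _ assms(3) inv])
      show "finite_dimensional W'" by (rule finite_dimensional_subset[OF assms(1)]) (auto simp: W'_def)
      show "W' \<noteq> {0}" using g by auto
    qed (auto simp: W'_def intro: sym)
    have orth: "inner e d = 0" "inner d e = 0" if "d \<in> D" for d
      using e(1) that by (auto simp: W'_def inner_commute)
    have "e \<notin> D" using orth(1)[of e] e(2) by auto
    moreover have "orthonormal (insert e D)"
      using on e(2) orth by (auto simp: orthonormal_def pairwise_insert orthogonal_def)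
    then have "P (insert e D)"
      using D(1) e(1,3) unfolding P_def W'_def by blast
    ultimately show False using D(2)[of "insert e D"] fin by simp
  qed
  moreover have "\<exists>l. \<forall>e\<in>D. T e = l e *\<^sub>R e" using D(1) unfolding P_def by metis
  ultimately show ?thesis using that fin on by blast
qed

text \<open>A minimising sequence for the distance is Cauchy by the parallelogram identity, and
  completeness provides the minimiser. Orthogonality of the residual is the vanishing first
  variation.\<close>

lemma orthogonal_projection_exists:
  fixes X :: "'a::{real_inner,complete_space} set"
  assumes X: "closed X" "subspace X"
  obtains y where "y \<in> X" "\<And>x. x \<in> X \<Longrightarrow> inner (z - y) x = 0"
proof -
  define d where "d = infdist z X"
  have ne: "X \<noteq> {}" using X subspace_0 by blast
  have d0: "d \<ge> 0" by (simp add: d_def infdist_nonneg)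
  have low: "d \<le> dist z x" if "x \<in> X" for x using infdist_le[OF that] by (simp add: d_def)
  have "\<exists>y\<in>X. dist z y < d + 1 / real (Suc n)" for n
  proof -
    have "(INF a\<in>X. dist z a) < d + 1 / real (Suc n)" using ne by (simp add: d_def infdist_def)
    then show ?thesis using ne by (subst (asm) cINF_less_iff) auto
  qed
  then obtain y where y: "\<And>n. y n \<in> X" "\<And>n. dist z (y n) < d + 1 / real (Suc n)" by metis
  \<comment> \<open>The midpoint of \<open>y m\<close> and \<open>y n\<close> lies in
    \<open>X\<close> and is therefore at distance at least \<open>d\<close> from
    \<open>z\<close>.\<close>
  have par: "(dist (y m) (y n))\<^sup>2 \<le> 2 * (dist z (y m))\<^sup>2 + 2 * (dist z (y n))\<^sup>2 - 4 * d\<^sup>2" for m n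
  proof -
    have "(1/2) *\<^sub>R (y m + y n) \<in> X" using y X by (intro subspace_scale subspace_add) auto
    then have "d\<^sup>2 \<le> (dist z ((1/2) *\<^sub>R (y m + y n)))\<^sup>2" using low d0 by (simp add: power_mono)
    then show ?thesis
      by (simp add: dist_norm power2_norm_eq_inner inner_simps inner_commute algebra_simps)
  qed
  have lim: "(\<lambda>n. dist z (y n)) \<longlonglongrightarrow> d"
  proof (rule tendsto_sandwich)
    show "\<forall>\<^sub>F n in sequentially. d \<le> dist z (y n)" using low y by simp
    show "\<forall>\<^sub>F n in sequentially. dist z (y n) \<le> d + 1 / real (Suc n)"
      using y by (simp add: less_imp_le)
    show "(\<lambda>n. d + 1 / real (Suc n)) \<longlonglongrightarrow> d"
      using tendsto_add[OF tendsto_const LIMSEQ_inverse_real_of_nat] by (simp add: inverse_eq_divide)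
  qed simp
  have "Cauchy y"
  proof (rule metric_CauchyI)
    fix e :: real assume e: "e > 0"
    have "(\<lambda>n. (dist z (y n))\<^sup>2) \<longlonglongrightarrow> d\<^sup>2" using lim by (intro tendsto_intros)
    then have "\<forall>\<^sub>F n in sequentially. (dist z (y n))\<^sup>2 < d\<^sup>2 + e\<^sup>2 / 4"
      using e by (intro order_tendstoD) auto
    then obtain N where N: "\<And>n. n \<ge> N \<Longrightarrow> (dist z (y n))\<^sup>2 < d\<^sup>2 + e\<^sup>2 / 4"
      by (auto simp: eventually_sequentially)
    have "dist (y m) (y n) < e" if "m \<ge> N" "n \<ge> N" for m n
    proof -
      have "(dist (y m) (y n))\<^sup>2 < e\<^sup>2" using par[of m n] N[OF that(1)] N[OF that(2)] by linarith
      then show ?thesis using e by (simp add: power_less_imp_less_base)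
    qed
    then show "\<exists>M. \<forall>m\<ge>M. \<forall>n\<ge>M. dist (y m) (y n) < e" by blast
  qed
  then obtain l where l: "y \<longlonglongrightarrow> l" using Cauchy_convergent convergent_def by blast
  then have lX: "l \<in> X" using X(1) y(1) closed_sequentially by blast
  have "(\<lambda>n. dist z (y n)) \<longlonglongrightarrow> dist z l" using l by (intro tendsto_intros)
  then have dl: "dist z l = d" using lim LIMSEQ_unique by blast
  have "inner (z - l) x = 0" if x: "x \<in> X" for x
  proof (rule linear_le_quadratic_imp_zero)
    fix t
    have "l + t *\<^sub>R x \<in> X" using lX x X(2) by (auto intro: subspace_add subspace_scale)
    then have "(dist z l)\<^sup>2 \<le> (dist z (l + t *\<^sub>R x))\<^sup>2" using low dl by (metis d0 power_mono)
    then show "2 * t * inner (z - l) x \<le> t\<^sup>2 * (norm x)\<^sup>2"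
      by (simp add: dist_norm power2_norm_eq_inner inner_simps inner_commute power2_eq_square[of t] algebra_simps)
  qed
  then show ?thesis using that lX by blast
qed

section \<open>Symmetric eigenvalue problems on stable subspaces\<close>

text \<open>\<open>A\<close> represents the form \<open>a\<close>, and \<open>Bs\<close> is the
  adjoint of \<open>B\<close>. The form \<open>b\<close> sees a vector only through
  \<open>B\<close>, so the spectral theory is carried out in the target type
  \<open>'l\<close>.\<close>

locale symmetric_form =
  fixes A :: "'z::{real_inner,complete_space} \<Rightarrow> 'z" and B :: "'z \<Rightarrow> 'l::{real_inner,complete_space}"
    and Bs :: "'l \<Rightarrow> 'z"
  assumes A: "bounded_linear A" and A_sym: "inner (A U) W = inner U (A W)"
    and B: "bounded_linear B" and Bs: "bounded_linear Bs"
    and adj: "inner (Bs f) U = inner f (B U)"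
begin

sublocale A: bounded_linear A by (rule A)
sublocale B: bounded_linear B by (rule B)
sublocale Bs: bounded_linear Bs by (rule Bs)

abbreviation a :: "'z \<Rightarrow> 'z \<Rightarrow> real" where "a U W \<equiv> inner (A U) W"
abbreviation b :: "'z \<Rightarrow> 'z \<Rightarrow> real" where "b U W \<equiv> inner (B U) (B W)"

text \<open>Encodes the presence of at least \<open>k\<close> eigenvalues in \<open>I\<close>,
  counted with multiplicity. Orthonormality is asked of the images under \<open>B\<close> because
  \<open>b\<close> is only semidefinite; on stable subspaces nothing is lost, as \<open>B\<close> is
  injective on each eigenspace.\<close>

definition orthosys :: "'z set \<Rightarrow> real set \<Rightarrow> nat \<Rightarrow> bool" where
  "orthosys X I k \<longleftrightarrow> (\<exists>D. finite D \<and> card D = k \<and> orthonormal D \<and>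
     (\<forall>e\<in>D. \<exists>\<mu>\<in>I. \<exists>U\<in>eigenspace X a b \<mu>. B U = e))"

lemma orthosys_mono:
  assumes "orthosys X I k" "I \<subseteq> I'" "k' \<le> k"
  shows "orthosys X I' k'"
proof -
  obtain D where D: "finite D" "card D = k" "orthonormal D"
    "\<forall>e\<in>D. \<exists>\<mu>\<in>I. \<exists>U\<in>eigenspace X a b \<mu>. B U = e"
    using assms(1) by (auto simp: orthosys_def)
  obtain D' where D': "D' \<subseteq> D" "card D' = k'" "finite D'"
    using obtain_subset_with_card_n[of k' D] assms(3) D(2) by metis
  then show ?thesis unfolding orthosys_def using D(3,4) assms(2) orthonormal_subset
    by (intro exI[of _ D']) blast
qed

end

text \<open>One locale for \<open>V\<close> and for every discrete space, with the same
  \<open>C\<close>. Stability bounds \<open>U\<close> by the size of the functional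
  \<open>a U\<close>, which is the form in which an inf-sup condition is used. Positivity is asked
  only at solutions of source problems, since the mixed form is indefinite on the whole
  space.\<close>

locale stable_subspace = symmetric_form A B Bs
  for A :: "'z::{real_inner,complete_space} \<Rightarrow> 'z" and B :: "'z \<Rightarrow> 'l::{real_inner,complete_space}"
    and Bs :: "'l \<Rightarrow> 'z" +
  fixes X :: "'z set" and C :: real
  assumes closed_X: "closed X" and subspace_X: "subspace X"
    and C_pos: "C > 0"
    and stable: "\<And>U \<eta>. U \<in> X \<Longrightarrow> 0 \<le> \<eta> \<Longrightarrow> (\<And>W. W \<in> X \<Longrightarrow> a U W \<le> \<eta> * norm W) \<Longrightarrow> norm U \<le> C * \<eta>"
    and pos: "\<And>U f. U \<in> X \<Longrightarrow> (\<And>W. W \<in> X \<Longrightarrow> a U W = inner f (B W)) \<Longrightarrow> 0 \<le> a U U"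
begin

lemma unique_zero: "U \<in> X \<Longrightarrow> (\<And>W. W \<in> X \<Longrightarrow> a U W = 0) \<Longrightarrow> U = 0"
  using stable[of U 0] by simp

lemma solution_bound:
  assumes "U \<in> X" "\<And>W. W \<in> X \<Longrightarrow> a U W = inner z W"
  shows "norm U \<le> C * norm z"
  by (rule stable) (use assms norm_cauchy_schwarz in auto)

text \<open>Closed-range argument. \<open>R\<close> collects the loads in \<open>X\<close> that
  admit a solution; stability makes the solutions of convergent loads Cauchy, so \<open>R\<close> is
  closed. The component of a load orthogonal to \<open>R\<close> solves the homogeneous problem by
  symmetry and therefore vanishes.\<close>

lemma solution_exists: "\<exists>U\<in>X. \<forall>W\<in>X. a U W = inner z W"
proof -
  define R where "R = {y \<in> X. \<exists>U\<in>X. \<forall>W\<in>X. a U W = inner y W}"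
  have "subspace R" unfolding subspace_def
  proof (intro conjI allI impI ballI)
    show "0 \<in> R" using subspace_0[OF subspace_X] by (force simp: R_def A.zero)
    fix x y assume "x \<in> R" "y \<in> R"
    then obtain U V where UV: "U \<in> X" "V \<in> X" "x \<in> X" "y \<in> X"
      "\<forall>W\<in>X. a U W = inner x W" "\<forall>W\<in>X. a V W = inner y W" unfolding R_def by blast
    then have "\<forall>W\<in>X. a (U + V) W = inner (x + y) W" by (simp add: A.add inner_add_left)
    then show "x + y \<in> R" using UV subspace_X unfolding R_def by (blast intro: subspace_add)
  next
    fix c x assume "x \<in> R"
    then obtain U where U: "U \<in> X" "x \<in> X" "\<forall>W\<in>X. a U W = inner x W" unfolding R_def by blast
    then have "\<forall>W\<in>X. a (c *\<^sub>R U) W = inner (c *\<^sub>R x) W" by (simp add: A.scaleR)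
    then show "c *\<^sub>R x \<in> R" using U subspace_X unfolding R_def by (blast intro: subspace_scale)
  qed
  moreover have "closed R" unfolding closed_sequential_limits
  proof (intro allI impI, elim conjE)
    fix y l assume y: "\<forall>n. y n \<in> R" "y \<longlonglongrightarrow> l"
    have lX: "l \<in> X" using closed_X y closed_sequentially[of X y l] by (auto simp: R_def)
    have "\<forall>n. \<exists>U. U \<in> X \<and> (\<forall>W\<in>X. a U W = inner (y n) W)" using y(1) unfolding R_def by blast
    then obtain U where U: "\<And>n. U n \<in> X" "\<And>n W. W \<in> X \<Longrightarrow> a (U n) W = inner (y n) W" by metis
    have d: "dist (U m) (U n) \<le> C * dist (y m) (y n)" for m n
      unfolding dist_norm
      by (rule solution_bound) (use U subspace_X in \<open>auto simp: A.diff inner_diff_left intro: subspace_diff\<close>)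
    have "Cauchy U"
    proof (rule metric_CauchyI)
      fix e :: real assume "e > 0"
      then obtain N where N: "\<forall>m\<ge>N. \<forall>n\<ge>N. dist (y m) (y n) < e / C"
        using LIMSEQ_imp_Cauchy[OF y(2)] C_pos unfolding Cauchy_def by (meson divide_pos_pos)
      have "dist (U m) (U n) < e" if "m \<ge> N" "n \<ge> N" for m n
      proof -
        have "dist (y m) (y n) < e / C" using N that by blast
        then have "C * dist (y m) (y n) < e" using C_pos by (simp add: field_simps)
        then show ?thesis using d[of m n] by linarith
      qed
      then show "\<exists>N. \<forall>m\<ge>N. \<forall>n\<ge>N. dist (U m) (U n) < e" by blast
    qed
    then obtain V where V: "U \<longlonglongrightarrow> V" using Cauchy_convergent convergent_def by blast
    then have VX: "V \<in> X" using closed_X U(1) closed_sequentially by blast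
    have "a V W = inner l W" if W: "W \<in> X" for W
    proof -
      have "(\<lambda>n. a (U n) W) \<longlonglongrightarrow> a V W" by (intro tendsto_intros A.tendsto V)
      moreover have "(\<lambda>n. a (U n) W) \<longlonglongrightarrow> inner l W"
        using U(2)[OF W] tendsto_inner[OF y(2) tendsto_const] by simp
      ultimately show ?thesis using LIMSEQ_unique by blast
    qed
    then show "l \<in> R" using lX VX unfolding R_def by blast
  qed
  ultimately obtain Pr where Pr: "\<And>x. Pr x \<in> R" "\<And>x y. y \<in> R \<Longrightarrow> inner (x - Pr x) y = 0"
    using orthogonal_projection_exists by metis
  obtain P where P: "\<And>x. P x \<in> X" "\<And>x y. y \<in> X \<Longrightarrow> inner (x - P x) y = 0"
    using orthogonal_projection_exists closed_X subspace_X by metis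
  define s where "s = P z - Pr (P z)"
  have sX: "s \<in> X" using P Pr subspace_X by (auto simp: s_def R_def intro: subspace_diff)
  have "a s U = 0" if U: "U \<in> X" for U
  proof -
    \<comment> \<open>The functional \<open>a U\<close>, represented in \<open>X\<close>, lies in
      \<open>R\<close> and is thus orthogonal to \<open>s\<close>; exchanging the arguments gives
      \<open>a s U = 0\<close>.\<close>
    have PA: "inner (A U) W = inner (P (A U)) W" if "W \<in> X" for W
      using P(2)[OF that, of "A U"] by (simp add: inner_diff_left)
    then have "P (A U) \<in> R" using P U unfolding R_def by blast
    then have "inner (P (A U)) s = 0" using Pr(2)[of "P (A U)" "P z"] by (simp add: s_def inner_commute)
    then show ?thesis using PA[OF sX] by (metis A_sym inner_commute)
  qed
  then have "s = 0" using unique_zero sX by blast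
  then have "P z \<in> R" using Pr(1)[of "P z"] by (simp add: s_def)
  then obtain U where U: "U \<in> X" "\<forall>W\<in>X. a U W = inner (P z) W" unfolding R_def by blast
  have "inner (P z) W = inner z W" if "W \<in> X" for W
    using P(2)[OF that, of z] by (simp add: inner_diff_left)
  then show ?thesis using U by auto
qed

section \<open>Solution operators and their spectrum\<close>

definition sol :: "'z \<Rightarrow> 'z" where
  "sol z = (SOME U. U \<in> X \<and> (\<forall>W\<in>X. a U W = inner z W))"

lemma sol: "sol z \<in> X" "W \<in> X \<Longrightarrow> a (sol z) W = inner z W"
  using someI_ex[of "\<lambda>U. U \<in> X \<and> (\<forall>W\<in>X. a U W = inner z W)"] solution_exists[of z]
  unfolding sol_def by blast+

lemma sol_eqI:
  assumes "U \<in> X" "\<And>W. W \<in> X \<Longrightarrow> a U W = inner z W"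
  shows "sol z = U"
proof -
  have "sol z - U = 0"
    by (rule unique_zero)
      (use assms sol subspace_X in \<open>auto simp: A.diff inner_diff_left intro: subspace_diff\<close>)
  then show ?thesis by simp
qed

lemma norm_sol: "norm (sol z) \<le> C * norm z"
  by (rule solution_bound) (auto simp: sol)

sublocale sol: bounded_linear sol
proof (rule bounded_linear_intro)
  show "sol (x + y) = sol x + sol y" for x y
    by (rule sol_eqI) (use sol subspace_X in \<open>auto simp: A.add inner_add_left intro: subspace_add\<close>)
  show "sol (r *\<^sub>R x) = r *\<^sub>R sol x" for r x
    by (rule sol_eqI) (use sol subspace_X in \<open>auto simp: A.scaleR intro: subspace_scale\<close>)
  show "norm (sol x) \<le> norm x * C" for x using norm_sol by (simp add: mult.commute)
qed

lemma sol_A: "U \<in> X \<Longrightarrow> sol (A U) = U"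
  by (rule sol_eqI) auto

lemma sol_Bs_eq_0:
  assumes "\<And>W. W \<in> X \<Longrightarrow> inner f (B W) = 0"
  shows "sol (Bs f) = 0"
  by (rule sol_eqI) (use assms subspace_X in \<open>auto simp: A.zero adj subspace_0\<close>)

definition T :: "'l \<Rightarrow> 'l" where "T f = B (sol (Bs f))"

sublocale T: bounded_linear T
  unfolding T_def
  by (intro bounded_linear_compose[OF B] bounded_linear_compose[OF sol.bounded_linear_axioms] Bs)

text \<open>Symmetry and nonnegativity of \<open>T\<close> are read off here: the right-hand side is
  \<open>a\<close> at two solutions, and for \<open>f = g\<close> the locale assumption
  \<open>pos\<close> applies.\<close>

lemma T_inner: "inner (T f) g = a (sol (Bs g)) (sol (Bs f))"
  by (simp add: T_def sol adj inner_commute[of _ g])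

lemma T_sym: "inner (T f) g = inner f (T g)"
  by (metis T_inner A_sym inner_commute)

lemma T_nonneg: "0 \<le> inner (T f) f"
  unfolding T_inner by (rule pos[of _ f]) (auto simp: sol adj)

text \<open>The eigenvalue equation as a fixed point of the solution operator. It involves no
  division by \<open>\<mu>\<close>, so \<open>\<mu> = 0\<close> needs no separate treatment.\<close>

lemma eigenspace_iff: "U \<in> eigenspace X a b \<mu> \<longleftrightarrow> U \<in> X \<and> U = \<mu> *\<^sub>R sol (Bs (B U))"
proof
  assume "U \<in> eigenspace X a b \<mu>"
  then have U: "U \<in> X" "\<And>W. W \<in> X \<Longrightarrow> a U W = \<mu> * b U W" by (auto simp: eigenspace_def)
  have "sol (\<mu> *\<^sub>R Bs (B U)) = U" by (rule sol_eqI) (use U in \<open>auto simp: adj\<close>)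
  then show "U \<in> X \<and> U = \<mu> *\<^sub>R sol (Bs (B U))" using U by (simp add: sol.scaleR)
next
  assume U: "U \<in> X \<and> U = \<mu> *\<^sub>R sol (Bs (B U))"
  have "a U W = \<mu> * b U W" if "W \<in> X" for W
  proof -
    have "a U W = a (\<mu> *\<^sub>R sol (Bs (B U))) W" using U by simp
    then show ?thesis using that by (simp only: A.scaleR sol inner_scaleR_left adj)
  qed
  then show "U \<in> eigenspace X a b \<mu>" using U by (auto simp: eigenspace_def)
qed

lemma eigenspace_subset: "eigenspace X a b \<mu> \<subseteq> X" by (auto simp: eigenspace_def)

lemma subspace_eigenspace: "subspace (eigenspace X a b \<mu>)"
  using subspace_X unfolding subspace_def eigenspace_def
  by (auto simp: A.zero A.add A.scaleR B.zero B.add B.scaleR inner_add_left distrib_left)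

lemma eigenspace_T: "U \<in> eigenspace X a b \<mu> \<Longrightarrow> B U = \<mu> *\<^sub>R T (B U)"
  unfolding T_def by (metis eigenspace_iff B.scaleR)

text \<open>If \<open>B U\<close> vanished, the load of \<open>U\<close> would vanish and with it
  \<open>U\<close>. Pairing the fixed-point equation with \<open>B U\<close> and using
  \<open>T_nonneg\<close> then fixes the sign of \<open>\<mu>\<close>.\<close>

lemma eigen_pos:
  assumes "U \<in> eigenspace X a b \<mu>" "U \<noteq> 0"
  shows "\<mu> > 0" "B U \<noteq> 0"
proof -
  show B0: "B U \<noteq> 0"
    using assms eigenspace_iff[of U \<mu>] by (auto simp: Bs.zero sol.zero)
  have "inner (B U) (B U) = \<mu> * inner (T (B U)) (B U)"
    by (metis eigenspace_T[OF assms(1)] inner_scaleR_left)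
  moreover have "inner (B U) (B U) > 0" using B0 by simp
  ultimately show "\<mu> > 0" using T_nonneg[of "B U"] by (metis not_le mult_nonneg_nonneg zero_less_mult_pos2 less_le mult_eq_0_iff)
qed

lemma inj_on_B_eigenspace: "inj_on B (eigenspace X a b \<mu>)"
proof (rule inj_onI)
  fix U W assume UW: "U \<in> eigenspace X a b \<mu>" "W \<in> eigenspace X a b \<mu>" "B U = B W"
  then have "U - W \<in> eigenspace X a b \<mu>" "B (U - W) = 0"
    using subspace_eigenspace by (auto simp: B.diff intro: subspace_diff)
  then show "U = W" using eigen_pos(2)[of "U - W" \<mu>] by auto
qed

lemma eigenspace_orthogonal:
  assumes "U \<in> eigenspace X a b \<mu>" "W \<in> eigenspace X a b \<nu>" "\<mu> \<noteq> \<nu>"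
  shows "inner (B U) (B W) = 0"
proof -
  have UW: "U \<in> X" "W \<in> X" using assms eigenspace_subset by auto
  have "\<mu> * inner (B U) (B W) = a U W" using assms UW by (simp add: eigenspace_def)
  also have "\<dots> = a W U" by (metis A_sym inner_commute)
  also have "\<dots> = \<nu> * inner (B U) (B W)" using assms UW by (simp add: eigenspace_def inner_commute)
  finally show ?thesis using assms(3) by auto
qed

lemma T_eigenvector:
  assumes "T e = t *\<^sub>R e" "t \<noteq> 0"
  shows "(1 / t) *\<^sub>R sol (Bs e) \<in> eigenspace X a b (1 / t)" "B ((1 / t) *\<^sub>R sol (Bs e)) = e"
proof -
  show 1: "B ((1 / t) *\<^sub>R sol (Bs e)) = e" using assms by (simp add: B.scaleR flip: T_def)
  show "(1 / t) *\<^sub>R sol (Bs e) \<in> eigenspace X a b (1 / t)"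
    unfolding eigenspace_iff 1 using sol subspace_X by (auto intro: subspace_scale)
qed

lemma T_eigenvalue_nonneg:
  assumes "T e = t *\<^sub>R e" "e \<noteq> 0"
  shows "t \<ge> 0"
proof -
  have "inner (T e) e = t * inner e e" by (simp add: assms)
  moreover have "inner e e > 0" using assms(2) by simp
  ultimately show ?thesis using T_nonneg[of e] by (metis not_le zero_le_mult_iff)
qed

text \<open>Supplies a lower bound for the eigenvalues in a half-line \<open>{..c}\<close>, which
  makes them bounded and thus accessible to compactness.\<close>

lemma orthosys_positive: "orthosys X I k \<Longrightarrow> orthosys X (I \<inter> {0<..}) k"
proof -
  assume "orthosys X I k"
  then obtain D where D: "finite D" "card D = k" "orthonormal D"
    "\<forall>e\<in>D. \<exists>\<mu>\<in>I. \<exists>U\<in>eigenspace X a b \<mu>. B U = e"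
    by (auto simp: orthosys_def)
  have "\<exists>\<mu>\<in>I \<inter> {0<..}. \<exists>U\<in>eigenspace X a b \<mu>. B U = e" if e: "e \<in> D" for e
  proof -
    obtain \<mu> U where U: "\<mu> \<in> I" "U \<in> eigenspace X a b \<mu>" "B U = e" using D(4) e by blast
    have "U \<noteq> 0" using e U D(3) by (auto simp: orthonormal_def B.zero)
    then show ?thesis using U eigen_pos(1)[OF U(2)] by auto
  qed
  then show ?thesis using D unfolding orthosys_def by blast
qed

text \<open>Eigenspaces of distinct eigenvalues have orthogonal images under \<open>B\<close>, and
  \<open>B\<close> preserves their dimensions, so orthonormal bases of the images can be united.
  This is one half of the dictionary between \<open>orthosys\<close> and the sums in
  \<open>kth_eigenvalue\<close>.\<close>

lemma orthosys_of_dims: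
  assumes "finite J" "\<And>\<mu>. \<mu> \<in> J \<Longrightarrow> finite_dimensional (eigenspace X a b \<mu>)"
    and "k \<le> (\<Sum>\<mu>\<in>J. dim (eigenspace X a b \<mu>))"
  shows "orthosys X J k"
proof -
  have "\<exists>D. finite D \<and> card D = dim (eigenspace X a b \<mu>) \<and> orthonormal D \<and> D \<subseteq> B ` eigenspace X a b \<mu>"
    if mu: "\<mu> \<in> J" for \<mu>
  proof -
    let ?E = "eigenspace X a b \<mu>"
    obtain S where S: "finite S" "independent S" "span S = ?E" "card S = dim ?E"
      using finite_dimensional_basis[OF assms(2)[OF mu] subspace_eigenspace] by metis
    have "finite_dimensional (B ` ?E)" "subspace (B ` ?E)"
      using finite_dimensional_linear_image[OF assms(2)[OF mu] B.linear]
        linear_subspace_image[OF B.linear subspace_eigenspace] by auto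
    then obtain D where D: "finite D" "orthonormal D" "span D = B ` ?E" "card D = dim (B ` ?E)"
      using orthonormal_basis_exists by metis
    have inj: "inj_on B (span S)" using S(3) inj_on_B_eigenspace by simp
    have "independent (B ` S)"
      using linear_independent_injective_image[OF B.linear S(2) inj] .
    moreover have "span (B ` S) = span (B ` ?E)"
      by (metis S(3) linear_span_image[OF B.linear] span_span)
    ultimately have "dim (B ` ?E) = card (B ` S)" using dim_eq_card by blast
    also have "\<dots> = card S" by (rule card_image) (use inj inj_on_subset span_superset in blast)
    finally show ?thesis using D S span_superset by metis
  qed
  then obtain D where D: "\<And>\<mu>. \<mu> \<in> J \<Longrightarrow> finite (D \<mu>)" "\<And>\<mu>. \<mu> \<in> J \<Longrightarrow> card (D \<mu>) = dim (eigenspace X a b \<mu>)"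
    "\<And>\<mu>. \<mu> \<in> J \<Longrightarrow> orthonormal (D \<mu>)" "\<And>\<mu>. \<mu> \<in> J \<Longrightarrow> D \<mu> \<subseteq> B ` eigenspace X a b \<mu>" by metis
  have orth: "inner e e' = 0" if "\<mu> \<in> J" "\<nu> \<in> J" "\<mu> \<noteq> \<nu>" "e \<in> D \<mu>" "e' \<in> D \<nu>" for \<mu> \<nu> e e'
    using D(4)[OF that(1)] D(4)[OF that(2)] that eigenspace_orthogonal by blast
  have "orthonormal (\<Union>\<mu>\<in>J. D \<mu>)"
    unfolding orthonormal_def
  proof (intro conjI)
    show "\<forall>e\<in>\<Union> (D ` J). norm e = 1" using D(3) by (auto simp: orthonormal_def)
    show "pairwise orthogonal (\<Union> (D ` J))"
    proof (rule pairwiseI)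
      fix e e' assume "e \<in> \<Union> (D ` J)" "e' \<in> \<Union> (D ` J)" and ne: "e \<noteq> e'"
      then obtain \<mu> \<nu> where mn: "\<mu> \<in> J" "\<nu> \<in> J" "e \<in> D \<mu>" "e' \<in> D \<nu>" by blast
      then show "orthogonal e e'"
        using orth D(3)[of \<mu>] ne by (cases "\<mu> = \<nu>") (auto simp: orthonormal_inner orthogonal_def)
    qed
  qed
  moreover have "card (\<Union>\<mu>\<in>J. D \<mu>) = (\<Sum>\<mu>\<in>J. dim (eigenspace X a b \<mu>))"
  proof (subst card_UN_disjoint)
    show "\<forall>i\<in>J. \<forall>j\<in>J. i \<noteq> j \<longrightarrow> D i \<inter> D j = {}"
    proof (intro ballI impI equals0I)
      fix i j e assume *: "i \<in> J" "j \<in> J" "i \<noteq> j" "e \<in> D i \<inter> D j"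
      then have "inner e e = 0" using orth by blast
      then show False using D(3)[OF *(1)] *(4) by (auto simp: orthonormal_def)
    qed
  qed (use assms(1) D in auto)
  moreover have "finite (\<Union>\<mu>\<in>J. D \<mu>)" using assms(1) D(1) by blast
  moreover have "\<forall>e\<in>\<Union>\<mu>\<in>J. D \<mu>. \<exists>\<mu>\<in>J. \<exists>U\<in>eigenspace X a b \<mu>. B U = e"
    using D(4) by blast
  ultimately have "orthosys X J (\<Sum>\<mu>\<in>J. dim (eigenspace X a b \<mu>))"
    unfolding orthosys_def by blast
  then show ?thesis using orthosys_mono assms(3) by blast
qed

text \<open>The other half of the dictionary: those members of an orthonormal system that belong to
  one eigenvalue are independent in the image of its eigenspace.\<close>

lemma dims_of_orthosys:
  assumes "orthosys X I k" "finite J"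
    and "\<And>\<mu>. \<mu> \<in> I \<Longrightarrow> \<mu> \<in> eigenvalues X a b \<Longrightarrow> \<mu> \<in> J"
    and fd: "\<And>\<mu>. \<mu> \<in> J \<Longrightarrow> finite_dimensional (eigenspace X a b \<mu>)"
  shows "k \<le> (\<Sum>\<mu>\<in>J. dim (eigenspace X a b \<mu>))"
proof -
  obtain D where D: "finite D" "card D = k" "orthonormal D"
    "\<forall>e\<in>D. \<exists>\<mu>\<in>I. \<exists>U\<in>eigenspace X a b \<mu>. B U = e"
    using assms(1) by (auto simp: orthosys_def)
  have "D \<subseteq> (\<Union>\<mu>\<in>J. D \<inter> B ` eigenspace X a b \<mu>)"
  proof
    fix e assume e: "e \<in> D"
    then obtain \<mu> U where U: "\<mu> \<in> I" "U \<in> eigenspace X a b \<mu>" "B U = e" using D(4) by blast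
    have "U \<noteq> 0" using e U D(3) by (auto simp: orthonormal_def B.zero)
    then have "\<mu> \<in> J" using assms(3) U by (auto simp: eigenvalues_def eigenpair_def)
    then show "e \<in> (\<Union>\<mu>\<in>J. D \<inter> B ` eigenspace X a b \<mu>)" using U e by blast
  qed
  then have "k \<le> card (\<Union>\<mu>\<in>J. D \<inter> B ` eigenspace X a b \<mu>)"
    using D(1,2) assms(2) by (metis card_mono finite_Int finite_UN_I)
  also have "\<dots> \<le> (\<Sum>\<mu>\<in>J. card (D \<inter> B ` eigenspace X a b \<mu>))"
    using assms(2) by (rule card_UN_le)
  also have "\<dots> \<le> (\<Sum>\<mu>\<in>J. dim (eigenspace X a b \<mu>))"
  proof (rule sum_mono)
    fix \<mu> assume "\<mu> \<in> J"
    then obtain S where S: "finite S" "span S = eigenspace X a b \<mu>" "card S = dim (eigenspace X a b \<mu>)"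
      using finite_dimensional_basis[OF fd subspace_eigenspace] by metis
    have "independent (D \<inter> B ` eigenspace X a b \<mu>)"
      using D(3) orthonormal_subset orthonormal_independent by (metis Int_lower1)
    moreover have "D \<inter> B ` eigenspace X a b \<mu> \<subseteq> span (B ` S)"
      by (simp add: linear_span_image[OF B.linear] S)
    ultimately have "card (D \<inter> B ` eigenspace X a b \<mu>) \<le> card (B ` S)"
      using independent_span_bound S(1) by blast
    also have "\<dots> \<le> card S" using S(1) by (rule card_image_le)
    finally show "card (D \<inter> B ` eigenspace X a b \<mu>) \<le> dim (eigenspace X a b \<mu>)" using S by simp
  qed
  finally show ?thesis .
qed

text \<open>The part of \<open>f\<close> orthogonal to the image of \<open>X\<close> under
  \<open>B\<close> is a load that no test vector in \<open>X\<close> detects.\<close>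

lemma sol_Bs_expand:
  assumes "finite D" "orthonormal D" "span D = B ` X"
  shows "sol (Bs f) = (\<Sum>d\<in>D. inner f d *\<^sub>R sol (Bs d))"
proof -
  have "sol (Bs (f - (\<Sum>d\<in>D. inner f d *\<^sub>R d))) = 0"
    by (rule sol_Bs_eq_0) (use orthonormal_residual_span[OF assms(2,1)] assms(3) in auto)
  then show ?thesis by (simp add: Bs.diff sol.diff Bs.sum sol.sum Bs.scaleR sol.scaleR)
qed

lemma T_expand:
  assumes "finite D" "orthonormal D" "span D = B ` X" "\<And>d. d \<in> D \<Longrightarrow> T d = l d *\<^sub>R d"
  shows "T f = (\<Sum>d\<in>D. (l d * inner f d) *\<^sub>R d)"
proof -
  have "T f = (\<Sum>d\<in>D. inner f d *\<^sub>R T d)"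
    unfolding T_def sol_Bs_expand[OF assms(1-3), of f] by (simp add: B.sum B.scaleR)
  then show ?thesis using assms(4) by (simp add: mult.commute)
qed

text \<open>On a finite-dimensional \<open>X\<close> the operator \<open>T\<close> is diagonalised
  on the image of \<open>B\<close>. The value \<open>l d = 0\<close> remains possible; such
  \<open>d\<close> correspond to no eigenvalue of the form.\<close>

lemma T_spectral:
  assumes "finite_dimensional X"
  obtains D l where "finite D" "orthonormal D" "span D = B ` X" "\<And>d. d \<in> D \<Longrightarrow> T d = l d *\<^sub>R d"
    "\<And>d. d \<in> D \<Longrightarrow> l d \<ge> 0"
proof -
  obtain D l where D: "finite D" "orthonormal D" "span D = B ` X" "\<And>d. d \<in> D \<Longrightarrow> T d = l d *\<^sub>R d"
  proof (rule symmetric_eigenbasis_exists[where T = T and W = "B ` X"])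
    show "finite_dimensional (B ` X)" by (rule finite_dimensional_linear_image[OF assms B.linear])
    show "subspace (B ` X)" by (rule linear_subspace_image[OF B.linear subspace_X])
    show "T ` B ` X \<subseteq> B ` X" by (auto simp: T_def sol)
    show "inner (T x) y = inner x (T y)" for x y by (rule T_sym)
  qed (use T.bounded_linear_axioms in auto)
  have "l d \<ge> 0" if "d \<in> D" for d
    by (rule T_eigenvalue_nonneg[OF D(4)[OF that]]) (use D(2) that in \<open>auto simp: orthonormal_def\<close>)
  then show ?thesis using D that by blast
qed

lemma orthosys_T:
  assumes "finite D" "orthonormal D" "\<And>d. d \<in> D \<Longrightarrow> T d = l d *\<^sub>R d" "\<And>d. d \<in> D \<Longrightarrow> l d \<noteq> 0 \<and> 1 / l d \<in> I"
  shows "orthosys X I (card D)"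
  unfolding orthosys_def using assms T_eigenvector by (intro exI[of _ D]) blast

end

section \<open>Galerkin approximation\<close>

text \<open>Negates eventual statements along a single sequence of mesh sizes. \<open>P\<close> may
  vary with \<open>n\<close>, which allows windows that shrink along the sequence.\<close>

lemma eventually_within_contrapos:
  fixes P :: "nat \<Rightarrow> real \<Rightarrow> bool"
  assumes "\<And>n. \<not> eventually (P n) (at 0 within H)"
  obtains f where "\<And>n. f n \<in> H" "\<And>n. f n \<noteq> 0" "\<And>n. \<not> P n (f n)" "f \<longlonglongrightarrow> 0"
proof -
  have "\<exists>x\<in>H. x \<noteq> 0 \<and> dist x 0 < 1 / real (Suc n) \<and> \<not> P n x" for n
    using assms[of n] unfolding eventually_at by (metis of_nat_0_less_iff zero_less_Suc zero_less_divide_1_iff)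
  then obtain f where f: "\<And>n. f n \<in> H" "\<And>n. f n \<noteq> 0" "\<And>n. dist (f n) 0 < 1 / real (Suc n)"
    "\<And>n. \<not> P n (f n)" by metis
  have "f \<longlonglongrightarrow> 0"
    by (rule Lim_null_comparison[OF _ LIMSEQ_inverse_real_of_nat])
      (use f(3) in \<open>auto simp: inverse_eq_divide less_imp_le\<close>)
  then show ?thesis using that f by blast
qed

lemma span_eq_of_card:
  assumes "finite T" "card T \<le> card S" "independent S" "S \<subseteq> span T"
  shows "span S = span T"
proof -
  have "x \<in> span S" if "x \<in> T" for x
  proof (rule ccontr)
    assume x: "x \<notin> span S"
    have "insert x S \<subseteq> span T" using that assms(4) by (simp add: span_base)
    from independent_span_bound[OF assms(1) independent_insertI[OF x assms(3)] this]
    have "finite (insert x S)" "card (insert x S) \<le> card T" by simp_all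
    moreover have "x \<notin> S" using x span_base by blast
    ultimately show False using assms(2) by simp
  qed
  then show ?thesis using assms(4) by (simp add: span_minimal subset_antisym subsetI)
qed

text \<open>\<open>compact\<close> is the abstract content of Rellich's theorem. Stability is
  assumed on the discrete spaces only, while \<open>pos\<close> is stated for all spaces at once;
  \<open>0 islimpt H\<close> makes the limit filter nontrivial.\<close>

locale galerkin = symmetric_form A B Bs
  for A :: "'z::{real_inner,complete_space} \<Rightarrow> 'z" and B :: "'z \<Rightarrow> 'l::{real_inner,complete_space}"
    and Bs :: "'l \<Rightarrow> 'z" +
  fixes V :: "'z set" and Vh :: "real \<Rightarrow> 'z set" and H :: "real set" and C :: real
  assumes closed_V: "closed V" and subspace_V: "subspace V" and C_pos: "C > 0"
    and H: "0 islimpt H"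
    and Vh: "\<And>h. h \<in> H \<Longrightarrow> subspace (Vh h) \<and> finite_dimensional (Vh h) \<and> Vh h \<subseteq> V"
    and Vh_stable: "\<And>h U \<eta>. h \<in> H \<Longrightarrow> U \<in> Vh h \<Longrightarrow> 0 \<le> \<eta> \<Longrightarrow> (\<And>W. W \<in> Vh h \<Longrightarrow> a U W \<le> \<eta> * norm W) \<Longrightarrow> norm U \<le> C * \<eta>"
    and pos: "\<And>X U f. X = V \<or> (\<exists>h\<in>H. X = Vh h) \<Longrightarrow> U \<in> X \<Longrightarrow> (\<And>W. W \<in> X \<Longrightarrow> a U W = inner f (B W)) \<Longrightarrow> 0 \<le> a U U"
    and approx: "\<And>U. U \<in> V \<Longrightarrow> ((\<lambda>h. infdist U (Vh h)) \<longlongrightarrow> 0) (at 0 within H)"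
    and compact: "\<And>U :: nat \<Rightarrow> 'z. (\<And>n. U n \<in> V) \<Longrightarrow> bounded (range U) \<Longrightarrow> \<exists>r l. strict_mono r \<and> (\<lambda>n. B (U (r n))) \<longlonglongrightarrow> l"
begin

lemma in_H: "\<forall>\<^sub>F h in at 0 within H. h \<in> H"
  by (simp add: eventually_at_topological) blast

lemma nontriv: "at 0 within H \<noteq> bot"
  using H by (simp add: trivial_limit_within)

text \<open>Stability passes from the discrete spaces to \<open>V\<close> by density.
  \<open>U\<close> is replaced by a discrete \<open>Z\<close> within \<open>d\<close>, which changes
  the functional by at most \<open>onorm A * d\<close>; the choice of \<open>d\<close> makes the
  total loss \<open>(1 + C * K) * d\<close> equal to \<open>e\<close>.\<close>

lemma V_stable:
  assumes "U \<in> V" "0 \<le> \<eta>" "\<And>W. W \<in> V \<Longrightarrow> a U W \<le> \<eta> * norm W"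
  shows "norm U \<le> C * \<eta>"
proof -
  define K where "K = onorm A"
  have K: "K \<ge> 0" "norm (A x) \<le> K * norm x" for x
    using onorm_pos_le[OF A] onorm[OF A] by (auto simp: K_def)
  have "norm U \<le> C * \<eta> + e" if e: "e > 0" for e
  proof -
    define d where "d = e / (1 + C * K)"
    have CK: "1 + C * K > 0" using C_pos K by (simp add: add_pos_nonneg)
    then have d: "d > 0" using e by (simp add: d_def)
    have "\<forall>\<^sub>F h in at 0 within H. h \<in> H \<and> infdist U (Vh h) < d"
      using order_tendstoD(2)[OF approx[OF assms(1)] d] in_H by (rule eventually_conj[rotated])
    then obtain h where h: "h \<in> H" "infdist U (Vh h) < d"
      using eventually_happens nontriv by blast
    have ne: "Vh h \<noteq> {}" using Vh[OF h(1)] subspace_0 by blast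
    then have "\<exists>Z\<in>Vh h. dist U Z < d"
      using h(2) by (subst (asm) infdist_notempty[OF ne], subst (asm) cINF_less_iff) auto
    then obtain Z where Z: "Z \<in> Vh h" "dist U Z < d" by blast
    have "norm Z \<le> C * (\<eta> + K * d)"
    proof (rule Vh_stable[OF h(1) Z(1)])
      show "0 \<le> \<eta> + K * d" using assms(2) K(1) d by simp
      fix W assume W: "W \<in> Vh h"
      have "a Z W = a U W + inner (A (Z - U)) W" by (simp add: A.diff inner_diff_left)
      also have "inner (A (Z - U)) W \<le> norm (A (Z - U)) * norm W" by (rule norm_cauchy_schwarz)
      also have "\<dots> \<le> (K * d) * norm W"
        using K(2)[of "Z - U"] Z(2) K(1)
        by (intro mult_right_mono) (auto simp: dist_norm norm_minus_commute intro: order_trans mult_left_mono less_imp_le)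
      finally show "a Z W \<le> (\<eta> + K * d) * norm W"
        using assms(3)[of W] W Vh[OF h(1)] by (auto simp: distrib_right)
    qed
    moreover have "norm U \<le> norm Z + dist U Z" by (simp add: dist_norm norm_triangle_sub add.commute)
    ultimately have "norm U \<le> C * \<eta> + (1 + C * K) * d" using Z(2) by (simp add: algebra_simps)
    then show ?thesis using CK by (simp add: d_def)
  qed
  then show ?thesis by (rule field_le_epsilon)
qed

sublocale V: stable_subspace A B Bs V C
proof
  show "0 \<le> a U U" if "U \<in> V" "\<And>W. W \<in> V \<Longrightarrow> a U W = inner f (B W)" for U f
    by (rule pos[of V]) (use that in auto)
qed (use closed_V subspace_V C_pos V_stable in auto)

lemma Vh_space: "h \<in> H \<Longrightarrow> stable_subspace A B Bs (Vh h) C"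
proof
  assume h: "h \<in> H"
  show "closed (Vh h)" using Vh[OF h] closed_finite_dimensional by blast
  show "subspace (Vh h)" using Vh[OF h] by blast
  show "0 \<le> a U U" if "U \<in> Vh h" "\<And>W. W \<in> Vh h \<Longrightarrow> a U W = inner f (B W)" for U f
    by (rule pos[of "Vh h"]) (use that h in auto)
qed (use C_pos Vh_stable in auto)

abbreviation solh :: "real \<Rightarrow> 'z \<Rightarrow> 'z" where "solh h \<equiv> stable_subspace.sol A (Vh h)"

text \<open>Quasi-optimality of the Galerkin projection, which maps \<open>U\<close> to
  \<open>solh h (A U)\<close>: it reproduces \<open>Vh h\<close> and has norm at most
  \<open>C * onorm A\<close>.\<close>

lemma galerkin_error:
  assumes h: "h \<in> H"
  shows "norm (U - solh h (A U)) \<le> (1 + C * onorm A) * infdist U (Vh h)"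
proof -
  interpret h: stable_subspace A B Bs "Vh h" C by (rule Vh_space[OF h])
  have CK: "1 + C * onorm A > 0" using C_pos onorm_pos_le[OF A] by (simp add: add_pos_nonneg)
  have "norm (U - solh h (A U)) / (1 + C * onorm A) \<le> dist U Z" if Z: "Z \<in> Vh h" for Z
  proof -
    have "U - solh h (A U) = (U - Z) - solh h (A (U - Z))"
      by (simp add: A.diff h.sol.diff h.sol_A[OF Z])
    then have "norm (U - solh h (A U)) \<le> norm (U - Z) + norm (solh h (A (U - Z)))"
      by (metis norm_triangle_ineq4)
    also have "norm (solh h (A (U - Z))) \<le> C * (onorm A * norm (U - Z))"
      using h.norm_sol[of "A (U - Z)"] onorm[OF A, of "U - Z"] C_pos
      by (meson mult_left_mono order_trans less_imp_le)
    finally show ?thesis using CK by (simp add: dist_norm field_simps)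
  qed
  moreover have "Vh h \<noteq> {}" using Vh[OF h] subspace_0 by blast
  ultimately have "norm (U - solh h (A U)) / (1 + C * onorm A) \<le> infdist U (Vh h)"
    unfolding infdist_def by (auto intro: cINF_greatest)
  then show ?thesis using CK by (simp add: field_simps)
qed

lemma galerkin_tendsto:
  assumes "U \<in> V"
  shows "((\<lambda>h. solh h (A U)) \<longlongrightarrow> U) (at 0 within H)"
proof -
  have "((\<lambda>h. solh h (A U) - U) \<longlongrightarrow> 0) (at 0 within H)"
  proof (rule Lim_null_comparison)
    show "\<forall>\<^sub>F h in at 0 within H. norm (solh h (A U) - U) \<le> (1 + C * onorm A) * infdist U (Vh h)"
      using in_H by eventually_elim (metis galerkin_error norm_minus_commute)
    show "((\<lambda>h. (1 + C * onorm A) * infdist U (Vh h)) \<longlongrightarrow> 0) (at 0 within H)"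
      using tendsto_mult_right_zero[OF approx[OF assms]] .
  qed
  then show ?thesis by (simp add: LIM_zero_iff)
qed

text \<open>Galerkin orthogonality: the discrete solution is the Galerkin projection of the
  continuous one, since both carry the same load on \<open>Vh h\<close>.\<close>

lemma solh_A_sol:
  assumes h: "h \<in> H" shows "solh h (A (V.sol z)) = solh h z"
proof -
  interpret h: stable_subspace A B Bs "Vh h" C by (rule Vh_space[OF h])
  show ?thesis
    by (rule h.sol_eqI[symmetric, THEN sym]) (use h.sol V.sol Vh[OF h] in auto)
qed

text \<open>Stability bounds the discrete eigenvectors, so along a subsequence their
  \<open>B\<close>-images and the eigenvalues converge. The loads then converge in norm, and uniform
  stability upgrades this to convergence of the eigenvectors themselves.\<close>

lemma eigen_limit:
  fixes h :: "nat \<Rightarrow> real"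
  assumes h: "\<And>n. h n \<in> H" "\<And>n. h n \<noteq> 0" "h \<longlonglongrightarrow> 0"
    and U: "\<And>n. U n \<in> eigenspace (Vh (h n)) a b (l n)" "\<And>n. norm (B (U n)) = 1" "\<And>n. \<bar>l n\<bar> \<le> L"
  shows "\<exists>r \<mu> u. strict_mono r \<and> (\<lambda>n. l (r n)) \<longlonglongrightarrow> \<mu> \<and> (\<lambda>n. U (r n)) \<longlonglongrightarrow> u \<and> u \<in> eigenspace V a b \<mu>"
proof -
  have eq: "U n = solh (h n) (l n *\<^sub>R Bs (B (U n)))" "U n \<in> V" for n
  proof -
    interpret h: stable_subspace A B Bs "Vh (h n)" C by (rule Vh_space[OF h(1)])
    show "U n = solh (h n) (l n *\<^sub>R Bs (B (U n)))"
      using U(1)[of n] h.eigenspace_iff[of "U n" "l n"] by (simp add: h.sol.scaleR)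
    show "U n \<in> V" using U(1)[of n] h.eigenspace_subset Vh[OF h(1)] by blast
  qed
  have "bounded (range U)" unfolding bounded_iff
  proof (intro exI ballI)
    fix x assume "x \<in> range U"
    then obtain n where x: "x = U n" by blast
    interpret h: stable_subspace A B Bs "Vh (h n)" C by (rule Vh_space[OF h(1)])
    have "norm (U n) \<le> C * norm (l n *\<^sub>R Bs (B (U n)))" by (metis eq(1) h.norm_sol)
    also have "\<dots> \<le> C * (L * onorm Bs)"
    proof -
      have "norm (Bs (B (U n))) \<le> onorm Bs" using onorm[OF Bs, of "B (U n)"] U(2) by simp
      moreover have "\<bar>l n\<bar> \<le> L" using U(3) .
      ultimately have "\<bar>l n\<bar> * norm (Bs (B (U n))) \<le> L * onorm Bs"
        by (intro mult_mono) auto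
      then show ?thesis using C_pos by simp
    qed
    finally show "norm x \<le> C * (L * onorm Bs)" using x by simp
  qed
  then obtain r1 f where r1: "strict_mono r1" "(\<lambda>n. B (U (r1 n))) \<longlonglongrightarrow> f"
    using compact[of U] eq(2) by blast
  have "bounded (range (l \<circ> r1))" unfolding bounded_iff using U(3) by auto
  then obtain \<mu> r2 where r2: "strict_mono r2" "((l \<circ> r1) \<circ> r2) \<longlonglongrightarrow> \<mu>"
    using bounded_imp_convergent_subsequence by blast
  define r where "r = r1 \<circ> r2"
  have r: "strict_mono r" using r1 r2 by (simp add: r_def strict_mono_o)
  have l: "(\<lambda>n. l (r n)) \<longlonglongrightarrow> \<mu>" using r2 by (simp add: r_def o_def)
  have Bf: "(\<lambda>n. B (U (r n))) \<longlonglongrightarrow> f"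
    using LIMSEQ_subseq_LIMSEQ[OF r1(2) r2(1)] by (simp add: r_def o_def)
  define u where "u = V.sol (\<mu> *\<^sub>R Bs f)"
  have "filterlim (\<lambda>n. h (r n)) (at 0 within H) sequentially"
    using LIMSEQ_subseq_LIMSEQ[OF h(3) r] h(1,2) by (simp add: filterlim_at o_def)
  then have P: "(\<lambda>n. solh (h (r n)) (A u)) \<longlonglongrightarrow> u"
    using filterlim_compose[OF galerkin_tendsto] V.sol(1) u_def by blast
  \<comment> \<open>This difference is a discrete solution whose load is the difference of two loads
    with the same limit.\<close>
  have "(\<lambda>n. U (r n) - solh (h (r n)) (A u)) \<longlonglongrightarrow> 0"
  proof (rule Lim_null_comparison)
    show "\<forall>\<^sub>F n in sequentially. norm (U (r n) - solh (h (r n)) (A u)) \<le>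
        C * norm (l (r n) *\<^sub>R Bs (B (U (r n))) - \<mu> *\<^sub>R Bs f)"
    proof (rule always_eventually, rule allI)
      fix n
      interpret h: stable_subspace A B Bs "Vh (h (r n))" C by (rule Vh_space[OF h(1)])
      have "U (r n) - solh (h (r n)) (A u) = solh (h (r n)) (l (r n) *\<^sub>R Bs (B (U (r n))) - \<mu> *\<^sub>R Bs f)"
        unfolding u_def solh_A_sol[OF h(1)] h.sol.diff eq(1)[symmetric] ..
      then show "norm (U (r n) - solh (h (r n)) (A u)) \<le>
        C * norm (l (r n) *\<^sub>R Bs (B (U (r n))) - \<mu> *\<^sub>R Bs f)" using h.norm_sol by simp
    qed
    have "(\<lambda>n. C * norm (l (r n) *\<^sub>R Bs (B (U (r n))) - \<mu> *\<^sub>R Bs f)) \<longlonglongrightarrow> C * norm (\<mu> *\<^sub>R Bs f - \<mu> *\<^sub>R Bs f)"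
      by (intro tendsto_intros l Bs.tendsto Bf)
    then show "(\<lambda>n. C * norm (l (r n) *\<^sub>R Bs (B (U (r n))) - \<mu> *\<^sub>R Bs f)) \<longlonglongrightarrow> 0" by simp
  qed
  from tendsto_add[OF this P] have Uu: "(\<lambda>n. U (r n)) \<longlonglongrightarrow> u" by simp
  then have "B u = f" using B.tendsto[OF Uu] Bf LIMSEQ_unique by blast
  then have "u = \<mu> *\<^sub>R V.sol (Bs (B u))" by (simp add: u_def V.sol.scaleR)
  then have "u \<in> eigenspace V a b \<mu>" using V.eigenspace_iff V.sol by (simp add: u_def)
  then show ?thesis using r l Uu by blast
qed

text \<open>Subsequences are extracted for one member of the system after another. Inner products
  are continuous, so the limits are again orthonormal and in particular distinct; \<open>J\<close>
  has to contain the possible limits of eigenvalues chosen from the sets \<open>I n\<close>.\<close>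

lemma orthosys_limit:
  fixes h :: "nat \<Rightarrow> real"
  assumes h: "\<And>n. h n \<in> H" "\<And>n. h n \<noteq> 0" "h \<longlonglongrightarrow> 0"
    and os: "\<And>n. orthosys (Vh (h n)) (I n) k" "\<And>n \<mu>. \<mu> \<in> I n \<Longrightarrow> \<bar>\<mu>\<bar> \<le> L"
    and J: "\<And>r l \<mu>. strict_mono r \<Longrightarrow> (\<And>n. l n \<in> I (r n)) \<Longrightarrow> l \<longlonglongrightarrow> \<mu> \<Longrightarrow> \<mu> \<in> J"
  shows "orthosys V J k"
proof -
  define Q where "Q n U l \<longleftrightarrow> (\<forall>i<k. l i \<in> I n \<and> U i \<in> eigenspace (Vh (h n)) a b (l i) \<and>
      (\<forall>j<k. inner (B (U i)) (B (U j)) = (if i = j then 1 else 0)))" for n U l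
  have "\<exists>U l. Q n U l" for n
  proof -
    obtain D where D: "finite D" "card D = k" "orthonormal D"
      "\<forall>e\<in>D. \<exists>\<mu>\<in>I n. \<exists>U\<in>eigenspace (Vh (h n)) a b \<mu>. B U = e"
      using os(1)[of n] by (auto simp: orthosys_def)
    obtain e where e: "bij_betw e {..<k} D"
      using ex_bij_betw_nat_finite[OF D(1)] D(2) by (auto simp: atLeast0LessThan)
    have eD: "e i \<in> D" if "i < k" for i using e that by (auto simp: bij_betw_def)
    have on: "inner (e i) (e j) = (if i = j then 1 else 0)" if "i < k" "j < k" for i j
      using orthonormal_inner[OF D(3) eD[OF that(1)] eD[OF that(2)]] e that
      by (auto simp: bij_betw_def inj_on_def)
    have "\<forall>i. \<exists>l U. i < k \<longrightarrow> l \<in> I n \<and> U \<in> eigenspace (Vh (h n)) a b l \<and> B U = e i"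
      using D(4) eD by blast
    then obtain l U where lU: "\<And>i. i < k \<Longrightarrow> l i \<in> I n \<and> U i \<in> eigenspace (Vh (h n)) a b (l i) \<and> B (U i) = e i"
      by metis
    have "Q n U l" unfolding Q_def using lU on by simp
    then show ?thesis by blast
  qed
  then obtain U l where "\<And>n. Q n (U n) (l n)" by metis
  then have Ul: "\<And>n i. i < k \<Longrightarrow> l n i \<in> I n"
    "\<And>n i. i < k \<Longrightarrow> U n i \<in> eigenspace (Vh (h n)) a b (l n i)"
    "\<And>n i j. i < k \<Longrightarrow> j < k \<Longrightarrow> inner (B (U n i)) (B (U n j)) = (if i = j then 1 else 0)"
    unfolding Q_def by blast+
  have "\<exists>r. strict_mono r \<and> (\<forall>i<j. \<exists>\<mu> u. (\<lambda>n. l (r n) i) \<longlonglongrightarrow> \<mu> \<and> (\<lambda>n. U (r n) i) \<longlonglongrightarrow> u \<and> u \<in> eigenspace V a b \<mu>)"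
    if "j \<le> k" for j using that
  proof (induction j)
    case 0
    then show ?case by (intro exI[of _ id]) (simp add: strict_mono_def)
  next
    case (Suc j)
    then obtain r where r: "strict_mono r"
      "\<forall>i<j. \<exists>\<mu> u. (\<lambda>n. l (r n) i) \<longlonglongrightarrow> \<mu> \<and> (\<lambda>n. U (r n) i) \<longlonglongrightarrow> u \<and> u \<in> eigenspace V a b \<mu>" by auto
    have j: "j < k" using Suc by simp
    have "\<exists>s \<mu> u. strict_mono s \<and> (\<lambda>n. l (r (s n)) j) \<longlonglongrightarrow> \<mu> \<and> (\<lambda>n. U (r (s n)) j) \<longlonglongrightarrow> u \<and> u \<in> eigenspace V a b \<mu>"
    proof (rule eigen_limit[of "\<lambda>n. h (r n)"])
      show "(\<lambda>n. h (r n)) \<longlonglongrightarrow> 0" using LIMSEQ_subseq_LIMSEQ[OF h(3) r(1)] by (simp add: o_def)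
      show "\<bar>l (r n) j\<bar> \<le> L" for n using os(2) Ul(1)[OF j] by blast
      show "norm (B (U (r n) j)) = 1" for n using Ul(3)[OF j j] by (simp add: norm_eq_1)
    qed (use h Ul j in auto)
    then obtain s \<mu> u where s: "strict_mono s" "(\<lambda>n. l (r (s n)) j) \<longlonglongrightarrow> \<mu>" "(\<lambda>n. U (r (s n)) j) \<longlonglongrightarrow> u"
      "u \<in> eigenspace V a b \<mu>" by blast
    have "\<exists>\<mu> u. (\<lambda>n. l ((r \<circ> s) n) i) \<longlonglongrightarrow> \<mu> \<and> (\<lambda>n. U ((r \<circ> s) n) i) \<longlonglongrightarrow> u \<and> u \<in> eigenspace V a b \<mu>"
      if i: "i < Suc j" for i
    proof (cases "i = j")
      case True
      then show ?thesis using s by auto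
    next
      case False
      then obtain \<mu> u where *: "(\<lambda>n. l (r n) i) \<longlonglongrightarrow> \<mu>" "(\<lambda>n. U (r n) i) \<longlonglongrightarrow> u" "u \<in> eigenspace V a b \<mu>"
        using r(2) i by (auto simp: less_Suc_eq)
      from LIMSEQ_subseq_LIMSEQ[OF *(1) s(1)] LIMSEQ_subseq_LIMSEQ[OF *(2) s(1)] *(3)
      show ?thesis by (auto simp: o_def)
    qed
    then show ?case using strict_mono_o[OF r(1) s(1)] by blast
  qed
  then obtain r where r: "strict_mono r"
    "\<forall>i<k. \<exists>\<mu> u. (\<lambda>n. l (r n) i) \<longlonglongrightarrow> \<mu> \<and> (\<lambda>n. U (r n) i) \<longlonglongrightarrow> u \<and> u \<in> eigenspace V a b \<mu>" by blast
  then have "\<forall>i. \<exists>\<mu> u. i < k \<longrightarrow> (\<lambda>n. l (r n) i) \<longlonglongrightarrow> \<mu> \<and> (\<lambda>n. U (r n) i) \<longlonglongrightarrow> u \<and> u \<in> eigenspace V a b \<mu>"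
    by blast
  then obtain \<mu> u where lim: "\<And>i. i < k \<Longrightarrow> (\<lambda>n. l (r n) i) \<longlonglongrightarrow> \<mu> i"
    "\<And>i. i < k \<Longrightarrow> (\<lambda>n. U (r n) i) \<longlonglongrightarrow> u i" "\<And>i. i < k \<Longrightarrow> u i \<in> eigenspace V a b (\<mu> i)" by metis
  have in_J: "\<mu> i \<in> J" if "i < k" for i
    by (rule J[OF r(1) _ lim(1)[OF that]]) (rule Ul(1)[OF that])
  have on: "inner (B (u i)) (B (u j)) = (if i = j then 1 else 0)" if "i < k" "j < k" for i j
  proof -
    have "(\<lambda>n. inner (B (U (r n) i)) (B (U (r n) j))) \<longlonglongrightarrow> inner (B (u i)) (B (u j))"
      by (intro tendsto_inner B.tendsto lim that)
    then show ?thesis by (simp add: Ul(3)[OF that] LIMSEQ_const_iff)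
  qed
  define D where "D = (\<lambda>i. B (u i)) ` {..<k}"
  have "inj_on (\<lambda>i. B (u i)) {..<k}"
  proof (rule inj_onI, rule ccontr)
    fix i j assume ij: "i \<in> {..<k}" "j \<in> {..<k}" "B (u i) = B (u j)" "i \<noteq> j"
    then show False using on[of i j] on[of i i] by simp
  qed
  then have "card D = k" "finite D" by (auto simp: D_def card_image)
  moreover have "orthonormal D" unfolding orthonormal_def D_def pairwise_def orthogonal_def norm_eq_1
    using on by (auto split: if_splits)
  moreover have "\<forall>e\<in>D. \<exists>\<mu>\<in>J. \<exists>U\<in>eigenspace V a b \<mu>. B U = e" using in_J lim(3) by (auto simp: D_def)
  ultimately show ?thesis unfolding orthosys_def by blast
qed

end

text \<open>Dimension count: the projection of \<open>span D0\<close> to the span of the smaller set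
  \<open>D1\<close> cannot be injective.\<close>

lemma exists_orthogonal_vector:
  fixes D0 D1 :: "'a::real_inner set"
  assumes "finite D1" "orthonormal D1" "independent D0" "card D1 < card D0"
  obtains f where "f \<in> span D0" "f \<noteq> 0" "\<And>d. d \<in> D1 \<Longrightarrow> inner f d = 0"
proof -
  define F where "F f = (\<Sum>d\<in>D1. inner f d *\<^sub>R d)" for f
  have lin: "linear F"
    by (rule linearI) (simp_all add: F_def inner_add_left scaleR_add_left sum.distrib scaleR_sum_right)
  have "\<not> inj_on F (span D0)"
  proof
    assume inj: "inj_on F (span D0)"
    have "F ` D0 \<subseteq> span D1" by (auto simp: F_def intro: span_sum span_scale span_base)
    then have "card (F ` D0) \<le> card D1"
      using independent_span_bound[OF assms(1) linear_independent_injective_image[OF lin assms(3) inj]] by blast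
    moreover have "card (F ` D0) = card D0" by (rule card_image) (use inj inj_on_subset span_superset in blast)
    ultimately show False using assms(4) by simp
  qed
  then obtain x y where xy: "x \<in> span D0" "y \<in> span D0" "F x = F y" "x \<noteq> y" by (auto simp: inj_on_def)
  have "F (x - y) = 0" using xy(3) linear_diff[OF lin] by simp
  then have "inner (x - y) d = 0" if "d \<in> D1" for d
    using orthonormal_inner_sum[OF assms(2,1) that, of "inner (x - y)"] by (simp add: F_def)
  then show ?thesis using that[of "x - y"] xy span_diff by auto
qed

section \<open>Convergence of the eigenvalues with their multiplicities\<close>

context galerkin
begin

abbreviation Th :: "real \<Rightarrow> 'l \<Rightarrow> 'l" where "Th h \<equiv> stable_subspace.T A B Bs (Vh h)"

text \<open>The discrete problems produce no surplus of eigenvalues up to \<open>c\<close>;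
  otherwise their eigenvectors would accumulate at such a system for \<open>V\<close>.\<close>

lemma eventually_not_orthosys_below:
  assumes "\<not> orthosys V {..c} k"
  shows "\<forall>\<^sub>F h in at 0 within H. \<not> orthosys (Vh h) {..c} k"
proof (rule ccontr)
  assume "\<not> (\<forall>\<^sub>F h in at 0 within H. \<not> orthosys (Vh h) {..c} k)"
  then obtain f where f: "\<And>n. f n \<in> H" "\<And>n. f n \<noteq> 0" "\<And>n. \<not> \<not> orthosys (Vh (f n)) {..c} k" "f \<longlonglongrightarrow> 0"
    using eventually_within_contrapos[of "\<lambda>n h. \<not> orthosys (Vh h) {..c} k"] by blast
  have "orthosys V {..c} k"
  proof (rule orthosys_limit[OF f(1,2,4)])
    show "orthosys (Vh (f n)) ({..c} \<inter> {0<..}) k" for n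
      using stable_subspace.orthosys_positive[OF Vh_space[OF f(1)]] f(3) by blast
    show "\<bar>\<mu>\<bar> \<le> c" if "\<mu> \<in> {..c} \<inter> {0<..}" for \<mu> using that by auto
    show "\<mu> \<in> {..c}" if "\<And>n. l n \<in> {..c} \<inter> {0<..}" "l \<longlonglongrightarrow> \<mu>" for l :: "nat \<Rightarrow> real" and \<mu>
      using LIMSEQ_le_const2[OF that(2)] that(1) by auto
  qed
  then show False using assms by simp
qed

text \<open>Excludes surplus multiplicity near \<open>c\<close>. The window shrinks along the
  contradicting sequence, so every limit eigenvalue is \<open>c\<close> itself.\<close>

lemma eventually_not_orthosys_at:
  assumes "\<not> orthosys V {c} k"
  shows "\<exists>\<epsilon>>0. \<forall>\<^sub>F h in at 0 within H. \<not> orthosys (Vh h) {c - \<epsilon>..c + \<epsilon>} k"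
proof (rule ccontr)
  assume neg: "\<not> ?thesis"
  define \<epsilon> where "\<epsilon> n = 1 / real (Suc n)" for n
  have \<epsilon>: "\<epsilon> n > 0" "\<epsilon> n \<le> 1" for n by (auto simp: \<epsilon>_def)
  have \<epsilon>0: "\<epsilon> \<longlonglongrightarrow> 0" unfolding \<epsilon>_def using LIMSEQ_inverse_real_of_nat by (simp add: inverse_eq_divide)
  obtain f where f: "\<And>n. f n \<in> H" "\<And>n. f n \<noteq> 0" "\<And>n. \<not> \<not> orthosys (Vh (f n)) {c - \<epsilon> n..c + \<epsilon> n} k" "f \<longlonglongrightarrow> 0"
    using eventually_within_contrapos[of "\<lambda>n h. \<not> orthosys (Vh h) {c - \<epsilon> n..c + \<epsilon> n} k"] neg \<epsilon>(1) by blast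
  have "orthosys V {c} k"
  proof (rule orthosys_limit[OF f(1,2,4)])
    show "orthosys (Vh (f n)) {c - \<epsilon> n..c + \<epsilon> n} k" for n using f(3) by blast
    show "\<bar>\<mu>\<bar> \<le> \<bar>c\<bar> + 1" if "\<mu> \<in> {c - \<epsilon> n..c + \<epsilon> n}" for \<mu> n using that \<epsilon>(2)[of n] by auto
    show "\<mu> \<in> {c}" if r: "strict_mono r" and l: "\<And>n. l n \<in> {c - \<epsilon> (r n)..c + \<epsilon> (r n)}" "l \<longlonglongrightarrow> \<mu>"
      for r l and \<mu> :: real
    proof -
      have e: "(\<lambda>n. \<epsilon> (r n)) \<longlonglongrightarrow> 0" using LIMSEQ_subseq_LIMSEQ[OF \<epsilon>0 r] by (simp add: o_def)
      have "l \<longlonglongrightarrow> c"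
      proof (rule tendsto_sandwich)
        show "(\<lambda>n. c - \<epsilon> (r n)) \<longlonglongrightarrow> c" using tendsto_diff[OF tendsto_const e] by simp
        show "(\<lambda>n. c + \<epsilon> (r n)) \<longlonglongrightarrow> c" using tendsto_add[OF tendsto_const e] by simp
      qed (use l(1) in auto)
      then show ?thesis using l(2) LIMSEQ_unique by blast
    qed
  qed
  then show False using assms by simp
qed

lemma Th_tendsto: "((\<lambda>h. Th h f) \<longlongrightarrow> V.T f) (at 0 within H)"
proof -
  have "((\<lambda>h. B (solh h (A (V.sol (Bs f))))) \<longlongrightarrow> V.T f) (at 0 within H)"
    unfolding V.T_def by (intro B.tendsto galerkin_tendsto V.sol)
  moreover have "\<forall>\<^sub>F h in at 0 within H. B (solh h (A (V.sol (Bs f)))) = Th h f"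
    using in_H by eventually_elim (simp add: solh_A_sol stable_subspace.T_def[OF Vh_space])
  ultimately show ?thesis by (rule Lim_transform_eventually)
qed

text \<open>
  Courant-Fischer in disguise: if fewer than \<open>k\<close> discrete eigenvalues were below \<open>lam + \<epsilon>\<close>, some
  combination of the continuous eigenvectors would be orthogonal to all of their eigenvectors.
\<close>

lemma eventually_orthosys_below:
  assumes os: "orthosys V {..lam} k" and lam: "lam > 0" and \<epsilon>: "\<epsilon> > 0"
  shows "\<forall>\<^sub>F h in at 0 within H. orthosys (Vh h) {..lam + \<epsilon>} k"
proof -
  obtain D0 where D0: "finite D0" "card D0 = k" "orthonormal D0"
    "\<forall>e\<in>D0. \<exists>\<mu>\<in>{..lam} \<inter> {0<..}. \<exists>U\<in>eigenspace V a b \<mu>. B U = e"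
    using V.orthosys_positive[OF os] unfolding orthosys_def by blast
  then have "\<forall>e\<in>D0. \<exists>\<mu>. 0 < \<mu> \<and> \<mu> \<le> lam \<and> V.T e = (1 / \<mu>) *\<^sub>R e"
  proof (intro ballI)
    fix e assume "e \<in> D0"
    then obtain \<mu> U where U: "0 < \<mu>" "\<mu> \<le> lam" "U \<in> eigenspace V a b \<mu>" "B U = e" using D0(4) by auto
    then have "e = \<mu> *\<^sub>R V.T e" using V.eigenspace_T by blast
    then have "V.T e = (1 / \<mu>) *\<^sub>R e" using U(1) by (metis divide_inverse less_irrefl mult_1 real_vector.scale_one scaleR_scaleR left_inverse)
    then show "\<exists>\<mu>. 0 < \<mu> \<and> \<mu> \<le> lam \<and> V.T e = (1 / \<mu>) *\<^sub>R e" using U by blast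
  qed
  then obtain \<nu> where \<nu>: "\<And>e. e \<in> D0 \<Longrightarrow> 0 < \<nu> e" "\<And>e. e \<in> D0 \<Longrightarrow> \<nu> e \<le> lam"
    "\<And>e. e \<in> D0 \<Longrightarrow> V.T e = (1 / \<nu> e) *\<^sub>R e" by metis
  \<comment> \<open>On \<open>span D0\<close> the Rayleigh quotient of \<open>V.T\<close> is at
    least \<open>1 / lam\<close>, while vectors orthogonal to \<open>D1\<close> below have discrete
    quotient at most \<open>1 / (lam + \<epsilon>)\<close>; the operator error on \<open>D0\<close>
    has to stay below this difference.\<close>
  define \<eta> where "\<eta> = 1 / lam - 1 / (lam + \<epsilon>)"
  have \<eta>: "\<eta> > 0" using lam \<epsilon> by (simp add: \<eta>_def frac_less2)
  have "((\<lambda>h. \<Sum>e\<in>D0. norm (Th h e - V.T e)) \<longlongrightarrow> (\<Sum>e\<in>D0. norm (V.T e - V.T e))) (at 0 within H)"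
    by (intro tendsto_intros Th_tendsto)
  then have "\<forall>\<^sub>F h in at 0 within H. (\<Sum>e\<in>D0. norm (Th h e - V.T e)) < \<eta>"
    using \<eta> by (intro order_tendstoD(2)) auto
  then show ?thesis using in_H
  proof eventually_elim
    case (elim h)
    interpret h: stable_subspace A B Bs "Vh h" C by (rule Vh_space[OF elim(2)])
    have "finite_dimensional (Vh h)" using Vh[OF elim(2)] by blast
    then obtain D l where D: "finite D" "orthonormal D" "span D = B ` Vh h"
      "\<And>d. d \<in> D \<Longrightarrow> Th h d = l d *\<^sub>R d" "\<And>d. d \<in> D \<Longrightarrow> l d \<ge> 0" using h.T_spectral by metis
    \<comment> \<open>Reciprocals reverse the order: discrete eigenvalues up to
      \<open>lam + \<epsilon>\<close> correspond to the large eigenvalues of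
      \<open>Th h\<close>.\<close>
    define D1 where "D1 = {d \<in> D. l d \<ge> 1 / (lam + \<epsilon>)}"
    have le: "lam + \<epsilon> > 0" using lam \<epsilon> by simp
    have pos1: "l d > 0" if "d \<in> D1" for d
      using that le by (auto simp: D1_def intro: less_le_trans[of 0 "1 / (lam + \<epsilon>)"])
    have "orthosys (Vh h) {..lam + \<epsilon>} (card D1)"
    proof (rule h.orthosys_T[of _ l])
      show "l d \<noteq> 0 \<and> 1 / l d \<in> {..lam + \<epsilon>}" if "d \<in> D1" for d
      proof -
        have "1 / (lam + \<epsilon>) \<le> l d" using that by (simp add: D1_def)
        then have "1 / l d \<le> lam + \<epsilon>" using pos1[OF that] le by (simp add: field_simps)
        then show ?thesis using pos1[OF that] by simp
      qed
    qed (use D orthonormal_subset[of D D1] in \<open>auto simp: D1_def\<close>)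
    show ?case
    proof (cases "k \<le> card D1")
      case True
      then show ?thesis using \<open>orthosys (Vh h) {..lam + \<epsilon>} (card D1)\<close> orthosys_mono by blast
    next
      case False
      have "orthonormal D1" "finite D1" using D orthonormal_subset[of D D1] by (auto simp: D1_def)
      then obtain f where f: "f \<in> span D0" "f \<noteq> 0" "\<And>d. d \<in> D1 \<Longrightarrow> inner f d = 0"
        using exists_orthogonal_vector[of D1 D0] orthonormal_independent[OF D0(3)] False D0(2) by auto
      have fe: "f = (\<Sum>e\<in>D0. inner f e *\<^sub>R e)" using orthonormal_expand[OF D0(3,1) f(1)] by simp
      have nf: "(norm f)\<^sup>2 = (\<Sum>e\<in>D0. (inner f e)\<^sup>2)"
        using orthonormal_norm_sum[OF D0(3,1), of "inner f"] fe by simp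
      have VTf: "V.T f = (\<Sum>e\<in>D0. inner f e *\<^sub>R V.T e)" by (subst fe) (simp add: V.T.sum V.T.scaleR)
      have ThF: "Th h f = (\<Sum>e\<in>D0. inner f e *\<^sub>R Th h e)" by (subst fe) (simp add: h.T.sum h.T.scaleR)
      have Tf: "inner (V.T f) f \<ge> (1 / lam) * (norm f)\<^sup>2"
      proof -
        have "V.T f = (\<Sum>e\<in>D0. (inner f e / \<nu> e) *\<^sub>R e)" unfolding VTf by (intro sum.cong) (auto simp: \<nu>(3))
        then have "inner (V.T f) f = (\<Sum>e\<in>D0. (inner f e / \<nu> e) * inner e f)" by (simp add: inner_sum_left)
        also have "\<dots> = (\<Sum>e\<in>D0. (1 / \<nu> e) * (inner f e)\<^sup>2)"
          by (intro sum.cong) (auto simp: inner_commute power2_eq_square)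
        also have "\<dots> \<ge> (\<Sum>e\<in>D0. (1 / lam) * (inner f e)\<^sup>2)"
          by (intro sum_mono mult_right_mono divide_left_mono) (auto simp: \<nu> lam)
        finally show ?thesis by (simp add: nf sum_distrib_left)
      qed
      have "inner (Th h f) f = (\<Sum>d\<in>D. l d * (inner f d)\<^sup>2)"
      proof -
        have T: "Th h f = (\<Sum>d\<in>D. (l d * inner f d) *\<^sub>R d)" by (rule h.T_expand) (use D in auto)
        show ?thesis unfolding T inner_sum_left
          by (intro sum.cong) (auto simp: inner_commute power2_eq_square)
      qed
      also have "\<dots> \<le> (\<Sum>d\<in>D. (1 / (lam + \<epsilon>)) * (inner f d)\<^sup>2)"
      proof (rule sum_mono)
        fix d assume "d \<in> D"
        then show "l d * (inner f d)\<^sup>2 \<le> 1 / (lam + \<epsilon>) * (inner f d)\<^sup>2"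
        proof (cases "d \<in> D1")
          case True
          then show ?thesis using f(3)[of d] by simp
        next
          case False
          then have "l d \<le> 1 / (lam + \<epsilon>)" using \<open>d \<in> D\<close> by (simp add: D1_def)
          then show ?thesis by (rule mult_right_mono) simp
        qed
      qed
      also have "\<dots> \<le> (1 / (lam + \<epsilon>)) * (norm f)\<^sup>2"
        unfolding sum_distrib_left[symmetric] using le bessel[OF D(2,1), of f]
        by (intro mult_left_mono) auto
      finally have Thf: "inner (Th h f) f \<le> (1 / (lam + \<epsilon>)) * (norm f)\<^sup>2" .
      have "V.T f - Th h f = (\<Sum>e\<in>D0. inner f e *\<^sub>R (V.T e - Th h e))"
        unfolding VTf ThF by (simp add: scaleR_diff_right sum_subtractf)
      then have "norm (V.T f - Th h f) \<le> (\<Sum>e\<in>D0. norm (inner f e *\<^sub>R (V.T e - Th h e)))"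
        using norm_sum by metis
      also have "\<dots> = (\<Sum>e\<in>D0. \<bar>inner f e\<bar> * norm (Th h e - V.T e))"
        by (simp add: norm_minus_commute)
      also have "(\<Sum>e\<in>D0. \<bar>inner f e\<bar> * norm (Th h e - V.T e)) \<le> (\<Sum>e\<in>D0. norm f * norm (Th h e - V.T e))"
      proof (intro sum_mono mult_right_mono)
        fix e assume "e \<in> D0"
        then show "\<bar>inner f e\<bar> \<le> norm f"
          using Cauchy_Schwarz_ineq2[of f e] D0(3) by (simp add: orthonormal_def)
      qed simp
      also have "\<dots> = norm f * (\<Sum>e\<in>D0. norm (Th h e - V.T e))" by (simp add: sum_distrib_left)
      also have "\<dots> < norm f * \<eta>" using f(2) elim(1) by simp
      finally have "norm (V.T f - Th h f) < norm f * \<eta>" .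
      then have "norm (V.T f - Th h f) * norm f < norm f * \<eta> * norm f"
        using f(2) by (intro mult_strict_right_mono) auto
      then have "inner (V.T f - Th h f) f < \<eta> * (norm f)\<^sup>2"
        using norm_cauchy_schwarz[of "V.T f - Th h f" f] by (simp add: power2_eq_square mult_ac)
      then have "\<eta> * (norm f)\<^sup>2 < \<eta> * (norm f)\<^sup>2"
        using Tf Thf by (simp add: \<eta>_def inner_diff_left left_diff_distrib)
      then show ?thesis by simp
    qed
  qed
qed

lemma kth_eigenvalue_pos:
  assumes "kth_eigenvalue V a b k lam" shows "lam > 0"
proof -
  obtain U where "U \<in> eigenspace V a b lam" "U \<noteq> 0"
    using assms by (auto simp: kth_eigenvalue_def eigenvalues_def eigenpair_def)
  then show ?thesis using V.eigen_pos by blast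
qed

text \<open>Both sides rest on counting. For \<open>c < lam\<close> fewer than \<open>k\<close>
  continuous eigenvalues lie in \<open>{..c}\<close>, and for small \<open>h\<close> the same holds
  for the discrete ones. For \<open>c > lam\<close> at least \<open>k\<close> discrete eigenvalues
  eventually lie below \<open>c\<close>.\<close>

theorem eigenvalue_tendsto:
  assumes kth: "kth_eigenvalue V a b k lam"
    and kth_h: "\<forall>\<^sub>F h in at 0 within H. kth_eigenvalue (Vh h) a b k (lamh h)"
  shows "(lamh \<longlongrightarrow> lam) (at 0 within H)"
proof (rule order_tendstoI)
  fix c assume c: "c < lam"
  have "\<not> orthosys V {..c} k"
  proof
    assume "orthosys V {..c} k"
    then have "k \<le> (\<Sum>\<mu> | \<mu> \<in> eigenvalues V a b \<and> \<mu> < lam. dim (eigenspace V a b \<mu>))"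
    proof (rule V.dims_of_orthosys)
      show "finite {\<mu> \<in> eigenvalues V a b. \<mu> < lam}"
        by (rule finite_subset[of _ "{\<mu> \<in> eigenvalues V a b. \<mu> \<le> lam}"])
          (use kth in \<open>auto simp: kth_eigenvalue_def\<close>)
    qed (use c kth in \<open>auto simp: kth_eigenvalue_def\<close>)
    then show False using kth by (simp add: kth_eigenvalue_def)
  qed
  from eventually_not_orthosys_below[OF this] kth_h in_H
  show "\<forall>\<^sub>F h in at 0 within H. c < lamh h"
  proof eventually_elim
    case (elim h)
    interpret h: stable_subspace A B Bs "Vh h" C by (rule Vh_space[OF elim(3)])
    have "orthosys (Vh h) {\<mu> \<in> eigenvalues (Vh h) a b. \<mu> \<le> lamh h} k"
      by (rule h.orthosys_of_dims) (use elim(2) in \<open>auto simp: kth_eigenvalue_def\<close>)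
    then show ?case using orthosys_mono[of "Vh h" _ k "{..c}" k] elim(1) by force
  qed
next
  fix c assume c: "lam < c"
  have "orthosys V {\<mu> \<in> eigenvalues V a b. \<mu> \<le> lam} k"
    by (rule V.orthosys_of_dims) (use kth in \<open>auto simp: kth_eigenvalue_def\<close>)
  then have os: "orthosys V {..lam} k" by (rule orthosys_mono) auto
  \<comment> \<open>Half of the distance, so that the \<open>k\<close> eigenvalues found are
    strictly below \<open>lamh h\<close> if \<open>lamh h \<ge> c\<close>.\<close>
  have "(c - lam) / 2 > 0" using c by simp
  from eventually_orthosys_below[OF os kth_eigenvalue_pos[OF kth] this] kth_h in_H
  show "\<forall>\<^sub>F h in at 0 within H. lamh h < c"
  proof eventually_elim
    case (elim h)
    interpret h: stable_subspace A B Bs "Vh h" C by (rule Vh_space[OF elim(3)])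
    show ?case
    proof (rule ccontr)
      assume "\<not> lamh h < c"
      then have lt: "lam + (c - lam) / 2 < lamh h" using c by (simp add: field_simps)
      from elim(1) have "k \<le> (\<Sum>\<mu> | \<mu> \<in> eigenvalues (Vh h) a b \<and> \<mu> < lamh h. dim (eigenspace (Vh h) a b \<mu>))"
      proof (rule h.dims_of_orthosys)
        show "finite {\<mu> \<in> eigenvalues (Vh h) a b. \<mu> < lamh h}"
          by (rule finite_subset[of _ "{\<mu> \<in> eigenvalues (Vh h) a b. \<mu> \<le> lamh h}"])
            (use elim(2) in \<open>auto simp: kth_eigenvalue_def\<close>)
      qed (use lt elim(2) in \<open>auto simp: kth_eigenvalue_def\<close>)
      then show False using elim(2) by (simp add: kth_eigenvalue_def)
    qed
  qed
qed

subsection \<open>Error estimates in terms of the gap\<close>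

text \<open>Abstract counterpart of \<open>gap\<close>. A real \<open>SUP\<close> is meaningful only
  for bounded nonempty sets: the bound 1 comes from \<open>0 \<in> Vh h\<close>, and
  \<open>M \<noteq> {0}\<close> will provide unit vectors.\<close>

definition gap_to_Vh :: "'z set \<Rightarrow> real \<Rightarrow> real" where
  "gap_to_Vh M h = (SUP U\<in>{U \<in> M. norm U = 1}. infdist U (Vh h))"

lemma infdist_unit_le:
  assumes h: "h \<in> H" and U: "norm U = 1"
  shows "infdist U (Vh h) \<le> 1"
proof -
  have "0 \<in> Vh h" using Vh[OF h] subspace_0 by blast
  from infdist_le[OF this, of U] show ?thesis using U by simp
qed

lemma gap_bdd_above: "h \<in> H \<Longrightarrow> bdd_above ((\<lambda>U. infdist U (Vh h)) ` {U \<in> M. norm U = 1})"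
  by (rule bdd_aboveI2[where M = 1]) (simp add: infdist_unit_le)

lemma infdist_le_gap:
  assumes h: "h \<in> H" and M: "subspace M" and U: "U \<in> M"
  shows "infdist U (Vh h) \<le> gap_to_Vh M h * norm U"
proof (cases "U = 0")
  case True
  have "0 \<in> Vh h" using Vh[OF h] subspace_0 by blast
  from infdist_le[OF this, of U] show ?thesis using True by simp
next
  case False
  have ne: "Vh h \<noteq> {}" using Vh[OF h] subspace_0 by blast
  define e where "e = (1 / norm U) *\<^sub>R U"
  have e: "e \<in> M" "norm e = 1" "U = norm U *\<^sub>R e" using False M U by (auto simp: e_def intro: subspace_scale)
  have "infdist U (Vh h) / norm U \<le> dist e Z" if Z: "Z \<in> Vh h" for Z
  proof -
    have "infdist U (Vh h) \<le> dist U (norm U *\<^sub>R Z)"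
      using Z Vh[OF h] by (intro infdist_le) (auto intro: subspace_scale)
    also have "\<dots> = norm (norm U *\<^sub>R (e - Z))"
      unfolding dist_norm scaleR_diff_right using e(3) by simp
    also have "\<dots> = norm U * dist e Z" by (simp add: dist_norm)
    finally show ?thesis using False by (simp add: field_simps)
  qed
  then have "infdist U (Vh h) / norm U \<le> infdist e (Vh h)"
    unfolding infdist_def[of e] using ne by (auto intro: cINF_greatest)
  also have "\<dots> \<le> gap_to_Vh M h"
    unfolding gap_to_Vh_def using e gap_bdd_above[OF h] by (intro cSUP_upper) auto
  finally show ?thesis using False by (simp add: field_simps)
qed

lemma gap_nonneg:
  assumes h: "h \<in> H" and M: "subspace M" "M \<noteq> {0}"
  shows "gap_to_Vh M h \<ge> 0"
proof -
  obtain U where U: "U \<in> M" "U \<noteq> 0" using M subspace_0 by blast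
  have "0 \<le> gap_to_Vh M h * norm U" using infdist_le_gap[OF h M(1) U(1)] infdist_nonneg order_trans by blast
  then show ?thesis using U(2) by (simp add: zero_le_mult_iff)
qed

text \<open>Approximation of single vectors becomes uniform on the unit sphere of a
  finite-dimensional \<open>M\<close>: coefficients in an orthonormal basis are at most 1, so the
  Galerkin errors of the basis vectors add up to a bound.\<close>

lemma gap_tendsto_0:
  assumes M: "subspace M" "finite_dimensional M" "M \<subseteq> V" "M \<noteq> {0}"
  shows "(gap_to_Vh M \<longlongrightarrow> 0) (at 0 within H)"
proof -
  obtain D where D: "finite D" "orthonormal D" "span D = M"
    using orthonormal_basis_exists[OF M(2,1)] by metis
  have "((\<lambda>h. \<Sum>d\<in>D. norm (d - solh h (A d))) \<longlongrightarrow> (\<Sum>d\<in>D. norm (d - d))) (at 0 within H)"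
    using D(3) M(3) span_base by (intro tendsto_intros galerkin_tendsto) blast
  then have lim: "((\<lambda>h. \<Sum>d\<in>D. norm (d - solh h (A d))) \<longlongrightarrow> 0) (at 0 within H)" by simp
  show ?thesis
  proof (rule tendsto_sandwich[OF _ _ tendsto_const lim])
    show "\<forall>\<^sub>F h in at 0 within H. 0 \<le> gap_to_Vh M h"
      using in_H by eventually_elim (rule gap_nonneg[OF _ M(1,4)])
    show "\<forall>\<^sub>F h in at 0 within H. gap_to_Vh M h \<le> (\<Sum>d\<in>D. norm (d - solh h (A d)))"
      using in_H
    proof eventually_elim
      case (elim h)
      interpret h: stable_subspace A B Bs "Vh h" C by (rule Vh_space[OF elim])
      obtain U where "U \<in> M" "U \<noteq> 0" using M subspace_0 by blast
      then have "(1 / norm U) *\<^sub>R U \<in> {U \<in> M. norm U = 1}" using M(1) by (auto intro: subspace_scale)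
      then have ne: "{U \<in> M. norm U = 1} \<noteq> {}" by blast
      show ?case unfolding gap_to_Vh_def
      proof (rule cSUP_least[OF ne])
        fix U assume U: "U \<in> {U \<in> M. norm U = 1}"
        have Ue: "(\<Sum>d\<in>D. inner U d *\<^sub>R d) = U" using orthonormal_expand[OF D(2,1)] D(3) U by blast
        have "infdist U (Vh h) \<le> norm (U - solh h (A U))"
          using infdist_le[OF h.sol(1)] by (simp add: dist_norm)
        also have "U - solh h (A U) = (\<Sum>d\<in>D. inner U d *\<^sub>R (d - solh h (A d)))"
        proof -
          have "solh h (A (\<Sum>d\<in>D. inner U d *\<^sub>R d)) = (\<Sum>d\<in>D. inner U d *\<^sub>R solh h (A d))"
            by (simp add: A.sum A.scaleR h.sol.sum h.sol.scaleR)
          then show ?thesis using Ue by (simp add: scaleR_diff_right sum_subtractf)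
        qed
        also have "norm \<dots> \<le> (\<Sum>d\<in>D. norm (inner U d *\<^sub>R (d - solh h (A d))))" by (rule norm_sum)
        also have "\<dots> \<le> (\<Sum>d\<in>D. norm (d - solh h (A d)))"
        proof (rule sum_mono)
          fix d assume "d \<in> D"
          then have "\<bar>inner U d\<bar> \<le> 1" using Cauchy_Schwarz_ineq2[of U d] D(2) U by (simp add: orthonormal_def)
          then show "norm (inner U d *\<^sub>R (d - solh h (A d))) \<le> norm (d - solh h (A d))"
            by (simp add: mult_left_le_one_le)
        qed
        finally show "infdist U (Vh h) \<le> (\<Sum>d\<in>D. norm (d - solh h (A d)))" .
      qed
    qed
  qed
qed

text \<open>
  The Galerkin projection followed by the \<open>L\<close>-orthogonal projection onto the discrete eigenvectors
  with eigenvalues near \<open>lam\<close> maps \<open>M\<close> onto their span, since there are at most \<open>dim M\<close> of them.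
\<close>

theorem eigenvector_estimate:
  assumes lam: "lam > 0" and M: "M = eigenspace V a b lam" and fin: "finite_dimensional M" and M0: "M \<noteq> {0}"
    and lamh: "(lamh \<longlongrightarrow> lam) (at 0 within H)"
    and Uh: "\<forall>\<^sub>F h in at 0 within H. Uh h \<in> eigenspace (Vh h) a b (lamh h) \<and> norm (Uh h) = 1"
  shows "\<exists>K. \<forall>\<^sub>F h in at 0 within H. \<exists>U\<in>M. norm (Uh h - U) \<le> K * gap_to_Vh M h"
proof -
  have subM: "subspace M" and MV: "M \<subseteq> V" by (simp_all add: M V.subspace_eigenspace V.eigenspace_subset)
  have "\<not> orthosys V {lam} (Suc (dim M))"
  proof
    assume "orthosys V {lam} (Suc (dim M))"
    then have "Suc (dim M) \<le> (\<Sum>\<mu>\<in>{lam}. dim (eigenspace V a b \<mu>))"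
      by (rule V.dims_of_orthosys) (use fin M in auto)
    then show False using M by simp
  qed
  then obtain \<epsilon> where \<epsilon>: "\<epsilon> > 0" "\<forall>\<^sub>F h in at 0 within H. \<not> orthosys (Vh h) {lam - \<epsilon>..lam + \<epsilon>} (Suc (dim M))"
    using eventually_not_orthosys_at by blast
  \<comment> \<open>Lower bound for \<open>\<bar>1 - lam * l d\<bar>\<close> when
    \<open>1 / l d\<close> lies outside the window of radius \<open>\<epsilon>\<close>; the right
    end, \<open>l d = 1 / (lam + \<epsilon>)\<close>, is the worst case.\<close>
  define \<kappa> where "\<kappa> = \<epsilon> / (lam + \<epsilon>)"
  have \<kappa>: "\<kappa> > 0" "\<kappa> \<le> 1" using \<epsilon>(1) lam by (auto simp: \<kappa>_def)
  define c1 where "c1 = 1 + C * onorm A"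
  define c2 where "c2 = c1 + C * (onorm Bs * ((lam / \<kappa>) * (onorm B * c1)))"
  have on0: "onorm A \<ge> 0" "onorm B \<ge> 0" "onorm Bs \<ge> 0"
    using onorm_pos_le A B Bs by auto
  have "((\<lambda>h. c2 * gap_to_Vh M h) \<longlongrightarrow> c2 * 0) (at 0 within H)"
    by (intro tendsto_intros gap_tendsto_0 subM fin MV M0)
  \<comment> \<open>With 1/2 as bound, the map \<open>P\<close> below is a perturbation of the
    identity on \<open>M\<close> and hence injective there.\<close>
  then have small: "\<forall>\<^sub>F h in at 0 within H. c2 * gap_to_Vh M h < 1 / 2"
    by (rule order_tendstoD) simp
  have win: "\<forall>\<^sub>F h in at 0 within H. lam - \<epsilon> < lamh h" "\<forall>\<^sub>F h in at 0 within H. lamh h < lam + \<epsilon>"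
    using order_tendstoD[OF lamh] \<epsilon>(1) by auto
  have "\<forall>\<^sub>F h in at 0 within H. \<exists>U\<in>M. norm (Uh h - U) \<le> (2 * c2) * gap_to_Vh M h"
    using in_H small win Uh \<epsilon>(2)
  proof eventually_elim
    case (elim h)
    interpret h: stable_subspace A B Bs "Vh h" C by (rule Vh_space[OF elim(1)])
    let ?\<delta> = "gap_to_Vh M h"
    have \<delta>0: "?\<delta> \<ge> 0" by (rule gap_nonneg[OF elim(1) subM M0])
    have "finite_dimensional (Vh h)" using Vh[OF elim(1)] by blast
    then obtain D l where D: "finite D" "orthonormal D" "span D = B ` Vh h"
      "\<And>d. d \<in> D \<Longrightarrow> Th h d = l d *\<^sub>R d" "\<And>d. d \<in> D \<Longrightarrow> l d \<ge> 0" using h.T_spectral by metis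
    define E where "E = {d \<in> D. l d \<noteq> 0 \<and> 1 / l d \<in> {lam - \<epsilon>..lam + \<epsilon>}}"
    have E: "finite E" "E \<subseteq> D" "orthonormal E" using D orthonormal_subset[of D E] by (auto simp: E_def)
    have "orthosys (Vh h) {lam - \<epsilon>..lam + \<epsilon>} (card E)"
      by (rule h.orthosys_T[of _ l]) (use D E in \<open>auto simp: E_def\<close>)
    then have cardE: "card E \<le> dim M"
      using elim(6) orthosys_mono[of "Vh h" "{lam - \<epsilon>..lam + \<epsilon>}" "card E" _ "Suc (dim M)"]
      by (meson not_less_eq_eq order_refl)
    \<comment> \<open>For \<open>U\<close> in \<open>M\<close> this is its Galerkin projection, with
      only the discrete eigenvectors in the window retained.\<close>
    define P where "P U = (\<Sum>d\<in>E. (lam * inner (B U) d) *\<^sub>R solh h (Bs d))" for U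
    have linP: "linear P"
      by (rule linearI)
        (simp_all add: P_def B.add B.scaleR inner_add_left distrib_left scaleR_add_left sum.distrib scaleR_sum_right mult_ac)
    have off: "\<kappa> \<le> \<bar>1 - lam * l d\<bar>" if d: "d \<in> D - E" for d
    proof (cases "l d = 0")
      case True
      then show ?thesis using \<kappa> by simp
    next
      case False
      define t where "t = 1 / l d"
      have ld: "l d > 0" using False D(5)[of d] d by auto
      then have t: "t > 0" "l d = 1 / t" by (auto simp: t_def)
      have "t < lam - \<epsilon> \<or> t > lam + \<epsilon>" using d False by (auto simp: E_def t_def)
      then show ?thesis
      proof
        assume "t < lam - \<epsilon>"
        then have "\<epsilon> * t \<le> (lam - t) * (lam + \<epsilon>)" using \<epsilon>(1) lam t by (intro mult_mono) auto
        then have "\<kappa> \<le> (lam - t) / t" using t lam \<epsilon>(1) by (simp add: \<kappa>_def field_simps)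
        also have "\<dots> = lam * l d - 1" using t by (simp add: field_simps)
        finally show ?thesis by linarith
      next
        assume "t > lam + \<epsilon>"
        then have "lam / t \<le> lam / (lam + \<epsilon>)" using lam \<epsilon>(1) by (intro divide_left_mono) auto
        moreover have "1 - lam / (lam + \<epsilon>) = \<kappa>" using lam \<epsilon>(1) by (simp add: \<kappa>_def field_simps)
        ultimately show ?thesis using t by simp
      qed
    qed
    have est: "norm (U - P U) \<le> c2 * ?\<delta> * norm U" if U: "U \<in> M" for U
    proof -
      let ?g = "\<Sum>d\<in>D-E. inner (B U) d *\<^sub>R d"
      have UV: "U \<in> V" using U MV by blast
      have "norm (U - solh h (A U)) \<le> c1 * infdist U (Vh h)"
        unfolding c1_def by (rule galerkin_error[OF elim(1)])
      also have "\<dots> \<le> c1 * (?\<delta> * norm U)"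
        using infdist_le_gap[OF elim(1) subM U] C_pos on0 by (intro mult_left_mono) (auto simp: c1_def)
      finally have e1: "norm (U - solh h (A U)) \<le> c1 * ?\<delta> * norm U" by (simp add: mult_ac)
      have PU: "solh h (A U) = lam *\<^sub>R solh h (Bs (B U))"
      proof (rule h.sol_eqI)
        show "lam *\<^sub>R solh h (Bs (B U)) \<in> Vh h" using h.sol h.subspace_X by (intro subspace_scale)
        fix W assume W: "W \<in> Vh h"
        have "W \<in> V" using W Vh[OF elim(1)] by blast
        then have "a U W = lam * b U W" using U M by (simp add: eigenspace_def)
        then show "a (lam *\<^sub>R solh h (Bs (B U))) W = a U W" using W by (simp add: A.scaleR h.sol adj)
      qed
      \<comment> \<open>The coefficient of the Galerkin error along \<open>d\<close> is that of
        \<open>B U\<close> times \<open>1 - lam * l d\<close>; outside the window the error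
        therefore controls \<open>B U\<close> up to the factor \<open>1 / \<kappa>\<close>.\<close>
      have res: "inner (B (U - solh h (A U))) d = (1 - lam * l d) * inner (B U) d" if d: "d \<in> D" for d
      proof -
        have "B (solh h (A U)) = lam *\<^sub>R Th h (B U)" by (simp add: PU B.scaleR h.T_def)
        moreover have "inner (Th h (B U)) d = l d * inner (B U) d" using D(4)[OF d] by (simp add: h.T_sym)
        ultimately show ?thesis by (simp add: B.diff inner_diff_left algebra_simps)
      qed
      have "\<kappa>\<^sup>2 * (norm ?g)\<^sup>2 = (\<Sum>d\<in>D-E. \<kappa>\<^sup>2 * (inner (B U) d)\<^sup>2)"
        using orthonormal_norm_sum[of "D - E" "inner (B U)"] D orthonormal_subset[of D "D - E"]
        by (simp add: sum_distrib_left)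
      also have "\<dots> \<le> (\<Sum>d\<in>D-E. (inner (B (U - solh h (A U))) d)\<^sup>2)"
      proof (rule sum_mono)
        fix d assume d: "d \<in> D - E"
        have "\<kappa>\<^sup>2 \<le> (1 - lam * l d)\<^sup>2" using off[OF d] \<kappa> by (metis abs_le_square_iff abs_of_pos)
        then show "\<kappa>\<^sup>2 * (inner (B U) d)\<^sup>2 \<le> (inner (B (U - solh h (A U))) d)\<^sup>2"
          using d by (simp add: res power_mult_distrib mult_right_mono)
      qed
      also have "\<dots> \<le> (\<Sum>d\<in>D. (inner (B (U - solh h (A U))) d)\<^sup>2)" using D(1) by (intro sum_mono2) auto
      also have "\<dots> \<le> (norm (B (U - solh h (A U))))\<^sup>2" by (rule bessel[OF D(2,1)])
      finally have "(\<kappa> * norm ?g)\<^sup>2 \<le> (norm (B (U - solh h (A U))))\<^sup>2" by (simp add: power_mult_distrib)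
      then have "\<kappa> * norm ?g \<le> norm (B (U - solh h (A U)))" by (rule power2_le_imp_le) simp
      also have "\<dots> \<le> onorm B * norm (U - solh h (A U))" by (rule onorm[OF B])
      also have "\<dots> \<le> onorm B * (c1 * ?\<delta> * norm U)" by (intro mult_left_mono e1 on0)
      finally have g: "norm ?g \<le> (1 / \<kappa>) * (onorm B * (c1 * ?\<delta> * norm U))" using \<kappa> by (simp add: field_simps)
      \<comment> \<open>What \<open>P\<close> discards is again a discrete solution, with the
        components of \<open>B U\<close> off the window as load; stability turns the bound on
        \<open>?g\<close> into one in the full norm.\<close>
      have "solh h (A U) - P U = lam *\<^sub>R solh h (Bs ?g)"
      proof -
        have "solh h (A U) = (\<Sum>d\<in>D. (lam * inner (B U) d) *\<^sub>R solh h (Bs d))"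
          unfolding PU h.sol_Bs_expand[OF D(1-3), of "B U"] by (simp add: scaleR_sum_right)
        also have "\<dots> = P U + (\<Sum>d\<in>D-E. (lam * inner (B U) d) *\<^sub>R solh h (Bs d))"
          unfolding P_def by (subst sum.subset_diff[OF E(2) D(1)]) (rule add.commute)
        also have "(\<Sum>d\<in>D-E. (lam * inner (B U) d) *\<^sub>R solh h (Bs d)) = lam *\<^sub>R solh h (Bs ?g)"
          by (simp add: Bs.sum Bs.scaleR h.sol.sum h.sol.scaleR scaleR_sum_right)
        finally show ?thesis by simp
      qed
      then have "norm (solh h (A U) - P U) = lam * norm (solh h (Bs ?g))" using lam by simp
      also have "\<dots> \<le> lam * (C * norm (Bs ?g))" using lam h.norm_sol by simp
      also have "\<dots> \<le> lam * (C * (onorm Bs * norm ?g))"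
        using lam C_pos onorm[OF Bs, of ?g] by simp
      also have "\<dots> \<le> lam * (C * (onorm Bs * ((1 / \<kappa>) * (onorm B * (c1 * ?\<delta> * norm U)))))"
        using lam C_pos on0 by (intro mult_left_mono g) auto
      finally have e2: "norm (solh h (A U) - P U) \<le> C * (onorm Bs * ((lam / \<kappa>) * (onorm B * c1))) * ?\<delta> * norm U"
        by (simp add: mult_ac)
      have "norm (U - P U) \<le> norm (U - solh h (A U)) + norm (solh h (A U) - P U)"
        using norm_triangle_ineq[of "U - solh h (A U)" "solh h (A U) - P U"] by simp
      also have "\<dots> \<le> c2 * ?\<delta> * norm U" using e1 e2 by (simp add: c2_def distrib_right)
      finally show ?thesis .
    qed
    have half: "norm (U - P U) \<le> norm U / 2" if "U \<in> M" for U
      using est[OF that] elim(2) mult_right_mono[of "c2 * ?\<delta>" "1/2" "norm U"] by simp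
    have inj: "inj_on P M"
    proof (rule inj_onI)
      fix U W assume UW: "U \<in> M" "W \<in> M" "P U = P W"
      then have "U - W \<in> M" "P (U - W) = 0" using subM linear_diff[OF linP] by (auto intro: subspace_diff)
      then have "norm (U - W) \<le> norm (U - W) / 2" using half[of "U - W"] by simp
      then show "U = W" by simp
    qed
    obtain S where S: "finite S" "independent S" "span S = M" "card S = dim M"
      using finite_dimensional_basis[OF fin subM] by metis
    \<comment> \<open>\<open>F\<close> has at most \<open>card E \<le> dim M\<close> elements, so
      the injective image of \<open>M\<close> fills its span.\<close>
    define F where "F = (\<lambda>d. solh h (Bs d)) ` E"
    have F: "finite F" "card F \<le> dim M" using E(1) cardE card_image_le[OF E(1), of "\<lambda>d. solh h (Bs d)"] by (auto simp: F_def)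
    have injS: "inj_on P (span S)" using inj S(3) by simp
    have cS: "card (P ` S) = dim M"
      using S(4) card_image[of P S] inj_on_subset[OF injS span_superset] by simp
    have "P ` S \<subseteq> span F" unfolding P_def F_def by (auto intro!: span_sum span_scale intro: span_base)
    then have "span (P ` S) = span F"
      using span_eq_of_card[OF F(1) _ linear_independent_injective_image[OF linP S(2) injS]] F(2) cS by simp
    then have PM: "P ` M = span F" using linear_span_image[OF linP, of S] S(3) by simp
    have UhE: "Uh h \<in> Vh h" "Uh h = lamh h *\<^sub>R solh h (Bs (B (Uh h)))" and nU: "norm (Uh h) = 1"
      using elim(5) h.eigenspace_iff by auto
    \<comment> \<open>The discrete eigenvector has components only along those \<open>d\<close> with
      \<open>1 / l d = lamh h\<close>, and \<open>lamh h\<close> is in the window.\<close>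
    have in_E: "d \<in> E" if d: "d \<in> D" "inner (B (Uh h)) d \<noteq> 0" for d
    proof -
      have "B (Uh h) = lamh h *\<^sub>R Th h (B (Uh h))" using elim(5) h.eigenspace_T by blast
      then have "inner (B (Uh h)) d = lamh h * inner (Th h (B (Uh h))) d" by (metis inner_scaleR_left)
      also have "inner (Th h (B (Uh h))) d = l d * inner (B (Uh h)) d" using D(4)[OF d(1)] by (simp add: h.T_sym)
      finally have "lamh h * l d = 1" using d(2) by simp
      then have "l d \<noteq> 0" "1 / l d = lamh h" by (auto simp: eq_commute[of _ "lamh h"] eq_divide_eq)
      then show ?thesis using d(1) elim(3,4) by (simp add: E_def)
    qed
    have "Uh h \<in> span F"
    proof -
      have "solh h (Bs (B (Uh h))) = (\<Sum>d\<in>D. inner (B (Uh h)) d *\<^sub>R solh h (Bs d))"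
        by (rule h.sol_Bs_expand[OF D(1-3)])
      also have "\<dots> \<in> span F"
      proof (rule span_sum)
        fix d assume "d \<in> D"
        then show "inner (B (Uh h)) d *\<^sub>R solh h (Bs d) \<in> span F"
          using in_E[of d] by (cases "inner (B (Uh h)) d = 0") (auto simp: F_def span_zero intro: span_scale span_base)
      qed
      finally show ?thesis using UhE(2) span_scale by metis
    qed
    then obtain U where U: "U \<in> M" "Uh h = P U" using PM by blast
    \<comment> \<open>\<open>U\<close> is a preimage of a unit vector under \<open>P\<close>, which
      on \<open>M\<close> shrinks norms by at most one half.\<close>
    have "norm U \<le> 2" using half[OF U(1)] norm_triangle_ineq2[of U "P U"] nU U(2) by simp
    have "c2 \<ge> 0"
      unfolding c2_def c1_def using C_pos on0 lam \<kappa> by (intro add_nonneg_nonneg mult_nonneg_nonneg) auto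
    have "norm (Uh h - U) \<le> c2 * ?\<delta> * norm U" using est[OF U(1)] U(2) by (simp add: norm_minus_commute)
    also have "\<dots> \<le> c2 * ?\<delta> * 2" using \<open>norm U \<le> 2\<close> \<open>c2 \<ge> 0\<close> \<delta>0 by (intro mult_left_mono) auto
    finally show ?case using U(1) by (intro bexI[of _ U]) (simp_all add: mult_ac)
  qed
  then show ?thesis by blast
qed

text \<open>With \<open>?D = Uh h - U\<close>, the terms linear in the error cancel because
  \<open>U\<close> satisfies its equation for all tests in \<open>V\<close>, among them
  \<open>Uh h\<close>. What remains is \<open>a ?D ?D - lam * b ?D ?D\<close>, to be divided by
  \<open>b (Uh h) (Uh h)\<close>.\<close>

theorem eigenvalue_estimate:
  assumes lam: "lam > 0" and M: "M = eigenspace V a b lam"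
    and lamh: "(lamh \<longlongrightarrow> lam) (at 0 within H)"
    and Uh: "\<forall>\<^sub>F h in at 0 within H. Uh h \<in> eigenspace (Vh h) a b (lamh h) \<and> norm (Uh h) = 1"
    and est: "\<forall>\<^sub>F h in at 0 within H. \<exists>U\<in>M. norm (Uh h - U) \<le> K * d h"
  shows "\<exists>K. \<forall>\<^sub>F h in at 0 within H. \<bar>lamh h - lam\<bar> \<le> K * (d h)\<^sup>2"
proof -
  \<comment> \<open>\<open>1 / c0\<close> bounds \<open>norm (B (Uh h))\<close> from below: a unit
    discrete eigenvector is \<open>lamh h\<close> times a discrete solution, and
    \<open>lamh h < lam + 1\<close>.\<close>
  define c0 where "c0 = (lam + 1) * (C * onorm Bs)"
  define KK where "KK = (onorm A + lam * (onorm B)\<^sup>2) * K\<^sup>2"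
  have on0: "onorm A \<ge> 0" "onorm B \<ge> 0" "onorm Bs \<ge> 0"
    using onorm_pos_le A B Bs by auto
  have "lam - 1 < lam" "lam < lam + 1" by auto
  then have "\<forall>\<^sub>F h in at 0 within H. lam - 1 < lamh h" "\<forall>\<^sub>F h in at 0 within H. lamh h < lam + 1"
    using order_tendstoD[OF lamh] by blast+
  then have "\<forall>\<^sub>F h in at 0 within H. \<bar>lamh h - lam\<bar> \<le> (c0\<^sup>2 * KK) * (d h)\<^sup>2"
    using in_H Uh est
  proof eventually_elim
    case (elim h)
    interpret h: stable_subspace A B Bs "Vh h" C by (rule Vh_space[OF elim(3)])
    obtain U where U: "U \<in> M" "norm (Uh h - U) \<le> K * d h" using elim(5) by blast
    let ?D = "Uh h - U"
    have UV: "U \<in> V" using U M V.eigenspace_subset by blast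
    have UhV: "Uh h \<in> Vh h" "Uh h \<in> V" using elim(4) h.eigenspace_subset Vh[OF elim(3)] by blast+
    have "Uh h = lamh h *\<^sub>R solh h (Bs (B (Uh h)))" using elim(4) h.eigenspace_iff by blast
    then have "1 = \<bar>lamh h\<bar> * norm (solh h (Bs (B (Uh h))))" using elim(4) by (metis norm_scaleR)
    also have "\<dots> \<le> (lam + 1) * (C * (onorm Bs * norm (B (Uh h))))"
    proof (rule mult_mono)
      show "\<bar>lamh h\<bar> \<le> lam + 1" using elim(1,2) lam by linarith
      have "norm (solh h (Bs (B (Uh h)))) \<le> C * norm (Bs (B (Uh h)))" by (rule h.norm_sol)
      also have "\<dots> \<le> C * (onorm Bs * norm (B (Uh h)))" using onorm[OF Bs] C_pos by simp
      finally show "norm (solh h (Bs (B (Uh h)))) \<le> C * (onorm Bs * norm (B (Uh h)))" .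
    qed (use lam in auto)
    finally have "1 \<le> c0 * norm (B (Uh h))" by (simp add: c0_def mult_ac)
    then have "1 \<le> (c0 * norm (B (Uh h)))\<^sup>2" by (rule one_le_power)
    then have low: "1 \<le> c0\<^sup>2 * b (Uh h) (Uh h)" by (simp add: power_mult_distrib power2_norm_eq_inner)
    have e1: "a (Uh h) (Uh h) = lamh h * b (Uh h) (Uh h)" using elim(4) UhV by (simp add: eigenspace_def)
    have e2: "a U (Uh h) = lam * b U (Uh h)" "a U U = lam * b U U" using U(1) M UV UhV by (auto simp: eigenspace_def)
    have e3: "a (Uh h) U = a U (Uh h)" by (metis A_sym inner_commute)
    have "a ?D ?D - lam * b ?D ?D = (lamh h - lam) * b (Uh h) (Uh h)"
      by (simp add: A.diff B.diff inner_diff_left inner_diff_right e1 e2 e3 inner_commute[of "B (Uh h)" "B U"] algebra_simps)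
    then have id: "(lamh h - lam) * b (Uh h) (Uh h) = a ?D ?D - lam * b ?D ?D" by simp
    have "\<bar>a ?D ?D\<bar> \<le> norm (A ?D) * norm ?D" by (rule Cauchy_Schwarz_ineq2)
    also have "\<dots> \<le> (onorm A * norm ?D) * norm ?D" by (intro mult_right_mono onorm[OF A]) auto
    finally have a1: "\<bar>a ?D ?D\<bar> \<le> onorm A * (norm ?D)\<^sup>2" by (simp add: power2_eq_square mult_ac)
    have "\<bar>b ?D ?D\<bar> = (norm (B ?D))\<^sup>2" by (simp add: power2_norm_eq_inner)
    also have "\<dots> \<le> (onorm B * norm ?D)\<^sup>2" by (intro power_mono onorm[OF B]) auto
    finally have b1: "\<bar>b ?D ?D\<bar> \<le> (onorm B)\<^sup>2 * (norm ?D)\<^sup>2" by (simp add: power_mult_distrib)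
    have "\<bar>(lamh h - lam) * b (Uh h) (Uh h)\<bar> \<le> \<bar>a ?D ?D\<bar> + lam * \<bar>b ?D ?D\<bar>"
      unfolding id using lam by (simp add: abs_mult order_trans[OF abs_triangle_ineq4])
    also have "\<dots> \<le> onorm A * (norm ?D)\<^sup>2 + lam * ((onorm B)\<^sup>2 * (norm ?D)\<^sup>2)"
      using a1 b1 lam by (intro add_mono mult_left_mono) auto
    also have "\<dots> = (onorm A + lam * (onorm B)\<^sup>2) * (norm ?D)\<^sup>2" by (simp add: algebra_simps)
    also have "\<dots> \<le> (onorm A + lam * (onorm B)\<^sup>2) * (K * d h)\<^sup>2"
      using on0 lam U(2) by (intro mult_left_mono power_mono) auto
    finally have up: "\<bar>lamh h - lam\<bar> * b (Uh h) (Uh h) \<le> KK * (d h)\<^sup>2"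
      by (simp add: KK_def power_mult_distrib abs_mult mult_ac)
    have "\<bar>lamh h - lam\<bar> * 1 \<le> \<bar>lamh h - lam\<bar> * (c0\<^sup>2 * b (Uh h) (Uh h))"
      by (intro mult_left_mono low) auto
    also have "\<dots> = c0\<^sup>2 * (\<bar>lamh h - lam\<bar> * b (Uh h) (Uh h))" by (simp add: mult_ac)
    also have "\<dots> \<le> c0\<^sup>2 * (KK * (d h)\<^sup>2)" by (intro mult_left_mono up) auto
    finally show ?case by (simp add: mult_ac)
  qed
  then show ?thesis by blast
qed

end

section \<open>Completeness of the space of square-integrable functions\<close>

lemma l2_eq_refl: "l2_eq f f \<longleftrightarrow> square_integrable f"
  by (auto simp: l2_eq_def)

lemma square_integrable_rep [simp]: "square_integrable (rep_l2 f)"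
  using Quotient3_rep_reflp[OF Quotient3_l2, of f] by (simp add: l2_eq_refl)

lemma borel_measurable_rep [measurable, simp]: "rep_l2 f \<in> borel_measurable borel"
  using square_integrable_rep[of f] by (simp add: square_integrable_def)

lemma rep_abs_l2: "square_integrable f \<Longrightarrow> AE x in lborel. rep_l2 (abs_l2 f) x = f x"
  using Quotient3_rep_abs[OF Quotient3_l2, of f] by (simp add: l2_eq_def)

lemma abs_rep_l2 [simp]: "abs_l2 (rep_l2 f) = f"
  by (rule Quotient3_abs_rep[OF Quotient3_l2])

lemma abs_l2_eqI:
  assumes "square_integrable f" "square_integrable g" "AE x in lborel. f x = g x"
  shows "abs_l2 f = abs_l2 g"
  by (rule Quotient3_rel_abs[OF Quotient3_l2]) (use assms in \<open>simp add: l2_eq_def\<close>)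

lemma abs_l2_add:
  assumes "square_integrable f" "square_integrable g"
  shows "abs_l2 f + abs_l2 g = abs_l2 (\<lambda>x. f x + g x)"
  by (rule plus_l2.abs_eq) (use assms in \<open>simp_all add: l2_eq_refl\<close>)

lemma abs_l2_scaleR: "square_integrable f \<Longrightarrow> r *\<^sub>R abs_l2 f = abs_l2 (\<lambda>x. r * f x)"
  by (rule scaleR_l2.abs_eq) (simp add: l2_eq_refl)

lemma square_integrable_diff:
  assumes "square_integrable f" "square_integrable g"
  shows "square_integrable (\<lambda>x. f x - g x)"
  using square_integrable_add[OF assms(1) square_integrable_scale[OF assms(2), of "-1"]] by simp

lemma abs_l2_diff:
  assumes "square_integrable f" "square_integrable g"
  shows "abs_l2 f - abs_l2 g = abs_l2 (\<lambda>x. f x - g x)"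
proof -
  have "abs_l2 f - abs_l2 g = abs_l2 f + (-1) *\<^sub>R abs_l2 g" by simp
  then show ?thesis
    using assms square_integrable_scale[OF assms(2), of "-1"] by (simp only: abs_l2_scaleR abs_l2_add) simp
qed

lemma inner_abs_l2:
  assumes "square_integrable f" "square_integrable g"
  shows "inner (abs_l2 f) (abs_l2 g) = (LINT x|lborel. f x * g x)"
  by (rule inner_l2.abs_eq) (use assms in \<open>simp_all add: l2_eq_refl\<close>)

lemma inner_rep_l2: "inner f g = (LINT x|lborel. rep_l2 f x * rep_l2 g x)"
  using inner_abs_l2[of "rep_l2 f" "rep_l2 g"] by simp

lemma inner_abs_l2_right: "square_integrable g \<Longrightarrow> inner f (abs_l2 g) = (LINT x|lborel. rep_l2 f x * g x)"
  using inner_abs_l2[of "rep_l2 f" g] by simp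

lemma norm_abs_l2_power2: "square_integrable f \<Longrightarrow> (norm (abs_l2 f))\<^sup>2 = (LINT x|lborel. (f x)\<^sup>2)"
  unfolding power2_norm_eq_inner by (simp add: inner_abs_l2 power2_eq_square)

lemma norm_abs_l2_le:
  assumes "square_integrable f" "square_integrable g" "\<And>x. \<bar>f x\<bar> \<le> \<bar>g x\<bar>"
  shows "norm (abs_l2 f) \<le> norm (abs_l2 g)"
proof (rule power2_le_imp_le)
  show "(norm (abs_l2 f))\<^sup>2 \<le> (norm (abs_l2 g))\<^sup>2"
    unfolding norm_abs_l2_power2[OF assms(1)] norm_abs_l2_power2[OF assms(2)]
    using assms by (intro integral_mono) (auto simp: square_integrable_def abs_le_square_iff)
qed simp

lemma nn_integral_square:
  "square_integrable f \<Longrightarrow> (\<integral>\<^sup>+x. ennreal ((f x)\<^sup>2) \<partial>lborel) = ennreal ((norm (abs_l2 f))\<^sup>2)"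
  by (simp add: norm_abs_l2_power2 nn_integral_eq_integral square_integrable_def)

lemma square_integrableI_nn:
  assumes "f \<in> borel_measurable borel" "(\<integral>\<^sup>+x. ennreal ((f x)\<^sup>2) \<partial>lborel) < \<infinity>"
  shows "square_integrable f"
  unfolding square_integrable_def using assms by (auto intro!: integrableI_nonneg)

text \<open>Riesz-Fischer. The partial sums \<open>G N\<close> of the absolute increments stay
  bounded in norm, monotone convergence makes their supremum finite almost everywhere, and absolute
  convergence gives the pointwise limit. Fatou's lemma identifies it as the limit in norm.\<close>

lemma l2_fast_Cauchy_convergent:
  fixes X :: "nat \<Rightarrow> 'a::euclidean_space l2"
  assumes X: "\<And>n. norm (X (Suc n) - X n) \<le> (1/2)^n"
  shows "convergent X"
proof -
  define u where "u n = rep_l2 (X n)" for n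
  define g where "g n x = \<bar>u (Suc n) x - u n x\<bar>" for n x
  define G where "G N x = (\<Sum>n<N. g n x)" for N x
  have u: "square_integrable (u n)" for n by (simp add: u_def)
  have [measurable]: "u n \<in> borel_measurable borel" for n by (simp add: u_def)
  have abs_u: "abs_l2 (u n) = X n" for n by (simp add: u_def)
  have [measurable]: "g n \<in> borel_measurable borel" for n unfolding g_def by measurable
  have [measurable]: "G n \<in> borel_measurable borel" for n unfolding G_def by measurable
  have sd: "square_integrable (\<lambda>x. u m x - u n x)" for m n by (rule square_integrable_diff[OF u u])
  have g: "square_integrable (g n)" for n
    using sd[of "Suc n" n] by (simp add: square_integrable_def g_def)
  have ng: "norm (abs_l2 (g n)) \<le> (1/2)^n" for n
  proof -
    have "norm (abs_l2 (g n)) \<le> norm (abs_l2 (\<lambda>x. u (Suc n) x - u n x))"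
      by (rule norm_abs_l2_le[OF g sd]) (simp add: g_def)
    also have "\<dots> = norm (X (Suc n) - X n)" by (simp add: abs_u flip: abs_l2_diff[OF u u])
    finally show ?thesis using X order_trans by blast
  qed
  have G: "square_integrable (G N) \<and> norm (abs_l2 (G N)) \<le> (\<Sum>n<N. (1/2)^n)" for N
  proof (induction N)
    case 0
    have "abs_l2 (\<lambda>x. 0) = (0 :: 'a l2)" by (simp add: zero_l2_def)
    then show ?case by (simp add: G_def[abs_def] square_integrable_zero)
  next
    case (Suc N)
    have eq: "G (Suc N) = (\<lambda>x. G N x + g N x)" by (auto simp: G_def)
    have "norm (abs_l2 (G (Suc N))) \<le> norm (abs_l2 (G N)) + norm (abs_l2 (g N))"
      unfolding eq abs_l2_add[OF conjunct1[OF Suc] g, symmetric] by (rule norm_triangle_ineq)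
    then show ?case using Suc ng[of N] square_integrable_add[OF conjunct1[OF Suc] g] by (simp add: eq)
  qed
  have geo: "(\<Sum>n<N. (1/2)^n) \<le> (2::real)" for N
    by (simp add: sum_gp_strict)
  have mono: "incseq (\<lambda>N. ennreal ((G N x)\<^sup>2))" for x
  proof (rule incseq_SucI)
    fix N
    have "0 \<le> G N x" unfolding G_def g_def by (simp add: sum_nonneg)
    moreover have "0 \<le> g N x" by (simp add: g_def)
    moreover have "G (Suc N) x = G N x + g N x" by (simp add: G_def)
    ultimately show "ennreal ((G N x)\<^sup>2) \<le> ennreal ((G (Suc N) x)\<^sup>2)"
      by (intro ennreal_leI power_mono) auto
  qed
  have "(\<integral>\<^sup>+x. (SUP N. ennreal ((G N x)\<^sup>2)) \<partial>lborel) = (SUP N. \<integral>\<^sup>+x. ennreal ((G N x)\<^sup>2) \<partial>lborel)"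
    using mono by (intro nn_integral_monotone_convergence_SUP) (auto simp: incseq_def le_fun_def)
  also have "\<dots> \<le> ennreal 4"
  proof (rule SUP_least)
    fix N
    have "norm (abs_l2 (G N)) \<le> 2" using G[of N] geo[of N] by linarith
    then have "(norm (abs_l2 (G N)))\<^sup>2 \<le> 2\<^sup>2" by (intro power_mono) auto
    then show "(\<integral>\<^sup>+x. ennreal ((G N x)\<^sup>2) \<partial>lborel) \<le> ennreal 4"
      unfolding nn_integral_square[OF conjunct1[OF G]] by (intro ennreal_leI) simp
  qed
  finally have "(\<integral>\<^sup>+x. (SUP N. ennreal ((G N x)\<^sup>2)) \<partial>lborel) \<noteq> \<infinity>"
    by (metis ennreal_less_top infinity_ennreal_def leD)
  then have "AE x in lborel. (SUP N. ennreal ((G N x)\<^sup>2)) \<noteq> \<infinity>"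
    by (intro nn_integral_noteq_infinite) auto
  then have conv: "AE x in lborel. convergent (\<lambda>n. u n x)"
  proof eventually_elim
    case (elim x)
    then obtain r where r: "r \<ge> 0" "(SUP N. ennreal ((G N x)\<^sup>2)) = ennreal r"
      by (metis ennreal_cases infinity_ennreal_def)
    have "G N x \<le> sqrt r" for N
    proof -
      have "ennreal ((G N x)\<^sup>2) \<le> ennreal r" unfolding r(2)[symmetric] by (rule SUP_upper) simp
      then have "(G N x)\<^sup>2 \<le> r" using r(1) by (simp add: ennreal_le_iff)
      then show ?thesis by (rule real_le_rsqrt)
    qed
    then have "summable (\<lambda>n. g n x)"
      by (intro bounded_imp_summable[where B = "sqrt r"])
        (auto simp: g_def G_def lessThan_Suc_atMost[symmetric] simp del: sum.lessThan_Suc)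
    then have "summable (\<lambda>n. u (Suc n) x - u n x)"
      unfolding g_def by (rule summable_rabs_cancel)
    then have "convergent (\<lambda>N. u N x - u 0 x)"
      by (simp add: summable_iff_convergent sum_lessThan_telescope[of "\<lambda>i. u i x"])
    then show ?case by (simp add: convergent_diff_const_right_iff)
  qed
  define f where "f x = lim (\<lambda>n. u n x)" for x
  have [measurable]: "f \<in> borel_measurable borel" unfolding f_def by measurable
  have lim: "AE x in lborel. (\<lambda>n. u n x) \<longlonglongrightarrow> f x"
    using conv by eventually_elim (simp add: f_def convergent_LIMSEQ_iff)
  have far: "norm (X m - X n) \<le> 2 * (1/2)^n" if "n \<le> m" for m n
  proof -
    have "norm (X (n + k) - X n) \<le> (1/2)^n * (\<Sum>j<k. (1/2)^j)" for k
    proof (induction k)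
      case (Suc k)
      have "norm (X (n + Suc k) - X n) \<le> norm (X (Suc (n + k)) - X (n + k)) + norm (X (n + k) - X n)"
        using norm_triangle_ineq[of "X (Suc (n + k)) - X (n + k)" "X (n + k) - X n"] by simp
      also have "\<dots> \<le> (1/2)^(n + k) + (1/2)^n * (\<Sum>j<k. (1/2)^j)"
        by (intro add_mono X Suc)
      finally show ?case by (simp add: power_add distrib_left)
    qed simp
    from this[of "m - n"] have "norm (X m - X n) \<le> (1/2)^n * (\<Sum>j<m-n. (1/2)^j)" using that by simp
    also have "\<dots> \<le> (1/2)^n * 2" by (intro mult_left_mono geo) auto
    finally show ?thesis by simp
  qed
  have fn: "(\<integral>\<^sup>+x. ennreal ((f x - u n x)\<^sup>2) \<partial>lborel) \<le> ennreal ((2 * (1/2)^n)\<^sup>2)" for n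
  proof -
    have "(\<integral>\<^sup>+x. ennreal ((f x - u n x)\<^sup>2) \<partial>lborel) = (\<integral>\<^sup>+x. liminf (\<lambda>m. ennreal ((u m x - u n x)\<^sup>2)) \<partial>lborel)"
    proof (rule nn_integral_cong_AE)
      show "AE x in lborel. ennreal ((f x - u n x)\<^sup>2) = liminf (\<lambda>m. ennreal ((u m x - u n x)\<^sup>2))"
        using lim
      proof eventually_elim
        case (elim x)
        have "(\<lambda>m. ennreal ((u m x - u n x)\<^sup>2)) \<longlonglongrightarrow> ennreal ((f x - u n x)\<^sup>2)"
          by (intro tendsto_ennrealI tendsto_intros elim)
        then show ?case by (metis lim_imp_Liminf sequentially_bot)
      qed
    qed
    also have "\<dots> \<le> liminf (\<lambda>m. \<integral>\<^sup>+x. ennreal ((u m x - u n x)\<^sup>2) \<partial>lborel)"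
      by (rule nn_integral_liminf) measurable
    also have "\<dots> \<le> ennreal ((2 * (1/2)^n)\<^sup>2)"
    proof (rule Liminf_le)
      show "\<forall>\<^sub>F m in sequentially. (\<integral>\<^sup>+x. ennreal ((u m x - u n x)\<^sup>2) \<partial>lborel) \<le> ennreal ((2 * (1/2)^n)\<^sup>2)"
        using eventually_ge_at_top[of n]
      proof eventually_elim
        case (elim m)
        then show ?case
          unfolding nn_integral_square[OF sd] abs_l2_diff[OF u u, symmetric] abs_u
          by (intro ennreal_leI power_mono far) auto
      qed
    qed simp
    finally show ?thesis .
  qed
  have sfn: "square_integrable (\<lambda>x. f x - u n x)" for n
    by (rule square_integrableI_nn) (use fn[of n] in \<open>auto simp: less_top[symmetric] top_unique intro: le_less_trans\<close>)
  have sf: "square_integrable f" using square_integrable_add[OF sfn[of 0] u[of 0]] by simp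
  have "norm (X n - abs_l2 f) \<le> 2 * (1/2)^n" for n
  proof (rule power2_le_imp_le)
    have "ennreal ((norm (abs_l2 f - X n))\<^sup>2) \<le> ennreal ((2 * (1/2)^n)\<^sup>2)"
      using fn[of n] unfolding nn_integral_square[OF sfn] abs_l2_diff[OF sf u, symmetric] abs_u .
    then show "(norm (X n - abs_l2 f))\<^sup>2 \<le> (2 * (1/2)^n)\<^sup>2"
      by (simp add: norm_minus_commute ennreal_le_iff)
  qed simp
  then have le: "\<forall>\<^sub>F n in sequentially. norm (X n - abs_l2 f) \<le> 2 * (1/2)^n" by simp
  have "(\<lambda>n. 2 * (1/2)^n :: real) \<longlonglongrightarrow> 0"
    by (rule tendsto_mult_right_zero) (rule LIMSEQ_realpow_zero, auto)
  then have "(\<lambda>n. X n - abs_l2 f) \<longlonglongrightarrow> 0" by (rule Lim_null_comparison[OF le])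
  then have "X \<longlonglongrightarrow> abs_l2 f" by (simp add: LIM_zero_iff)
  then show ?thesis by (auto simp: convergent_def)
qed

instance l2 :: (euclidean_space) complete_space
proof
  fix X :: "nat \<Rightarrow> 'a l2"
  assume X: "Cauchy X"
  have "\<exists>N. \<forall>m\<ge>N. \<forall>n\<ge>N. dist (X m) (X n) < (1/2)^k" for k :: nat
    using X by (simp add: Cauchy_def)
  then obtain N where N: "\<And>k m n. m \<ge> N k \<Longrightarrow> n \<ge> N k \<Longrightarrow> dist (X m) (X n) < (1/2)^k" by metis
  \<comment> \<open>The sum makes \<open>r\<close> nondecreasing and at least \<open>N k\<close>;
    the summand \<open>k\<close> makes it strictly increasing.\<close>
  define r where "r k = k + (\<Sum>j\<le>k. N j)" for k
  have rN: "r k \<ge> N k" for k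
    unfolding r_def using member_le_sum[of k "{..k}" N] by simp
  have r: "strict_mono r" by (rule strict_mono_Suc_iff[THEN iffD2]) (simp add: r_def)
  have "convergent (\<lambda>k. X (r k))"
  proof (rule l2_fast_Cauchy_convergent)
    fix k
    have "r (Suc k) \<ge> N k" using rN[of k] strict_mono_less[OF r, of k "Suc k"] by simp
    then have "dist (X (r (Suc k))) (X (r k)) < (1/2)^k" using rN N by blast
    then show "norm (X (r (Suc k)) - X (r k)) \<le> (1/2)^k" by (simp add: dist_norm)
  qed
  then obtain l where "(X \<circ> r) \<longlonglongrightarrow> l" by (auto simp: convergent_def o_def)
  then have "X \<longlonglongrightarrow> l" using Cauchy_converges_subseq[OF X r] by blast
  then show "convergent X" by (auto simp: convergent_def)
qed

section \<open>Smooth functions of bounded support\<close>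

lemma partial_eq:
  assumes "(f has_derivative f') (at x)" shows "partial i f x = f' (axis i 1)"
  using frechet_derivative_at[OF assms] by (simp add: partial_def)

lemma partial_const [simp]: "partial i (\<lambda>x. c) = (\<lambda>x. 0)"
  using partial_eq[OF has_derivative_const] by (intro ext) blast

lemma partial_has_derivative:
  assumes "f differentiable_on UNIV"
  shows "(f has_derivative (\<lambda>t. \<Sum>i\<in>UNIV. t $ i * partial i f x)) (at x)"
proof -
  have d: "(f has_derivative frechet_derivative f (at x)) (at x)"
    using assms frechet_derivative_works[of f "at x"] by (simp add: differentiable_on_def)
  then interpret D: bounded_linear "frechet_derivative f (at x)" by (rule has_derivative_bounded_linear)
  have "frechet_derivative f (at x) t = (\<Sum>i\<in>UNIV. t $ i * partial i f x)" for t
  proof -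
    have "frechet_derivative f (at x) t = frechet_derivative f (at x) (\<Sum>i\<in>UNIV. t $ i *\<^sub>R axis i 1)"
      using basis_expansion[of t] by (simp add: scalar_mult_eq_scaleR)
    then show ?thesis by (simp add: D.sum D.scaleR partial_def)
  qed
  then have eq: "frechet_derivative f (at x) = (\<lambda>t. \<Sum>i\<in>UNIV. t $ i * partial i f x)" by (rule ext)
  show ?thesis using d unfolding eq .
qed

lemma partial_mult:
  assumes "f differentiable_on UNIV" "g differentiable_on UNIV"
  shows "partial i (\<lambda>x. f x * g x) = (\<lambda>x. f x * partial i g x + partial i f x * g x)"
proof
  fix x
  have "(f has_derivative frechet_derivative f (at x)) (at x)" "(g has_derivative frechet_derivative g (at x)) (at x)"
    using assms frechet_derivative_works by (auto simp: differentiable_on_def)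
  from partial_eq[OF has_derivative_mult[OF this]]
  show "partial i (\<lambda>x. f x * g x) x = f x * partial i g x + partial i f x * g x"
    by (simp add: partial_def)
qed

lemma partial_add:
  assumes "f differentiable_on UNIV" "g differentiable_on UNIV"
  shows "partial i (\<lambda>x. f x + g x) = (\<lambda>x. partial i f x + partial i g x)"
proof
  fix x
  have "(f has_derivative frechet_derivative f (at x)) (at x)" "(g has_derivative frechet_derivative g (at x)) (at x)"
    using assms frechet_derivative_works by (auto simp: differentiable_on_def)
  from partial_eq[OF has_derivative_add[OF this]]
  show "partial i (\<lambda>x. f x + g x) x = partial i f x + partial i g x"
    by (simp add: partial_def)
qed

lemma partial_nth: "partial i (\<lambda>x. x $ j) = (\<lambda>x. if i = j then 1 else 0)"
proof
  fix x :: plane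
  have "((\<lambda>x. x $ j) has_derivative (\<lambda>x. x $ j)) (at x)"
    by (rule bounded_linear_imp_has_derivative) (rule bounded_linear_vec_nth)
  from partial_eq[OF this] show "partial i (\<lambda>x. x $ j) x = (if i = j then 1 else 0)"
    by (simp add: axis_def)
qed

lemma partial_eq_0:
  assumes "open S" "x \<in> S" "\<And>y. y \<in> S \<Longrightarrow> f y = 0"
  shows "partial i f x = 0"
proof -
  have "(f has_derivative (\<lambda>t. 0)) (at x)"
    by (rule has_derivative_transform_within_open[OF _ assms(1,2), of "\<lambda>x. 0"]) (use assms(3) in auto)
  then show ?thesis using partial_eq by blast
qed

lemma Ck_Suc_D: "Ck (Suc n) f \<Longrightarrow> Ck n f"
  by (induction n arbitrary: f) (auto intro: differentiable_imp_continuous_on)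

lemma Ck_const: "Ck n (\<lambda>x. c)"
  by (induction n arbitrary: c) auto

lemma Ck_add: "Ck n f \<Longrightarrow> Ck n g \<Longrightarrow> Ck n (\<lambda>x. f x + g x)"
  by (induction n arbitrary: f g) (auto simp: partial_add intro: continuous_on_add differentiable_on_add)

lemma Ck_mult: "Ck n f \<Longrightarrow> Ck n g \<Longrightarrow> Ck n (\<lambda>x. f x * g x)"
proof (induction n arbitrary: f g)
  case 0
  then show ?case by (auto intro: continuous_on_mult)
next
  case (Suc n)
  then have "Ck n f" "Ck n g" using Ck_Suc_D by blast+
  then show ?case using Suc by (auto simp: partial_mult intro!: Ck_add Suc.IH)
qed

definition C1 :: "(plane \<Rightarrow> real) \<Rightarrow> bool" where
  "C1 f \<longleftrightarrow> f differentiable_on UNIV \<and> (\<forall>i. continuous_on UNIV (partial i f))"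

lemma C1_iff_Ck: "C1 f \<longleftrightarrow> Ck 1 f"
  by (simp add: C1_def)

lemma C1_mult: "C1 f \<Longrightarrow> C1 g \<Longrightarrow> C1 (\<lambda>x. f x * g x)"
  unfolding C1_iff_Ck by (rule Ck_mult)

lemma C1_continuous: "C1 f \<Longrightarrow> continuous_on UNIV f"
  by (simp add: C1_def differentiable_imp_continuous_on)

lemma C1_nth: "C1 (\<lambda>x. x $ j)"
  by (simp add: C1_def partial_nth differentiable_on_def bounded_linear_imp_differentiable bounded_linear_vec_nth)

definition vanishes_off :: "real \<Rightarrow> (plane \<Rightarrow> real) \<Rightarrow> bool" where
  "vanishes_off R f \<longleftrightarrow> (\<forall>x. R < norm x \<longrightarrow> f x = 0)"

lemma vanishes_off_partial: "vanishes_off R f \<Longrightarrow> vanishes_off R (partial i f)"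
  unfolding vanishes_off_def
proof (intro allI impI)
  fix x :: plane assume f: "\<forall>x. R < norm x \<longrightarrow> f x = 0" and x: "R < norm x"
  show "partial i f x = 0"
  proof (rule partial_eq_0[of "{x. R < norm x}"])
    show "open {x :: plane. R < norm x}" by (intro open_Collect_less continuous_intros)
  qed (use f x in auto)
qed

lemma integrable_continuous_vanishes:
  assumes "continuous_on UNIV f" "vanishes_off R f"
  shows "integrable lborel f"
proof -
  have "integrable lborel (\<lambda>x. indicator (cball 0 R) x *\<^sub>R f x)"
    by (rule borel_integrable_compact) (use assms continuous_on_subset in auto)
  also have "(\<lambda>x. indicator (cball 0 R) x *\<^sub>R f x) = f"
    by (rule ext) (use assms(2) in \<open>auto simp: vanishes_off_def indicator_def\<close>)
  finally show ?thesis .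
qed

lemma square_integrable_continuous_vanishes:
  assumes "continuous_on UNIV f" "vanishes_off R f"
  shows "square_integrable f"
  unfolding square_integrable_def
proof
  show "f \<in> borel_measurable lborel" using borel_measurable_continuous_onI[OF assms(1)] by simp
  show "integrable lborel (\<lambda>x. (f x)\<^sup>2)"
    by (rule integrable_continuous_vanishes[of _ R])
      (use assms in \<open>auto simp: vanishes_off_def intro: continuous_on_power\<close>)
qed

lemma bounded_continuous_vanishes:
  assumes "continuous_on UNIV f" "vanishes_off R f"
  obtains K where "K > 0" "\<And>x. \<bar>f x\<bar> \<le> K"
proof -
  have "bounded (f ` cball 0 R)"
    by (intro compact_imp_bounded compact_continuous_image continuous_on_subset[OF assms(1)]) auto
  then obtain K where K: "K > 0" "\<And>x. x \<in> cball 0 R \<Longrightarrow> \<bar>f x\<bar> \<le> K"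
    unfolding bounded_pos by auto
  have "\<bar>f x\<bar> \<le> K" for x
    using K assms(2) by (cases "norm x \<le> R") (auto simp: vanishes_off_def)
  then show ?thesis using that K by blast
qed

lemma lint_translate:
  fixes f :: "'a::euclidean_space \<Rightarrow> real"
  assumes [measurable]: "f \<in> borel_measurable borel"
  shows "(LINT x|lborel. f (x + c)) = (LINT x|lborel. f x)"
proof -
  have "(LINT x|lborel. f x) = (LINT x|distr lborel borel ((+) c). f x)" by (simp add: lborel_distr_plus)
  also have "\<dots> = (LINT x|lborel. f (c + x))" by (rule integral_distr) measurable
  finally show ?thesis by (simp add: add.commute)
qed

definition dir_deriv :: "(plane \<Rightarrow> real) \<Rightarrow> plane \<Rightarrow> plane \<Rightarrow> real" where
  "dir_deriv f t x = (\<Sum>i\<in>UNIV. t $ i * partial i f x)"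

lemma dir_deriv_line:
  assumes "C1 f"
  shows "((\<lambda>s. f (x + s *\<^sub>R t)) has_real_derivative dir_deriv f t (x + s *\<^sub>R t)) (at s)"
proof -
  have 1: "((\<lambda>s. x + s *\<^sub>R t) has_derivative (\<lambda>s. s *\<^sub>R t)) (at s)"
    by (auto intro!: derivative_eq_intros)
  have 2: "(f has_derivative (\<lambda>t. \<Sum>i\<in>UNIV. t $ i * partial i f (x + s *\<^sub>R t'))) (at (x + s *\<^sub>R t'))" for t'
    using assms by (intro partial_has_derivative) (simp add: C1_def)
  have "((f \<circ> (\<lambda>s. x + s *\<^sub>R t)) has_derivative
      ((\<lambda>v. \<Sum>i\<in>UNIV. v $ i * partial i f (x + s *\<^sub>R t)) \<circ> (\<lambda>s. s *\<^sub>R t))) (at s)"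
    by (rule diff_chain_at[OF 1 2])
  moreover have "(\<lambda>v. \<Sum>i\<in>UNIV. v $ i * partial i f (x + s *\<^sub>R t)) \<circ> (\<lambda>s. s *\<^sub>R t) =
      (*) (dir_deriv f t (x + s *\<^sub>R t))"
    by (rule ext) (simp add: dir_deriv_def sum_distrib_left mult_ac)
  ultimately show ?thesis unfolding has_field_derivative_def by (simp add: o_def)
qed

lemma continuous_dir_deriv: "C1 f \<Longrightarrow> continuous_on UNIV (dir_deriv f t)"
  unfolding dir_deriv_def C1_def by (intro continuous_intros) auto

lemma vanishes_off_dir_deriv: "vanishes_off R f \<Longrightarrow> vanishes_off R (dir_deriv f t)"
  using vanishes_off_partial[of R f] by (simp add: vanishes_off_def dir_deriv_def)

text \<open>Prepares dominated convergence: the mean value theorem bounds all quotients by a bound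
  \<open>K\<close> of the derivative, and since the steps have length at most \<open>norm t\<close>,
  they vanish off a ball enlarged by \<open>norm t\<close>.\<close>

lemma difference_quotient:
  assumes f: "C1 f" "vanishes_off R f"
  obtains K where "K > 0" "\<And>n x. \<bar>real (Suc n) * (f (x + (1 / real (Suc n)) *\<^sub>R t) - f x)\<bar> \<le> K * indicator (cball 0 (R + norm t)) x"
    "\<And>x. (\<lambda>n. real (Suc n) * (f (x + (1 / real (Suc n)) *\<^sub>R t) - f x)) \<longlonglongrightarrow> dir_deriv f t x"
proof -
  obtain K where K: "K > 0" "\<And>x. \<bar>dir_deriv f t x\<bar> \<le> K"
    using bounded_continuous_vanishes[OF continuous_dir_deriv[OF f(1)] vanishes_off_dir_deriv[OF f(2)]] by blast
  have b: "\<bar>f (x + s *\<^sub>R t) - f x\<bar> \<le> K * s" if s: "s > 0" for s x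
  proof -
    obtain z where "f (x + s *\<^sub>R t) - f (x + 0 *\<^sub>R t) = (s - 0) * dir_deriv f t (x + z *\<^sub>R t)"
      using MVT2[OF s, of "\<lambda>s. f (x + s *\<^sub>R t)" "\<lambda>s. dir_deriv f t (x + s *\<^sub>R t)"] dir_deriv_line[OF f(1)] by blast
    then have "\<bar>f (x + s *\<^sub>R t) - f x\<bar> = s * \<bar>dir_deriv f t (x + z *\<^sub>R t)\<bar>" using s by (simp add: abs_mult)
    also have "\<dots> \<le> s * K" using s K by simp
    finally show ?thesis by (simp add: mult.commute)
  qed
  show ?thesis
  proof
    show "\<bar>real (Suc n) * (f (x + (1 / real (Suc n)) *\<^sub>R t) - f x)\<bar> \<le> K * indicator (cball 0 (R + norm t)) x" for n x
    proof (cases "x \<in> cball 0 (R + norm t)")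
      case True
      have "real (Suc n) * \<bar>f (x + (1 / real (Suc n)) *\<^sub>R t) - f x\<bar> \<le> real (Suc n) * (K * (1 / real (Suc n)))"
        by (intro mult_left_mono b) auto
      then show ?thesis using True by (simp add: abs_mult)
    next
      case False
      then have x: "norm x > R + norm t" by simp
      have "norm ((1 / real (Suc n)) *\<^sub>R t) \<le> norm t" by (simp add: divide_le_eq mult_le_cancel_left1)
      then have "norm (x + (1 / real (Suc n)) *\<^sub>R t) > R"
        using x norm_triangle_ineq2[of x "- ((1 / real (Suc n)) *\<^sub>R t)"] by simp
      moreover have "norm x > R" using x norm_ge_zero[of t] by linarith
      ultimately show ?thesis using f(2) False by (simp add: vanishes_off_def)
    qed
    show "(\<lambda>n. real (Suc n) * (f (x + (1 / real (Suc n)) *\<^sub>R t) - f x)) \<longlonglongrightarrow> dir_deriv f t x" for x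
    proof -
      have "(\<lambda>h. (f (x + h *\<^sub>R t) - f x) / h) \<midarrow>0\<rightarrow> dir_deriv f t x"
        using dir_deriv_line[OF f(1), of x t 0] by (simp add: DERIV_def)
      moreover have "filterlim (\<lambda>n. 1 / real (Suc n)) (at 0) sequentially"
        using LIMSEQ_inverse_real_of_nat by (simp add: filterlim_at inverse_eq_divide)
      ultimately have "(\<lambda>n. (f (x + (1 / real (Suc n)) *\<^sub>R t) - f x) / (1 / real (Suc n))) \<longlonglongrightarrow> dir_deriv f t x"
        by (rule filterlim_compose)
      then show ?thesis by (simp add: mult.commute)
    qed
  qed (rule K)
qed

lemma integrable_indicator_cball: "integrable lborel (\<lambda>x. K * indicator (cball (0::plane) r) x :: real)"
  using borel_integrable_compact[of "cball (0::plane) r" "\<lambda>x. K"] by (simp add: mult.commute)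

text \<open>By translation invariance all difference quotients have integral zero, and dominated
  convergence passes to the derivative, without iterated integration in coordinates.\<close>

lemma integral_dir_deriv_eq_0:
  assumes f: "C1 f" "vanishes_off R f"
  shows "(LINT x|lborel. dir_deriv f t x) = 0"
proof -
  obtain K where K: "\<And>n x. \<bar>real (Suc n) * (f (x + (1 / real (Suc n)) *\<^sub>R t) - f x)\<bar> \<le> K * indicator (cball 0 (R + norm t)) x"
    "\<And>x. (\<lambda>n. real (Suc n) * (f (x + (1 / real (Suc n)) *\<^sub>R t) - f x)) \<longlonglongrightarrow> dir_deriv f t x"
    using difference_quotient[OF f] by metis
  have [measurable]: "f \<in> borel_measurable borel" by (intro borel_measurable_continuous_onI C1_continuous f)
  have [measurable]: "dir_deriv f t \<in> borel_measurable borel"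
    by (intro borel_measurable_continuous_onI continuous_dir_deriv f)
  have "(\<lambda>n. LINT x|lborel. real (Suc n) * (f (x + (1 / real (Suc n)) *\<^sub>R t) - f x)) \<longlonglongrightarrow> (LINT x|lborel. dir_deriv f t x)"
    by (rule integral_dominated_convergence[OF _ _ integrable_indicator_cball[of K "R + norm t"]])
      (use K in \<open>auto simp del: of_nat_Suc\<close>)
  moreover have "(LINT x|lborel. real (Suc n) * (f (x + (1 / real (Suc n)) *\<^sub>R t) - f x)) = 0" for n
  proof -
    have i: "integrable lborel f" by (rule integrable_continuous_vanishes[OF C1_continuous[OF f(1)] f(2)])
    have "integrable lborel (\<lambda>x. f (x + c))" for c
    proof (rule integrable_continuous_vanishes)
      show "continuous_on UNIV (\<lambda>x. f (x + c))"
        by (rule continuous_on_compose2[OF C1_continuous[OF f(1)]]) (auto intro: continuous_intros)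
      show "vanishes_off (R + norm c) (\<lambda>x. f (x + c))" unfolding vanishes_off_def
      proof (intro allI impI)
        fix x :: plane assume "R + norm c < norm x"
        then have "R < norm (x + c)" using norm_triangle_ineq2[of x "- c"] by simp
        then show "f (x + c) = 0" using f(2) by (simp add: vanishes_off_def)
      qed
    qed
    then show ?thesis using i lint_translate[of f] by simp
  qed
  ultimately show ?thesis by (simp only: LIMSEQ_const_iff)
qed

lemma integral_partial_eq_0:
  assumes f: "C1 f" "vanishes_off R f"
  shows "(LINT x|lborel. partial i f x) = 0"
proof -
  have "dir_deriv f (axis i 1) = partial i f"
    by (auto simp: dir_deriv_def axis_def if_distrib[of "\<lambda>c. c * _"] cong: if_cong)
  then show ?thesis using integral_dir_deriv_eq_0[OF f, of "axis i 1"] by simp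
qed

lemma integration_by_parts:
  assumes f: "C1 f" and g: "C1 g" "vanishes_off R g"
  shows "(LINT x|lborel. f x * partial i g x) = - (LINT x|lborel. partial i f x * g x)"
proof -
  have c: "continuous_on UNIV f" "continuous_on UNIV g" "continuous_on UNIV (partial i f)" "continuous_on UNIV (partial i g)"
    using f g C1_continuous by (auto simp: C1_def)
  have "integrable lborel (\<lambda>x. f x * partial i g x)" "integrable lborel (\<lambda>x. partial i f x * g x)"
    using g(2) vanishes_off_partial[OF g(2), of i]
    by (auto intro!: integrable_continuous_vanishes[of _ R] continuous_on_mult c simp: vanishes_off_def)
  moreover have "(LINT x|lborel. partial i (\<lambda>x. f x * g x) x) = 0"
    by (rule integral_partial_eq_0[of _ R]) (use C1_mult[OF f g(1)] g(2) in \<open>auto simp: vanishes_off_def\<close>)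
  ultimately show ?thesis using f g by (simp add: partial_mult C1_def)
qed

lemma square_integrable_C1:
  "C1 f \<Longrightarrow> vanishes_off R f \<Longrightarrow> square_integrable f"
  using square_integrable_continuous_vanishes C1_continuous by blast

lemma square_integrable_translate:
  assumes "square_integrable f" shows "square_integrable (\<lambda>x. f (x + c))"
proof -
  have [measurable]: "f \<in> borel_measurable borel" using assms by (simp add: square_integrable_def)
  have "integrable (distr lborel borel ((+) c)) (\<lambda>x. (f x)\<^sup>2)" using assms by (simp add: lborel_distr_plus square_integrable_def)
  then have "integrable lborel (\<lambda>x. (f (c + x))\<^sup>2)" by (subst (asm) integrable_distr_eq) auto
  then show ?thesis by (simp add: square_integrable_def add.commute)
qed

lemma norm_abs_l2_translate:
  assumes "square_integrable f" shows "norm (abs_l2 (\<lambda>x. f (x + c))) = norm (abs_l2 f)"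
proof -
  have [measurable]: "f \<in> borel_measurable borel" using assms by (simp add: square_integrable_def)
  have "(norm (abs_l2 (\<lambda>x. f (x + c))))\<^sup>2 = (norm (abs_l2 f))\<^sup>2"
    using lint_translate[of "\<lambda>x. (f x)\<^sup>2" c] by (simp add: norm_abs_l2_power2 assms square_integrable_translate)
  then show ?thesis by simp
qed

text \<open>
  The increment over \<open>t\<close> is at most \<open>n\<close> times the increment over \<open>t / n\<close>, by translation
  invariance; then \<open>n\<close> tends to infinity.
\<close>

lemma norm_increment_le_dir_deriv:
  assumes f: "C1 f" "vanishes_off R f"
  shows "norm (abs_l2 (\<lambda>x. f (x + t) - f x)) \<le> norm (abs_l2 (dir_deriv f t))"
proof -
  have sf: "square_integrable f" by (rule square_integrable_C1[OF f])
  have si: "square_integrable (\<lambda>x. f (x + c) - f x)" for c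
    by (intro square_integrable_diff square_integrable_translate sf)
  have sd: "square_integrable (dir_deriv f t)"
    by (rule square_integrable_continuous_vanishes[OF continuous_dir_deriv[OF f(1)] vanishes_off_dir_deriv[OF f(2)]])
  have [measurable]: "f \<in> borel_measurable borel" by (intro borel_measurable_continuous_onI C1_continuous f)
  have [measurable]: "dir_deriv f t \<in> borel_measurable borel"
    by (intro borel_measurable_continuous_onI continuous_dir_deriv f)
  have tele: "norm (abs_l2 (\<lambda>x. f (x + real j *\<^sub>R s) - f x)) \<le> real j * norm (abs_l2 (\<lambda>x. f (x + s) - f x))" for j s
  proof (induction j)
    case 0
    have "abs_l2 (\<lambda>x. 0) = (0 :: plane l2)" by (simp add: zero_l2_def)
    then show ?case by simp
  next
    case (Suc j)
    have "(\<lambda>x. f (x + real (Suc j) *\<^sub>R s) - f x) = (\<lambda>x. (f ((x + real j *\<^sub>R s) + s) - f (x + real j *\<^sub>R s)) + (f (x + real j *\<^sub>R s) - f x))"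
      by (auto simp: algebra_simps)
    then have "abs_l2 (\<lambda>x. f (x + real (Suc j) *\<^sub>R s) - f x) =
        abs_l2 (\<lambda>x. f ((x + real j *\<^sub>R s) + s) - f (x + real j *\<^sub>R s)) + abs_l2 (\<lambda>x. f (x + real j *\<^sub>R s) - f x)"
      using square_integrable_translate[OF si[of s]] si by (simp add: abs_l2_add)
    then have "norm (abs_l2 (\<lambda>x. f (x + real (Suc j) *\<^sub>R s) - f x)) \<le>
        norm (abs_l2 (\<lambda>x. f ((x + real j *\<^sub>R s) + s) - f (x + real j *\<^sub>R s))) + norm (abs_l2 (\<lambda>x. f (x + real j *\<^sub>R s) - f x))"
      by (simp only: norm_triangle_ineq)
    then show ?case using Suc norm_abs_l2_translate[OF si[of s], of "real j *\<^sub>R s"] by (simp add: distrib_right)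
  qed
  obtain K where K: "K > 0" "\<And>n x. \<bar>real (Suc n) * (f (x + (1 / real (Suc n)) *\<^sub>R t) - f x)\<bar> \<le> K * indicator (cball 0 (R + norm t)) x"
    "\<And>x. (\<lambda>n. real (Suc n) * (f (x + (1 / real (Suc n)) *\<^sub>R t) - f x)) \<longlonglongrightarrow> dir_deriv f t x"
    using difference_quotient[OF f] by metis
  have "(\<lambda>n. LINT x|lborel. (real (Suc n) * (f (x + (1 / real (Suc n)) *\<^sub>R t) - f x))\<^sup>2) \<longlonglongrightarrow> (LINT x|lborel. (dir_deriv f t x)\<^sup>2)"
  proof (rule integral_dominated_convergence[OF _ _ integrable_indicator_cball[of "K\<^sup>2" "R + norm t"]])
    show "AE x in lborel. (\<lambda>n. (real (Suc n) * (f (x + (1 / real (Suc n)) *\<^sub>R t) - f x))\<^sup>2) \<longlonglongrightarrow> (dir_deriv f t x)\<^sup>2"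
      by (intro AE_I2 tendsto_power K)
    show "AE x in lborel. norm ((real (Suc n) * (f (x + (1 / real (Suc n)) *\<^sub>R t) - f x))\<^sup>2) \<le> K\<^sup>2 * indicator (cball 0 (R + norm t)) x" for n
    proof (rule AE_I2)
      fix x
      have "\<bar>real (Suc n) * (f (x + (1 / real (Suc n)) *\<^sub>R t) - f x)\<bar>\<^sup>2 \<le> (K * indicator (cball 0 (R + norm t)) x)\<^sup>2"
        by (intro power_mono K) auto
      then show "norm ((real (Suc n) * (f (x + (1 / real (Suc n)) *\<^sub>R t) - f x))\<^sup>2) \<le> K\<^sup>2 * indicator (cball 0 (R + norm t)) x"
        by (cases "norm x \<le> R + norm t") (simp_all add: power_mult_distrib del: of_nat_Suc)
    qed
  qed auto
  moreover have "(norm (abs_l2 (\<lambda>x. f (x + t) - f x)))\<^sup>2 \<le> (LINT x|lborel. (real (Suc n) * (f (x + (1 / real (Suc n)) *\<^sub>R t) - f x))\<^sup>2)" for n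
  proof -
    let ?s = "(1 / real (Suc n)) *\<^sub>R t"
    have "real (Suc n) *\<^sub>R ?s = t" by (simp del: of_nat_Suc)
    then have "norm (abs_l2 (\<lambda>x. f (x + t) - f x)) \<le> real (Suc n) * norm (abs_l2 (\<lambda>x. f (x + ?s) - f x))"
      using tele[of "Suc n" ?s] by simp
    also have "\<dots> = norm (real (Suc n) *\<^sub>R abs_l2 (\<lambda>x. f (x + ?s) - f x))" by simp
    also have "\<dots> = norm (abs_l2 (\<lambda>x. real (Suc n) * (f (x + ?s) - f x)))"
      by (simp only: abs_l2_scaleR[OF si])
    finally have "(norm (abs_l2 (\<lambda>x. f (x + t) - f x)))\<^sup>2 \<le> (norm (abs_l2 (\<lambda>x. real (Suc n) * (f (x + ?s) - f x))))\<^sup>2"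
      by (intro power_mono) auto
    then show ?thesis by (simp only: norm_abs_l2_power2[OF square_integrable_scale[OF si]])
  qed
  ultimately have "(norm (abs_l2 (\<lambda>x. f (x + t) - f x)))\<^sup>2 \<le> (LINT x|lborel. (dir_deriv f t x)\<^sup>2)"
    by (intro LIMSEQ_le_const) auto
  then have "(norm (abs_l2 (\<lambda>x. f (x + t) - f x)))\<^sup>2 \<le> (norm (abs_l2 (dir_deriv f t)))\<^sup>2"
    by (simp add: norm_abs_l2_power2[OF sd])
  then show ?thesis by (rule power2_le_imp_le) simp
qed

section \<open>Test functions\<close>

text \<open>The classical flat function \<open>exp (- (1 / t))\<close> with a polynomial factor in
  \<open>1 / t\<close>: the family is closed under differentiation, so smoothness needs a single
  induction over all \<open>p\<close>.\<close>

definition flat :: "real poly \<Rightarrow> real \<Rightarrow> real" where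
  "flat p t = (if t > 0 then poly p (1 / t) * exp (- (1 / t)) else 0)"

text \<open>With \<open>s = 1 / t\<close> one has \<open>ds/dt = - s\<^sup>2\<close>, so the
  derivative of \<open>p(s) exp(- s)\<close> is
  \<open>s\<^sup>2 (p(s) - p'(s)) exp(- s)\<close>.\<close>

definition flat_deriv :: "real poly \<Rightarrow> real poly" where
  "flat_deriv p = [:0, 0, 1:] * (p - pderiv p)"

lemma poly_times_exp_minus_tendsto_0: "((\<lambda>s. poly p s * exp (- s)) \<longlongrightarrow> (0::real)) at_top"
proof -
  have "((\<lambda>s. \<Sum>i\<le>degree p. coeff p i * (s ^ i / exp s)) \<longlongrightarrow> (\<Sum>i\<le>degree p. coeff p i * 0)) at_top"
    by (intro tendsto_intros tendsto_power_div_exp_0)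
  then show ?thesis by (simp add: poly_altdef exp_minus sum_distrib_right divide_inverse mult.assoc)
qed

lemma flat_has_derivative: "(flat p has_real_derivative flat (flat_deriv p) t) (at t)"
proof -
  consider "t > 0" | "t < 0" | "t = 0" by linarith
  then show ?thesis
  proof cases
    case 1
    have "((\<lambda>t. poly p (1 / t) * exp (- (1 / t))) has_real_derivative flat (flat_deriv p) t) (at t)"
      using 1 by (auto intro!: derivative_eq_intros poly_DERIV
          simp: flat_def flat_deriv_def field_simps power2_eq_square)
    then show ?thesis
      by (rule has_field_derivative_transform_within_open[of _ _ _ "{0<..}"]) (use 1 in \<open>auto simp: flat_def\<close>)
  next
    case 2
    have "((\<lambda>t. 0) has_real_derivative flat (flat_deriv p) t) (at t)" using 2 by (simp add: flat_def)
    then show ?thesis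
      by (rule has_field_derivative_transform_within_open[of _ _ _ "{..<0}"]) (use 2 in \<open>auto simp: flat_def\<close>)
  next
    \<comment> \<open>From the right, the difference quotient at 0 is again a polynomial times an
      exponential in \<open>1 / h\<close> and decays.\<close>
    case 3
    have "((\<lambda>h. flat p h / h) \<longlongrightarrow> 0) (at_left 0)"
      by (rule tendsto_eventually) (simp add: eventually_at_filter flat_def)
    moreover have "((\<lambda>h. flat p h / h) \<longlongrightarrow> 0) (at_right 0)"
    proof -
      have "((\<lambda>h. poly (pCons 0 p) (inverse h) * exp (- inverse h)) \<longlongrightarrow> 0) (at_right 0)"
        by (rule filterlim_compose[OF poly_times_exp_minus_tendsto_0 filterlim_inverse_at_top_right])
      moreover have "\<forall>\<^sub>F h in at_right 0. poly (pCons 0 p) (inverse h) * exp (- inverse h) = flat p h / h"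
        by (simp add: eventually_at_filter flat_def inverse_eq_divide)
      ultimately show ?thesis by (rule Lim_transform_eventually)
    qed
    ultimately have "((\<lambda>h. flat p h / h) \<longlongrightarrow> 0) (at 0)" by (rule filterlim_split_at)
    then show ?thesis using 3 by (simp add: DERIV_def flat_def)
  qed
qed

lemma flat_affine_has_derivative:
  "((\<lambda>x. flat p (c * x $ i + d)) has_derivative (\<lambda>t. c * t $ i * flat (flat_deriv p) (c * x $ i + d))) (at (x :: plane))"
proof -
  have 1: "((\<lambda>x. c * x $ i + d) has_derivative (\<lambda>t. c * t $ i)) (at x)"
    by (auto intro!: derivative_eq_intros bounded_linear_imp_has_derivative bounded_linear_vec_nth)
  have "(flat p has_derivative (*) (flat (flat_deriv p) (c * x $ i + d))) (at (c * x $ i + d))"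
    using flat_has_derivative by (simp add: has_field_derivative_def)
  from diff_chain_at[OF 1 this] show ?thesis by (simp add: o_def mult_ac)
qed

lemma flat_affine_differentiable: "(\<lambda>x. flat p (c * x $ i + d)) differentiable_on (UNIV :: plane set)"
  unfolding differentiable_on_def differentiable_def
proof
  fix x :: plane
  show "\<exists>D. ((\<lambda>x. flat p (c * x $ i + d)) has_derivative D) (at x within UNIV)"
    by (rule exI, rule flat_affine_has_derivative)
qed

lemma Ck_flat_affine: "Ck n (\<lambda>x. flat p (c * x $ i + d))"
proof (induction n arbitrary: p)
  case 0
  show ?case using differentiable_imp_continuous_on[OF flat_affine_differentiable] by simp
next
  case (Suc n)
  have "partial j (\<lambda>x. flat p (c * x $ i + d)) =
      (\<lambda>x. (c * axis j 1 $ i) * flat (flat_deriv p) (c * x $ i + d))" for j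
    using partial_eq[OF flat_affine_has_derivative] by (rule ext)
  then show ?case using flat_affine_differentiable Suc by (auto intro: Ck_mult Ck_const)
qed

text \<open>A factor \<open>flat 1 (n (x - a) - 1)\<close> with \<open>n > 0\<close> is positive
  exactly for \<open>x > a + 1 / n\<close>. The offset 1 keeps the support in a compact box inside
  \<open>box a b\<close>, and growing \<open>n\<close> recovers the indicator of that box.\<close>

definition box_bump :: "plane \<Rightarrow> plane \<Rightarrow> nat \<Rightarrow> plane \<Rightarrow> real" where
  "box_bump a b n x = flat 1 (real n * x $ 1 + (- real n * a $ 1 - 1)) * flat 1 (- real n * x $ 1 + (real n * b $ 1 - 1))
     * (flat 1 (real n * x $ 2 + (- real n * a $ 2 - 1)) * flat 1 (- real n * x $ 2 + (real n * b $ 2 - 1)))"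

lemma flat_1: "0 \<le> flat 1 t" "flat 1 t \<le> 1" "flat 1 t \<noteq> 0 \<longleftrightarrow> t > 0"
  by (auto simp: flat_def)

lemma test_function_box_bump:
  assumes "box a b \<subseteq> \<Omega>" "n > 0"
  shows "test_function \<Omega> (box_bump a b n)"
proof -
  let ?K = "cbox (\<chi> i. a $ i + 1 / real n) (\<chi> i. b $ i - 1 / real n)"
  have "{x. box_bump a b n x \<noteq> 0} \<subseteq> ?K"
  proof
    fix x assume "x \<in> {x. box_bump a b n x \<noteq> 0}"
    then have "0 < real n * x $ i + (- real n * a $ i - 1) \<and> 0 < - real n * x $ i + (real n * b $ i - 1)" for i
      using exhaust_2[of i] by (auto simp: box_bump_def flat_1)
    then have "a $ i + 1 / real n \<le> x $ i \<and> x $ i \<le> b $ i - 1 / real n" for i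
      using assms(2) by (simp add: field_simps less_imp_le)
    then show "x \<in> ?K" by (simp add: mem_box_cart)
  qed
  then have K: "closure {x. box_bump a b n x \<noteq> 0} \<subseteq> ?K" by (rule closure_minimal) (rule closed_cbox)
  have "?K \<subseteq> box a b"
  proof
    fix x assume "x \<in> ?K"
    then have x: "a $ i + 1 / real n \<le> x $ i" "x $ i \<le> b $ i - 1 / real n" for i by (simp_all add: mem_box_cart)
    have "1 / real n > 0" using assms(2) by simp
    then have "a $ i < x $ i \<and> x $ i < b $ i" for i using x[of i] by linarith
    then show "x \<in> box a b" by (simp add: mem_box_cart)
  qed
  moreover have "compact (closure {x. box_bump a b n x \<noteq> 0})"
    using compact_Int_closed[OF compact_cbox closed_closure] K by (metis inf.absorb2)
  moreover have "Ck m (box_bump a b n)" for m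
    unfolding box_bump_def[abs_def] by (intro Ck_mult Ck_flat_affine)
  ultimately show ?thesis using K assms(1) by (auto simp: test_function_def)
qed

lemma flat_1_tendsto:
  "(\<lambda>n. flat 1 (real n * s - 1)) \<longlonglongrightarrow> (if s > 0 then 1 else 0)"
proof (cases "s > 0")
  case True
  have lim: "filterlim (\<lambda>n. real n * s - 1) at_top sequentially"
  proof -
    have "filterlim (\<lambda>n. real n * s) at_top sequentially"
      using filterlim_tendsto_pos_mult_at_top[OF tendsto_const True filterlim_real_sequentially]
      by (simp add: mult.commute)
    then show ?thesis using filterlim_tendsto_add_at_top[OF tendsto_const[of "-1"]] by (simp add: add.commute)
  qed
  then have "(\<lambda>n. exp (- (1 / (real n * s - 1)))) \<longlonglongrightarrow> exp (- 0)"
    by (intro tendsto_intros tendsto_divide_0[OF tendsto_const] filterlim_at_top_imp_at_infinity)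
  moreover have "\<forall>\<^sub>F n in sequentially. exp (- (1 / (real n * s - 1))) = flat 1 (real n * s - 1)"
    using filterlim_at_top_dense[THEN iffD1, OF lim, rule_format, of 0] by eventually_elim (simp add: flat_def)
  ultimately show ?thesis using True by (auto intro: Lim_transform_eventually)
next
  case False
  then have "flat 1 (real n * s - 1) = 0" for n
    using mult_nonneg_nonpos[of "real n" s] by (simp add: flat_def)
  then show ?thesis using False by simp
qed

lemma box_bump_tendsto: "(\<lambda>n. box_bump a b n x) \<longlonglongrightarrow> indicator (box a b) x"
proof -
  have "(\<lambda>n. flat 1 (real n * (x $ 1 - a $ 1) - 1) * flat 1 (real n * (b $ 1 - x $ 1) - 1)
     * (flat 1 (real n * (x $ 2 - a $ 2) - 1) * flat 1 (real n * (b $ 2 - x $ 2) - 1)))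
     \<longlonglongrightarrow> (if x $ 1 - a $ 1 > 0 then 1 else 0) * (if b $ 1 - x $ 1 > 0 then 1 else 0)
       * ((if x $ 2 - a $ 2 > 0 then 1 else 0) * (if b $ 2 - x $ 2 > 0 then 1 else 0))"
    by (intro tendsto_intros flat_1_tendsto)
  moreover have "(if x $ 1 - a $ 1 > 0 then 1 else 0) * (if b $ 1 - x $ 1 > 0 then 1 else 0)
       * ((if x $ 2 - a $ 2 > 0 then 1 else 0) * (if b $ 2 - x $ 2 > 0 then 1 else 0)) = (indicator (box a b) x :: real)"
    by (auto simp: indicator_def mem_box_cart forall_2)
  ultimately show ?thesis by (simp add: box_bump_def algebra_simps)
qed

lemma box_bump_bounds: "\<bar>box_bump a b n x\<bar> \<le> 1"
proof -
  have "\<bar>flat 1 t\<bar> \<le> 1" for t using flat_1[of t] by simp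
  then show ?thesis unfolding box_bump_def abs_mult
    by (intro mult_le_one) auto
qed

text \<open>The positive and negative parts of \<open>G\<close> are densities of two measures that
  agree on boxes, a generator stable under intersection, and hence coincide.\<close>

lemma AE_zero_of_box_integrals:
  fixes G :: "'a::euclidean_space \<Rightarrow> real"
  assumes G: "integrable lborel G" and 0: "\<And>a b. (LINT x|lborel. G x * indicator (box a b) x) = 0"
  shows "AE x in lborel. G x = 0"
proof -
  have [measurable]: "G \<in> borel_measurable borel" using borel_measurable_integrable[OF G] by simp
  define P where "P x = max 0 (G x)" for x
  define N where "N x = max 0 (- G x)" for x
  have [measurable]: "P \<in> borel_measurable borel" "N \<in> borel_measurable borel"
    by (simp_all add: P_def[abs_def] N_def[abs_def])
  have iP: "integrable lborel (\<lambda>x. P x * indicator (box a b) x)" for a b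
    by (rule Bochner_Integration.integrable_bound[OF G]) (auto simp: P_def indicator_def)
  have iN: "integrable lborel (\<lambda>x. N x * indicator (box a b) x)" for a b
    by (rule Bochner_Integration.integrable_bound[OF G]) (auto simp: N_def indicator_def)
  have eP: "emeasure (density lborel (\<lambda>x. ennreal (P x))) (box a b) = ennreal (LINT x|lborel. P x * indicator (box a b) x)" for a b
    by (subst nn_integral_eq_integral[OF iP, symmetric])
      (auto simp: P_def emeasure_density ennreal_mult' ennreal_indicator intro!: nn_integral_cong)
  have eN: "emeasure (density lborel (\<lambda>x. ennreal (N x))) (box a b) = ennreal (LINT x|lborel. N x * indicator (box a b) x)" for a b
    by (subst nn_integral_eq_integral[OF iN, symmetric])
      (auto simp: N_def emeasure_density ennreal_mult' ennreal_indicator intro!: nn_integral_cong)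
  have eq: "(LINT x|lborel. P x * indicator (box a b) x) = (LINT x|lborel. N x * indicator (box a b) x)" for a b
  proof -
    have "(LINT x|lborel. P x * indicator (box a b) x) - (LINT x|lborel. N x * indicator (box a b) x)
      = (LINT x|lborel. G x * indicator (box a b) x)"
      unfolding Bochner_Integration.integral_diff[OF iP iN, symmetric]
      by (intro Bochner_Integration.integral_cong) (auto simp: P_def N_def left_diff_distrib[symmetric])
    then show ?thesis using 0 by simp
  qed
  have "density lborel (\<lambda>x. ennreal (P x)) = density lborel (\<lambda>x. ennreal (N x))"
  proof (rule measure_eqI_generator_eq)
    let ?E = "range (\<lambda>(a, b). box a b :: 'a set)"
    show "Int_stable ?E" by (auto simp: Int_stable_def box_Int_box)
    show "?E \<subseteq> Pow UNIV" "sets (density lborel (\<lambda>x. ennreal (P x))) = sigma_sets UNIV ?E"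
      "sets (density lborel (\<lambda>x. ennreal (N x))) = sigma_sets UNIV ?E"
      by (simp_all add: borel_eq_box)
    let ?A = "\<lambda>n::nat. box (- (real n *\<^sub>R One)) (real n *\<^sub>R One) :: 'a set"
    show "range ?A \<subseteq> ?E" "(\<Union>i. ?A i) = UNIV" unfolding UN_box_eq_UNIV by auto
    show "emeasure (density lborel (\<lambda>x. ennreal (P x))) (?A i) \<noteq> \<infinity>" for i by (simp add: eP)
    show "emeasure (density lborel (\<lambda>x. ennreal (P x))) X = emeasure (density lborel (\<lambda>x. ennreal (N x))) X" if "X \<in> ?E" for X
      using that eP eN eq by auto
  qed
  then have "AE x in lborel. ennreal (P x) = ennreal (N x)"
    by (intro sigma_finite_measure.density_unique[OF lborel.sigma_finite_measure_axioms]) auto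
  then show ?thesis by eventually_elim (auto simp: P_def N_def max_def split: if_splits)
qed

text \<open>Fundamental lemma of the calculus of variations. Bump functions converge to indicators
  of boxes inside \<open>\<Omega>\<close>, so \<open>g\<close> integrates to zero over each of them,
  and countably many such boxes cover \<open>\<Omega>\<close>.\<close>

lemma L2_eq_0_of_test_functions:
  assumes \<Omega>: "open \<Omega>" and g: "g \<in> L2 \<Omega>" and 0: "\<And>\<phi>. test_function \<Omega> \<phi> \<Longrightarrow> inner g (abs_l2 \<phi>) = 0"
    and si: "\<And>\<phi>. test_function \<Omega> \<phi> \<Longrightarrow> square_integrable \<phi>"
  shows "g = 0"
proof -
  have si_box: "square_integrable (\<lambda>x. indicator (box a b) x :: real)" for a b :: plane
  proof -
    have "integrable lborel (\<lambda>x. indicator (box a b) x :: real)"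
      using integrable_real_indicator[of "box a b" lborel] by (simp add: emeasure_lborel_box_eq)
    moreover have "(\<lambda>x. (indicator (box a b) x :: real)\<^sup>2) = indicator (box a b)" by (auto simp: indicator_def)
    ultimately show ?thesis by (simp add: square_integrable_def)
  qed
  have box0: "(LINT x|lborel. rep_l2 g x * indicator (box a b) x) = 0" if ab: "box a b \<subseteq> \<Omega>" for a b
  proof -
    have tf: "test_function \<Omega> (box_bump a b (Suc n))" for n by (rule test_function_box_bump[OF ab]) simp
    have supp: "box_bump a b (Suc n) x \<noteq> 0 \<Longrightarrow> x \<in> box a b" for n x
      using test_function_box_bump[OF order_refl, of "Suc n" a b] closure_subset by (fastforce simp: test_function_def)
    have "(\<lambda>n. LINT x|lborel. rep_l2 g x * box_bump a b (Suc n) x) \<longlonglongrightarrow> (LINT x|lborel. rep_l2 g x * indicator (box a b) x)"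
    proof (rule integral_dominated_convergence)
      show "integrable lborel (\<lambda>x. \<bar>rep_l2 g x * indicator (box a b) x\<bar>)"
        by (intro integrable_abs square_integrable_mult si_box) simp
      show "AE x in lborel. (\<lambda>n. rep_l2 g x * box_bump a b (Suc n) x) \<longlonglongrightarrow> rep_l2 g x * indicator (box a b) x"
        by (intro AE_I2 tendsto_intros LIMSEQ_Suc box_bump_tendsto)
      show "AE x in lborel. norm (rep_l2 g x * box_bump a b (Suc n) x) \<le> \<bar>rep_l2 g x * indicator (box a b) x\<bar>" for n
      proof (rule AE_I2)
        fix x show "norm (rep_l2 g x * box_bump a b (Suc n) x) \<le> \<bar>rep_l2 g x * indicator (box a b) x\<bar>"
          using supp[of n x] box_bump_bounds[of a b "Suc n" x]
          by (cases "box_bump a b (Suc n) x = 0") (auto simp: abs_mult intro!: mult_left_le)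
      qed
      show "(\<lambda>x. rep_l2 g x * box_bump a b (Suc n) x) \<in> borel_measurable lborel" for n
        using si[OF tf[of n]] by (auto simp: square_integrable_def)
    qed (use si_box[of a b] in \<open>auto simp: square_integrable_def\<close>)
    moreover have "(LINT x|lborel. rep_l2 g x * box_bump a b (Suc n) x) = 0" for n
      using 0[OF tf[of n]] si[OF tf[of n]] by (simp add: inner_abs_l2_right)
    ultimately show ?thesis by (simp only: LIMSEQ_const_iff)
  qed
  \<comment> \<open>After restriction to a box, intersecting with any further box leaves a box
    inside \<open>\<Omega>\<close>, so the criterion by box integrals applies.\<close>
  have AE_box: "AE x in lborel. x \<in> box a b \<longrightarrow> rep_l2 g x = 0" if ab: "box a b \<subseteq> \<Omega>" for a b
  proof -
    have "AE x in lborel. rep_l2 g x * indicator (box a b) x = 0"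
    proof (rule AE_zero_of_box_integrals)
      show "integrable lborel (\<lambda>x. rep_l2 g x * indicator (box a b) x)"
        by (intro square_integrable_mult si_box) simp
      fix c d :: plane
      obtain a' b' where eq: "box a b \<inter> box c d = box a' b'" using box_Int_box[of a b c d] by blast
      then have "(LINT x|lborel. rep_l2 g x * indicator (box a b) x * indicator (box c d) x) =
          (LINT x|lborel. rep_l2 g x * indicator (box a' b') x)"
        by (simp add: mult.assoc flip: indicator_inter_arith)
      then show "(LINT x|lborel. rep_l2 g x * indicator (box a b) x * indicator (box c d) x) = 0"
        using box0[of a' b'] eq ab by auto
    qed
    then show ?thesis by eventually_elim (auto simp: indicator_def)
  qed
  obtain \<D> where D: "countable \<D>" "\<D> \<subseteq> Pow \<Omega>" "\<And>X. X \<in> \<D> \<Longrightarrow> \<exists>a b. X = box a b" "\<Union>\<D> = \<Omega>"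
    using open_countable_Union_open_box[OF \<Omega>] by blast
  have "AE x in lborel. \<forall>X\<in>\<D>. x \<in> X \<longrightarrow> rep_l2 g x = 0"
  proof (subst AE_ball_countable[OF D(1)], intro ballI)
    fix X assume "X \<in> \<D>"
    then show "AE x in lborel. x \<in> X \<longrightarrow> rep_l2 g x = 0" using AE_box D(2,3) by blast
  qed
  moreover have "AE x in lborel. x \<notin> \<Omega> \<longrightarrow> rep_l2 g x = 0" using g by (simp add: L2_def)
  ultimately have *: "AE x in lborel. rep_l2 g x = 0" by eventually_elim (use D(4) in blast)
  have "abs_l2 (rep_l2 g) = abs_l2 (\<lambda>x. 0)"
    by (rule abs_l2_eqI) (use * in \<open>auto simp: square_integrable_zero\<close>)
  then show ?thesis by (simp add: zero_l2_def)
qed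

section \<open>Sobolev spaces on planar domains\<close>

lemma norm_vec_power2: "(norm (x :: 'a::real_normed_vector ^ 'n))\<^sup>2 = (\<Sum>i\<in>UNIV. (norm (x $ i))\<^sup>2)"
  by (simp add: norm_vec_def L2_set_def sum_nonneg)

lemma test_function_C1: "test_function \<Omega> \<phi> \<Longrightarrow> C1 \<phi>"
  unfolding C1_iff_Ck by (simp only: test_function_def)

lemma in_closure_support: "f x \<noteq> 0 \<Longrightarrow> x \<in> closure {x. f x \<noteq> 0}"
  by (rule subsetD[OF closure_subset]) simp

lemma test_function_eq_0:
  assumes "test_function \<Omega> \<phi>" "x \<notin> \<Omega>" shows "\<phi> x = 0"
proof (rule ccontr)
  assume "\<phi> x \<noteq> 0"
  then have "x \<in> closure {x. \<phi> x \<noteq> 0}" by (rule in_closure_support)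
  then show False using assms by (auto simp: test_function_def)
qed

lemma test_function_vanishes:
  assumes "test_function \<Omega> \<phi>" obtains R where "vanishes_off R \<phi>"
proof -
  have "bounded (closure {x. \<phi> x \<noteq> 0})" using assms by (simp add: test_function_def compact_imp_bounded)
  then obtain R where "\<forall>x\<in>closure {x. \<phi> x \<noteq> 0}. norm x \<le> R" by (auto simp: bounded_iff)
  then have "vanishes_off R \<phi>" unfolding vanishes_off_def using in_closure_support[of \<phi>] by force
  then show ?thesis using that by blast
qed

lemma square_integrable_test:
  assumes "test_function \<Omega> \<phi>" shows "square_integrable \<phi>"
  by (rule test_function_vanishes[OF assms]) (rule square_integrable_C1[OF test_function_C1[OF assms]])

lemma test_function_support:
  assumes "\<And>n. Ck n f" "test_function \<Omega> \<phi>" "{x. f x \<noteq> 0} \<subseteq> closure {x. \<phi> x \<noteq> 0}"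
  shows "test_function \<Omega> f"
proof -
  have "closure {x. f x \<noteq> 0} \<subseteq> closure {x. \<phi> x \<noteq> 0}" using assms(3) by (simp add: closure_minimal)
  moreover have "compact (closure {x. f x \<noteq> 0})"
    using bounded_subset[OF compact_imp_bounded assms(3)] assms(2)
    by (simp add: compact_closure test_function_def)
  ultimately show ?thesis using assms by (auto simp: test_function_def)
qed

lemma test_function_partial:
  assumes "test_function \<Omega> \<phi>" shows "test_function \<Omega> (partial i \<phi>)"
proof (rule test_function_support[OF _ assms])
  have "Ck (Suc n) \<phi>" for n using assms by (simp only: test_function_def)
  then show "Ck n (partial i \<phi>)" for n by simp
  show "{x. partial i \<phi> x \<noteq> 0} \<subseteq> closure {x. \<phi> x \<noteq> 0}"
  proof (rule ccontr)
    assume "\<not> ?thesis"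
    then obtain x where x: "partial i \<phi> x \<noteq> 0" "x \<notin> closure {x. \<phi> x \<noteq> 0}" by blast
    have "partial i \<phi> x = 0"
      by (rule partial_eq_0[of "- closure {x. \<phi> x \<noteq> 0}"]) (use x(2) in_closure_support[of \<phi>] in auto)
    then show False using x by simp
  qed
qed

lemma test_function_zero: "test_function \<Omega> (\<lambda>x. 0)"
  by (simp add: test_function_def Ck_const)

lemma test_function_scale: "test_function \<Omega> \<phi> \<Longrightarrow> test_function \<Omega> (\<lambda>x. c * \<phi> x)"
  by (rule test_function_support[where \<phi> = \<phi>])
    (use in_closure_support[of \<phi>] in \<open>auto simp: test_function_def intro!: Ck_mult Ck_const\<close>)

lemma test_function_add:
  assumes "test_function \<Omega> \<phi>" "test_function \<Omega> \<psi>"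
  shows "test_function \<Omega> (\<lambda>x. \<phi> x + \<psi> x)"
proof -
  let ?K = "closure {x. \<phi> x \<noteq> 0} \<union> closure {x. \<psi> x \<noteq> 0}"
  have K: "compact ?K" "?K \<subseteq> \<Omega>" using assms by (auto simp: test_function_def)
  have "{x. \<phi> x + \<psi> x \<noteq> 0} \<subseteq> ?K" using in_closure_support[of \<phi>] in_closure_support[of \<psi>] by force
  then have c: "closure {x. \<phi> x + \<psi> x \<noteq> 0} \<subseteq> ?K" by (rule closure_minimal) auto
  then have "compact (closure {x. \<phi> x + \<psi> x \<noteq> 0})"
    using bounded_subset[OF compact_imp_bounded[OF K(1)]] \<open>{x. \<phi> x + \<psi> x \<noteq> 0} \<subseteq> ?K\<close>
    by (simp add: compact_closure)
  then show ?thesis using c K assms by (auto simp: test_function_def intro: Ck_add)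
qed

lemma subspace_closure:
  fixes S :: "'a::real_normed_vector set"
  assumes "subspace S" shows "subspace (closure S)"
  unfolding subspace_def
proof (intro conjI allI ballI)
  show "0 \<in> closure S" using subspace_0[OF assms] closure_subset by blast
  fix x y assume "x \<in> closure S" "y \<in> closure S"
  then obtain f g where fg: "\<And>n. f n \<in> S" "f \<longlonglongrightarrow> x" "\<And>n. g n \<in> S" "g \<longlonglongrightarrow> y"
    unfolding closure_sequential by blast
  have "\<forall>n. f n + g n \<in> S" using fg assms by (simp add: subspace_add)
  then show "x + y \<in> closure S" unfolding closure_sequential using tendsto_add[OF fg(2,4)]
    by (intro exI[of _ "\<lambda>n. f n + g n"]) simp
next
  fix c x assume "x \<in> closure S"
  then obtain f where f: "\<And>n. f n \<in> S" "f \<longlonglongrightarrow> x" unfolding closure_sequential by blast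
  have "\<forall>n. c *\<^sub>R f n \<in> S" using f assms by (simp add: subspace_scale)
  then show "c *\<^sub>R x \<in> closure S" unfolding closure_sequential
    using tendsto_scaleR[OF tendsto_const f(2)] by (intro exI[of _ "\<lambda>n. c *\<^sub>R f n"]) simp
qed

locale planar_domain =
  fixes \<Omega> :: "plane set"
  assumes open_domain: "open \<Omega>" and bounded_domain: "bounded \<Omega>"
begin

lemma measurable_domain [measurable]: "\<Omega> \<in> sets borel"
  using open_domain by simp

lemma restrict_L2:
  assumes "square_integrable f" "A \<in> sets borel"
  shows "square_integrable (\<lambda>x. f x * indicator A x)" "abs_l2 (\<lambda>x. f x * indicator A x) \<in> L2 A"
proof -
  have [measurable]: "f \<in> borel_measurable borel" "A \<in> sets borel" using assms by (auto simp: square_integrable_def)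
  show si: "square_integrable (\<lambda>x. f x * indicator A x)"
    unfolding square_integrable_def
  proof
    show "integrable lborel (\<lambda>x. (f x * indicator A x)\<^sup>2)"
      by (rule Bochner_Integration.integrable_bound[of _ "\<lambda>x. (f x)\<^sup>2"])
        (use assms in \<open>auto simp: square_integrable_def indicator_def\<close>)
  qed simp
  show "abs_l2 (\<lambda>x. f x * indicator A x) \<in> L2 A"
    using rep_abs_l2[OF si] by (auto simp: L2_def indicator_def)
qed

text \<open>As an orthogonal complement, \<open>L2 \<Omega>\<close> is visibly a closed subspace.
  For the converse inclusion \<open>f\<close> is tested against its own restriction to the
  complement of \<open>\<Omega>\<close>.\<close>

lemma L2_eq_orthogonal: "L2 \<Omega> = {f. \<forall>g\<in>L2 (- \<Omega>). inner f g = 0}"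
proof (intro set_eqI iffI)
  fix f assume f: "f \<in> L2 \<Omega>"
  have "inner f g = 0" if g: "g \<in> L2 (- \<Omega>)" for g
  proof -
    have "AE x in lborel. x \<notin> \<Omega> \<longrightarrow> rep_l2 f x = 0" "AE x in lborel. x \<notin> - \<Omega> \<longrightarrow> rep_l2 g x = 0"
      using f g by (simp_all add: L2_def)
    then have "AE x in lborel. rep_l2 f x * rep_l2 g x = 0" by eventually_elim auto
    then show ?thesis unfolding inner_rep_l2 by (rule integral_eq_zero_AE)
  qed
  then show "f \<in> {f. \<forall>g\<in>L2 (- \<Omega>). inner f g = 0}" by blast
next
  fix f assume f: "f \<in> {f. \<forall>g\<in>L2 (- \<Omega>). inner f g = 0}"
  let ?g = "\<lambda>x. rep_l2 f x * indicator (- \<Omega>) x"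
  have g: "square_integrable ?g" "abs_l2 ?g \<in> L2 (- \<Omega>)"
    by (rule restrict_L2; simp)+
  have "inner f (abs_l2 ?g) = 0" using f g(2) by blast
  then have "(LINT x|lborel. rep_l2 f x * ?g x) = 0" unfolding inner_abs_l2_right[OF g(1)] .
  moreover have "rep_l2 f x * ?g x = (?g x)\<^sup>2" for x by (auto simp: indicator_def power2_eq_square)
  ultimately have "(LINT x|lborel. (?g x)\<^sup>2) = 0" by simp
  then have "AE x in lborel. (?g x)\<^sup>2 = 0"
    using integral_nonneg_eq_0_iff_AE[of lborel "\<lambda>x. (?g x)\<^sup>2"] g(1) by (auto simp: square_integrable_def)
  then have "AE x in lborel. x \<notin> \<Omega> \<longrightarrow> rep_l2 f x = 0" by eventually_elim auto
  then show "f \<in> L2 \<Omega>" by (simp add: L2_def)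
qed

lemma closed_L2: "closed (L2 \<Omega>)"
proof -
  have "L2 \<Omega> = (\<Inter>g\<in>L2 (- \<Omega>). {f. inner f g = 0})" by (auto simp: L2_eq_orthogonal)
  then show ?thesis by (auto intro!: closed_INT closed_Collect_eq continuous_intros)
qed

lemma subspace_L2: "subspace (L2 \<Omega>)"
  unfolding L2_eq_orthogonal subspace_def by (auto simp: inner_add_left)

lemma test_function_L2: "test_function \<Omega> \<phi> \<Longrightarrow> abs_l2 \<phi> \<in> L2 \<Omega>"
proof -
  assume \<phi>: "test_function \<Omega> \<phi>"
  from rep_abs_l2[OF square_integrable_test[OF \<phi>]]
  have "AE x in lborel. x \<notin> \<Omega> \<longrightarrow> rep_l2 (abs_l2 \<phi>) x = 0"
    by eventually_elim (use test_function_eq_0[OF \<phi>] in auto)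
  then show ?thesis by (simp add: L2_def)
qed

text \<open>Justifies the definite description in \<open>weak_deriv\<close>: the difference lies in
  \<open>L2 \<Omega>\<close> and is orthogonal to all test functions.\<close>

lemma has_weak_deriv_unique:
  assumes "has_weak_deriv \<Omega> i u g" "has_weak_deriv \<Omega> i u g'"
  shows "g = g'"
proof -
  have "g - g' = 0"
  proof (rule L2_eq_0_of_test_functions[OF open_domain])
    show "g - g' \<in> L2 \<Omega>" using assms subspace_L2 by (auto simp: has_weak_deriv_def intro: subspace_diff)
    show "inner (g - g') (abs_l2 \<phi>) = 0" if "test_function \<Omega> \<phi>" for \<phi>
      using assms that by (simp add: has_weak_deriv_def inner_diff_left)
  qed (rule square_integrable_test)
  then show ?thesis by simp
qed

lemma weak_deriv_eqI: "has_weak_deriv \<Omega> i u g \<Longrightarrow> weak_deriv \<Omega> i u = g"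
  unfolding weak_deriv_def using has_weak_deriv_unique by blast

lemma has_weak_deriv_add:
  "has_weak_deriv \<Omega> i u g \<Longrightarrow> has_weak_deriv \<Omega> i v g' \<Longrightarrow> has_weak_deriv \<Omega> i (u + v) (g + g')"
  using subspace_L2 by (auto simp: has_weak_deriv_def inner_add_left intro: subspace_add)

lemma has_weak_deriv_scaleR:
  "has_weak_deriv \<Omega> i u g \<Longrightarrow> has_weak_deriv \<Omega> i (c *\<^sub>R u) (c *\<^sub>R g)"
  using subspace_L2 by (auto simp: has_weak_deriv_def intro: subspace_scale)

lemma has_weak_deriv_test:
  assumes \<phi>: "test_function \<Omega> \<phi>"
  shows "has_weak_deriv \<Omega> i (abs_l2 \<phi>) (abs_l2 (partial i \<phi>))"
  unfolding has_weak_deriv_def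
proof (intro conjI allI impI)
  show "abs_l2 (partial i \<phi>) \<in> L2 \<Omega>" using test_function_L2 test_function_partial \<phi> by blast
  fix \<psi> assume \<psi>: "test_function \<Omega> \<psi>"
  obtain R where R: "vanishes_off R \<psi>" using test_function_vanishes[OF \<psi>] by blast
  have si: "square_integrable \<phi>" "square_integrable \<psi>" "square_integrable (partial i \<phi>)" "square_integrable (partial i \<psi>)"
    using \<phi> \<psi> test_function_partial square_integrable_test by blast+
  show "inner (abs_l2 \<phi>) (abs_l2 (partial i \<psi>)) = - inner (abs_l2 (partial i \<phi>)) (abs_l2 \<psi>)"
    unfolding inner_abs_l2[OF si(1,4)] inner_abs_l2[OF si(3,2)]
    by (rule integration_by_parts[OF test_function_C1[OF \<phi>] test_function_C1[OF \<psi>] R])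
qed

text \<open>The weak derivative is a closed operator: its defining identities are continuous in both
  arguments, and \<open>L2 \<Omega>\<close> is closed.\<close>

lemma has_weak_deriv_limit:
  assumes "u \<longlonglongrightarrow> u'" "g \<longlonglongrightarrow> g'" "\<And>n. has_weak_deriv \<Omega> i (u n) (g n)"
  shows "has_weak_deriv \<Omega> i u' g'"
  unfolding has_weak_deriv_def
proof (intro conjI allI impI)
  show "g' \<in> L2 \<Omega>"
    using closed_sequentially[OF closed_L2 _ assms(2)] assms(3) by (auto simp: has_weak_deriv_def)
  fix \<phi> assume \<phi>: "test_function \<Omega> \<phi>"
  have "(\<lambda>n. inner (u n) (abs_l2 (partial i \<phi>))) \<longlonglongrightarrow> inner u' (abs_l2 (partial i \<phi>))"
    by (intro tendsto_intros assms)
  moreover have "(\<lambda>n. - inner (g n) (abs_l2 \<phi>)) \<longlonglongrightarrow> - inner g' (abs_l2 \<phi>)"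
    by (intro tendsto_intros assms)
  moreover have "inner (u n) (abs_l2 (partial i \<phi>)) = - inner (g n) (abs_l2 \<phi>)" for n
    using assms(3) \<phi> by (simp add: has_weak_deriv_def)
  ultimately show "inner u' (abs_l2 (partial i \<phi>)) = - inner g' (abs_l2 \<phi>)"
    using LIMSEQ_unique by simp
qed

lemma has_weak_deriv_weak_deriv: "has_weak_deriv \<Omega> i u g \<Longrightarrow> has_weak_deriv \<Omega> i u (weak_deriv \<Omega> i u)"
  by (simp add: weak_deriv_eqI)

lemma H1_iff: "u \<in> H1 \<Omega> \<longleftrightarrow> u \<in> L2 \<Omega> \<and> (\<forall>i. has_weak_deriv \<Omega> i u (grad \<Omega> u $ i))"
proof -
  have "(\<exists>g. has_weak_deriv \<Omega> i u g) \<longleftrightarrow> has_weak_deriv \<Omega> i u (weak_deriv \<Omega> i u)" for i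
    using has_weak_deriv_weak_deriv by blast
  then show ?thesis by (simp add: H1_def grad_def)
qed

lemma gradI:
  assumes "u \<in> L2 \<Omega>" "\<And>i. has_weak_deriv \<Omega> i u (g $ i)"
  shows "u \<in> H1 \<Omega>" "grad \<Omega> u = g"
  using assms by (auto simp: H1_def grad_def vec_eq_iff weak_deriv_eqI)

lemma grad_add:
  assumes "u \<in> H1 \<Omega>" "v \<in> H1 \<Omega>"
  shows "u + v \<in> H1 \<Omega>" "grad \<Omega> (u + v) = grad \<Omega> u + grad \<Omega> v"
proof -
  have "u + v \<in> L2 \<Omega>" "\<And>i. has_weak_deriv \<Omega> i (u + v) ((grad \<Omega> u + grad \<Omega> v) $ i)"
    using assms subspace_L2 by (auto simp: H1_iff intro: has_weak_deriv_add subspace_add)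
  then show "u + v \<in> H1 \<Omega>" "grad \<Omega> (u + v) = grad \<Omega> u + grad \<Omega> v" using gradI by blast+
qed

lemma grad_scaleR:
  assumes "u \<in> H1 \<Omega>"
  shows "c *\<^sub>R u \<in> H1 \<Omega>" "grad \<Omega> (c *\<^sub>R u) = c *\<^sub>R grad \<Omega> u"
proof -
  have "c *\<^sub>R u \<in> L2 \<Omega>" "\<And>i. has_weak_deriv \<Omega> i (c *\<^sub>R u) ((c *\<^sub>R grad \<Omega> u) $ i)"
    using assms subspace_L2 by (auto simp: H1_iff intro: has_weak_deriv_scaleR subspace_scale)
  then show "c *\<^sub>R u \<in> H1 \<Omega>" "grad \<Omega> (c *\<^sub>R u) = c *\<^sub>R grad \<Omega> u" using gradI by blast+
qed

lemma grad_diff: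
  assumes "u \<in> H1 \<Omega>" "v \<in> H1 \<Omega>"
  shows "u - v \<in> H1 \<Omega>" "grad \<Omega> (u - v) = grad \<Omega> u - grad \<Omega> v"
proof -
  have "u - v = u + (-1) *\<^sub>R v" by simp
  then show "u - v \<in> H1 \<Omega>" "grad \<Omega> (u - v) = grad \<Omega> u - grad \<Omega> v"
    using grad_add[OF assms(1) grad_scaleR(1)[OF assms(2), of "-1"]] grad_scaleR(2)[OF assms(2), of "-1"] by simp_all
qed

lemma grad_test:
  assumes "test_function \<Omega> \<phi>"
  shows "abs_l2 \<phi> \<in> H1 \<Omega>" "grad \<Omega> (abs_l2 \<phi>) = (\<chi> i. abs_l2 (partial i \<phi>))"
proof -
  have "\<And>i. has_weak_deriv \<Omega> i (abs_l2 \<phi>) ((\<chi> i. abs_l2 (partial i \<phi>)) $ i)"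
    using assms by (simp add: has_weak_deriv_test)
  then show "abs_l2 \<phi> \<in> H1 \<Omega>" "grad \<Omega> (abs_l2 \<phi>) = (\<chi> i. abs_l2 (partial i \<phi>))"
    using gradI test_function_L2[OF assms] by blast+
qed

text \<open>The space \<open>H1_0\<close> is studied through its graph, where the \<open>H1\<close> norm becomes the norm of a product type.\<close>

definition graph :: "plane l2 \<Rightarrow> plane l2 \<times> ((plane l2)^2)" where
  "graph u = (u, grad \<Omega> u)"

definition test_graphs :: "(plane l2 \<times> ((plane l2)^2)) set" where
  "test_graphs = {graph (abs_l2 \<phi>) | \<phi>. test_function \<Omega> \<phi>}"

lemma test_graphsI: "test_function \<Omega> \<phi> \<Longrightarrow> x = graph (abs_l2 \<phi>) \<Longrightarrow> x \<in> test_graphs"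
  unfolding test_graphs_def by blast

lemma H1_norm_eq: "H1_norm \<Omega> u = norm (graph u)"
  by (simp add: H1_norm_def graph_def norm_Pair)

lemma graph_diff: "u \<in> H1 \<Omega> \<Longrightarrow> v \<in> H1 \<Omega> \<Longrightarrow> graph (u - v) = graph u - graph v"
  by (simp add: graph_def grad_diff)

lemma subspace_test_graphs: "subspace test_graphs"
  unfolding subspace_def
proof (intro conjI allI ballI)
  have "abs_l2 (\<lambda>x. 0) = (0 :: plane l2)" by (simp add: zero_l2_def)
  moreover have "grad \<Omega> (0 :: plane l2) = 0"
    by (rule gradI(2)) (use subspace_L2 in \<open>auto simp: has_weak_deriv_def subspace_0\<close>)
  ultimately have "0 = graph (abs_l2 (\<lambda>x. 0))" by (simp add: graph_def zero_prod_def)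
  then show "0 \<in> test_graphs" by (rule test_graphsI[OF test_function_zero])
next
  fix x y assume "x \<in> test_graphs" "y \<in> test_graphs"
  then obtain \<phi> \<psi> where p: "test_function \<Omega> \<phi>" "test_function \<Omega> \<psi>" "x = graph (abs_l2 \<phi>)" "y = graph (abs_l2 \<psi>)"
    by (auto simp: test_graphs_def)
  have "x + y = graph (abs_l2 (\<lambda>x. \<phi> x + \<psi> x))"
    using p grad_test square_integrable_test by (simp add: graph_def grad_add flip: abs_l2_add)
  then show "x + y \<in> test_graphs" using test_graphsI test_function_add p(1,2) by blast
next
  fix c x assume "x \<in> test_graphs"
  then obtain \<phi> where p: "test_function \<Omega> \<phi>" "x = graph (abs_l2 \<phi>)" by (auto simp: test_graphs_def)
  have "c *\<^sub>R x = graph (abs_l2 (\<lambda>x. c * \<phi> x))"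
    using p grad_test square_integrable_test by (simp add: graph_def grad_scaleR flip: abs_l2_scaleR)
  then show "c *\<^sub>R x \<in> test_graphs" using test_graphsI test_function_scale p(1) by blast
qed

text \<open>Closedness of the weak derivative turns every limit of test graphs into a graph, so
  completion in the \<open>H1\<close> norm amounts to a closure in the product space.\<close>

lemma graph_H1_0: "graph ` H1_0 \<Omega> = closure test_graphs"
proof (intro set_eqI iffI)
  fix x assume "x \<in> graph ` H1_0 \<Omega>"
  then obtain u where u: "u \<in> H1_0 \<Omega>" "x = graph u" by blast
  show "x \<in> closure test_graphs" unfolding closure_approachable
  proof (intro allI impI)
    fix e :: real assume "e > 0"
    then obtain \<phi> where \<phi>: "test_function \<Omega> \<phi>" "H1_norm \<Omega> (u - abs_l2 \<phi>) < e" using u by (auto simp: H1_0_def)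
    then have "norm (graph u - graph (abs_l2 \<phi>)) < e"
      using u grad_test(1) by (simp add: H1_norm_eq H1_0_def flip: graph_diff)
    then show "\<exists>y\<in>test_graphs. dist y x < e"
      using test_graphsI[OF \<phi>(1) refl] u(2) by (auto simp: dist_norm norm_minus_commute intro!: bexI)
  qed
next
  fix x assume x: "x \<in> closure test_graphs"
  then obtain y where y: "\<And>n. y n \<in> test_graphs" "y \<longlonglongrightarrow> x" unfolding closure_sequential by blast
  from y(1) obtain \<phi> where \<phi>: "\<And>n. test_function \<Omega> (\<phi> n)" "\<And>n. y n = graph (abs_l2 (\<phi> n))"
    unfolding test_graphs_def by (simp only: mem_Collect_eq) metis
  have l1: "(\<lambda>n. abs_l2 (\<phi> n)) \<longlonglongrightarrow> fst x" using tendsto_fst[OF y(2)] by (simp add: \<phi>(2) graph_def)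
  have l2: "(\<lambda>n. grad \<Omega> (abs_l2 (\<phi> n)) $ i) \<longlonglongrightarrow> snd x $ i" for i
    using tendsto_vec_nth[OF tendsto_snd[OF y(2)]] by (simp add: \<phi>(2) graph_def)
  have "fst x \<in> L2 \<Omega>" by (rule closed_sequentially[OF closed_L2 _ l1]) (rule test_function_L2[OF \<phi>(1)])
  moreover have "has_weak_deriv \<Omega> i (fst x) (snd x $ i)" for i
    by (rule has_weak_deriv_limit[OF l1 l2]) (use grad_test[OF \<phi>(1)] H1_iff in blast)
  ultimately have u: "fst x \<in> H1 \<Omega>" "graph (fst x) = x" using gradI[of "fst x" "snd x"] by (auto simp: graph_def)
  have "fst x \<in> H1_0 \<Omega>" unfolding H1_0_def
  proof (intro CollectI conjI allI impI)
    fix e :: real assume "e > 0"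
    then obtain z where "z \<in> test_graphs" "dist z x < e" using x closure_approachable by blast
    then obtain \<phi> where \<phi>: "test_function \<Omega> \<phi>" "dist (graph (abs_l2 \<phi>)) x < e" unfolding test_graphs_def by auto
    then have "H1_norm \<Omega> (fst x - abs_l2 \<phi>) < e"
      using u grad_test(1) by (simp add: H1_norm_eq graph_diff dist_norm norm_minus_commute)
    then show "\<exists>\<phi>. test_function \<Omega> \<phi> \<and> H1_norm \<Omega> (fst x - abs_l2 \<phi>) < e" using \<phi>(1) by blast
  qed (rule u)
  then show "x \<in> graph ` H1_0 \<Omega>" using u(2) by (metis imageI)
qed

lemma H1_0_H1: "u \<in> H1_0 \<Omega> \<Longrightarrow> u \<in> H1 \<Omega>"
  by (simp add: H1_0_def)

lemma H1_0_iff: "u \<in> H1_0 \<Omega> \<longleftrightarrow> u \<in> H1 \<Omega> \<and> graph u \<in> closure test_graphs"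
proof -
  have "inj graph" by (auto simp: inj_def graph_def)
  then show ?thesis using graph_H1_0 H1_0_H1 by (metis imageI inj_image_mem_iff)
qed

text \<open>Density principle: a closed condition on a function and its gradient has to be verified
  for test functions only. The Poincare and Rellich inequalities and the zero mean of gradients are
  obtained this way.\<close>

lemma H1_0_closed_property:
  assumes "closed S" "\<And>\<phi>. test_function \<Omega> \<phi> \<Longrightarrow> graph (abs_l2 \<phi>) \<in> S" "u \<in> H1_0 \<Omega>"
  shows "graph u \<in> S"
proof -
  have "closure test_graphs \<subseteq> S" by (rule closure_minimal) (use assms in \<open>auto simp: test_graphs_def\<close>)
  then show ?thesis using graph_H1_0 assms(3) by blast
qed

lemma subspace_H1_0: "subspace (H1_0 \<Omega>)"
proof -
  have s: "subspace (closure test_graphs)"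
    by (rule subspace_closure) (rule subspace_test_graphs)
  have 0: "graph 0 = 0" "0 \<in> H1 \<Omega>"
    using gradI[of 0 0] subspace_L2 by (auto simp: graph_def has_weak_deriv_def subspace_0 zero_prod_def)
  show ?thesis unfolding subspace_def
  proof (intro conjI allI ballI)
    show "0 \<in> H1_0 \<Omega>" using 0 s by (simp add: H1_0_iff subspace_0)
    fix u v assume uv: "u \<in> H1_0 \<Omega>" "v \<in> H1_0 \<Omega>"
    then have "graph (u + v) = graph u + graph v" by (simp add: graph_def grad_add H1_0_H1)
    then show "u + v \<in> H1_0 \<Omega>" using uv s by (simp add: H1_0_iff grad_add subspace_add)
  next
    fix c u assume u: "u \<in> H1_0 \<Omega>"
    then have "graph (c *\<^sub>R u) = c *\<^sub>R graph u" by (simp add: graph_def grad_scaleR H1_0_H1)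
    then show "c *\<^sub>R u \<in> H1_0 \<Omega>" using u s by (simp add: H1_0_iff grad_scaleR subspace_scale)
  qed
qed

text \<open>Integrating \<open>\<partial>\<^sub>1 (x\<^sub>1 \<phi>\<^sup>2) = \<phi>\<^sup>2 + 2 x\<^sub>1 \<phi> \<partial>\<^sub>1 \<phi>\<close> gives the Poincare inequality with constant \<open>2 R\<close>.\<close>

lemma poincare: "\<exists>R\<ge>0. \<forall>u\<in>H1_0 \<Omega>. norm u \<le> R * norm (grad \<Omega> u)"
proof -
  obtain R where R: "R > 0" "\<And>x. x \<in> \<Omega> \<Longrightarrow> norm x \<le> R" using bounded_domain by (auto simp: bounded_pos)
  have test: "norm (abs_l2 \<phi>) \<le> 2 * R * norm (grad \<Omega> (abs_l2 \<phi>))" if \<phi>: "test_function \<Omega> \<phi>" for \<phi>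
  proof -
    obtain r where r: "vanishes_off r \<phi>" using test_function_vanishes[OF \<phi>] by blast
    have C: "C1 \<phi>" by (rule test_function_C1[OF \<phi>])
    have d: "\<phi> differentiable_on UNIV" "(\<lambda>x. \<phi> x * \<phi> x) differentiable_on UNIV" "(\<lambda>x :: plane. x $ 1) differentiable_on UNIV"
      using C C1_mult[OF C C] C1_nth by (auto simp: C1_def)
    have si: "square_integrable \<phi>" "square_integrable (partial 1 \<phi>)"
      using \<phi> test_function_partial square_integrable_test by blast+
    let ?f = "\<lambda>x. 2 * (x $ 1 * \<phi> x)"
    have cf: "continuous_on UNIV ?f" by (intro continuous_intros C1_continuous[OF C] C1_continuous[OF C1_nth])
    have sf: "square_integrable ?f"
      by (rule square_integrable_continuous_vanishes[OF cf]) (use r in \<open>auto simp: vanishes_off_def\<close>)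
    have i: "integrable lborel (\<lambda>x. \<phi> x * \<phi> x)" "integrable lborel (\<lambda>x. ?f x * partial 1 \<phi> x)"
      using si sf by (auto intro!: square_integrable_mult)
    have "(LINT x|lborel. partial 1 (\<lambda>x. x $ 1 * (\<phi> x * \<phi> x)) x) = 0"
      by (rule integral_partial_eq_0[of _ r]) (use C1_mult[OF C1_nth C1_mult[OF C C]] r in \<open>auto simp: vanishes_off_def\<close>)
    moreover have "partial 1 (\<lambda>x. x $ 1 * (\<phi> x * \<phi> x)) = (\<lambda>x. \<phi> x * \<phi> x + ?f x * partial 1 \<phi> x)"
      using d by (simp add: partial_mult partial_nth fun_eq_iff algebra_simps)
    ultimately have "(LINT x|lborel. \<phi> x * \<phi> x) = - (LINT x|lborel. ?f x * partial 1 \<phi> x)"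
      using i by simp
    then have "(norm (abs_l2 \<phi>))\<^sup>2 = - inner (abs_l2 ?f) (abs_l2 (partial 1 \<phi>))"
      unfolding norm_abs_l2_power2[OF si(1)] inner_abs_l2[OF sf si(2)] by (simp add: power2_eq_square)
    also have "\<dots> \<le> norm (abs_l2 ?f) * norm (abs_l2 (partial 1 \<phi>))"
      using Cauchy_Schwarz_ineq2[of "abs_l2 ?f" "abs_l2 (partial 1 \<phi>)"] by linarith
    also have "norm (abs_l2 ?f) \<le> norm (abs_l2 (\<lambda>x. (2 * R) * \<phi> x))"
    proof (rule norm_abs_l2_le[OF sf square_integrable_scale[OF si(1)]])
      fix x show "\<bar>?f x\<bar> \<le> \<bar>(2 * R) * \<phi> x\<bar>"
      proof (cases "\<phi> x = 0")
        case False
        then have "\<bar>x $ 1\<bar> \<le> R"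
          using R(2)[of x] test_function_eq_0[OF \<phi>, of x] component_le_norm_cart[of x 1] by fastforce
        then show ?thesis using R(1) by (simp add: abs_mult mult_right_mono)
      qed simp
    qed
    also have "\<dots> = 2 * R * norm (abs_l2 \<phi>)" using R(1) by (simp add: abs_l2_scaleR[OF si(1), symmetric])
    finally have "(norm (abs_l2 \<phi>))\<^sup>2 \<le> 2 * R * norm (abs_l2 \<phi>) * norm (abs_l2 (partial 1 \<phi>))"
      by (simp add: mult_right_mono)
    then have "norm (abs_l2 \<phi>) \<le> 2 * R * norm (abs_l2 (partial 1 \<phi>))"
      by (cases "norm (abs_l2 \<phi>) = 0") (use R(1) in \<open>auto simp: power2_eq_square\<close>)
    also have "\<dots> \<le> 2 * R * norm (grad \<Omega> (abs_l2 \<phi>))"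
      using Finite_Cartesian_Product.norm_nth_le[of "grad \<Omega> (abs_l2 \<phi>)" 1] R(1) by (simp add: grad_test[OF \<phi>])
    finally show ?thesis .
  qed
  have "norm u \<le> 2 * R * norm (grad \<Omega> u)" if "u \<in> H1_0 \<Omega>" for u
  proof -
    have "graph u \<in> {z. norm (fst z) \<le> 2 * R * norm (snd z)}"
      by (rule H1_0_closed_property[OF _ _ that])
        (use test in \<open>auto simp: graph_def intro!: closed_Collect_le continuous_intros\<close>)
    then show ?thesis by (simp add: graph_def)
  qed
  then show ?thesis using R(1) by (intro exI[of _ "2 * R"]) auto
qed

text \<open>Through this element the vanishing mean becomes an orthogonality condition; boundedness
  of \<open>\<Omega>\<close> makes it square-integrable.\<close>

definition one :: "plane l2" where "one = abs_l2 (indicator \<Omega>)"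

lemma square_integrable_indicator: "square_integrable (indicator \<Omega> :: plane \<Rightarrow> real)"
proof -
  have "integrable lborel (\<lambda>x. indicator \<Omega> x :: real)"
    using integrable_real_indicator[of \<Omega> lborel] emeasure_bounded_finite[OF bounded_domain] by simp
  moreover have "(\<lambda>x. (indicator \<Omega> x :: real)\<^sup>2) = indicator \<Omega>" by (auto simp: indicator_def)
  ultimately show ?thesis by (simp add: square_integrable_def)
qed

lemma L2_0_eq: "L2_0 \<Omega> = {f \<in> L2 \<Omega>. inner f one = 0}"
  unfolding L2_0_def one_def set_lebesgue_integral_def
  by (simp add: inner_abs_l2_right[OF square_integrable_indicator] mult.commute)

lemma closed_L2_0: "closed (L2_0 \<Omega>)"
  unfolding L2_0_eq Collect_conj_eq Collect_mem_eq
  by (intro closed_Int closed_L2 closed_Collect_eq continuous_intros)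

lemma subspace_L2_0: "subspace (L2_0 \<Omega>)"
  using subspace_L2 unfolding L2_0_eq subspace_def by (auto simp: inner_add_left)

text \<open>Makes the rotation of a field in \<open>H1_0_vec \<Omega>\<close> an admissible test
  function for the pressure.\<close>

lemma grad_mean_zero:
  assumes "u \<in> H1_0 \<Omega>" shows "grad \<Omega> u $ i \<in> L2_0 \<Omega>"
proof -
  have "graph u \<in> {z. inner (snd z $ i) one = 0}"
  proof (rule H1_0_closed_property[OF _ _ assms])
    show "closed {z :: plane l2 \<times> ((plane l2)^2). inner (snd z $ i) one = 0}"
      by (intro closed_Collect_eq continuous_intros)
    fix \<phi> assume \<phi>: "test_function \<Omega> \<phi>"
    obtain r where r: "vanishes_off r \<phi>" using test_function_vanishes[OF \<phi>] by blast
    have \<phi>': "test_function \<Omega> (partial i \<phi>)" by (rule test_function_partial[OF \<phi>])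
    have "inner (abs_l2 (partial i \<phi>)) one = (LINT x|lborel. partial i \<phi> x * indicator \<Omega> x)"
      unfolding one_def by (rule inner_abs_l2[OF square_integrable_test[OF \<phi>'] square_integrable_indicator])
    also have "\<dots> = (LINT x|lborel. partial i \<phi> x)"
      using test_function_eq_0[OF \<phi>'] by (intro Bochner_Integration.integral_cong) (auto simp: indicator_def)
    also have "\<dots> = 0" by (rule integral_partial_eq_0[OF test_function_C1[OF \<phi>] r])
    finally show "graph (abs_l2 \<phi>) \<in> {z. inner (snd z $ i) one = 0}"
      by (simp add: graph_def grad_test[OF \<phi>])
  qed
  moreover have "grad \<Omega> u $ i \<in> L2 \<Omega>" using H1_0_H1[OF assms] by (simp add: H1_iff has_weak_deriv_def)
  ultimately show ?thesis by (simp add: L2_0_eq graph_def)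
qed

end

section \<open>Rellich compactness\<close>

text \<open>Expansion of the square over pairs of points in \<open>Q\<close>. It converts control of
  differences within a cell into control of \<open>f\<close> up to its mean on the cell.\<close>

lemma variance_identity:
  fixes f :: "'a::euclidean_space \<Rightarrow> real"
  assumes f: "square_integrable f" and Q[measurable]: "Q \<in> sets borel" and fin: "emeasure lborel Q < \<infinity>"
  shows "(\<integral>\<^sup>+x. \<integral>\<^sup>+y. ennreal (indicator Q x * indicator Q y * (f x - f y)\<^sup>2) \<partial>lborel \<partial>lborel) =
    ennreal (2 * (measure lborel Q * (LINT x|lborel. (f x)\<^sup>2 * indicator Q x) - (LINT x|lborel. f x * indicator Q x)\<^sup>2))"
proof -
  have [measurable]: "f \<in> borel_measurable borel" using f by (simp add: square_integrable_def)
  define m where "m = measure lborel Q"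
  define A where "A = (LINT x|lborel. f x * indicator Q x)"
  define B where "B = (LINT x|lborel. (f x)\<^sup>2 * indicator Q x)"
  have i1: "integrable lborel (\<lambda>x. indicator Q x :: real)" using fin by simp
  have "(\<lambda>x. (indicator Q x :: real)\<^sup>2) = indicator Q" by (auto simp: indicator_def)
  then have sQ: "square_integrable (indicator Q :: 'a \<Rightarrow> real)" using i1 by (simp add: square_integrable_def)
  have i2: "integrable lborel (\<lambda>x. f x * indicator Q x)" by (rule square_integrable_mult[OF f sQ])
  have i3: "integrable lborel (\<lambda>x. (f x)\<^sup>2 * indicator Q x)"
    by (rule Bochner_Integration.integrable_bound[of _ "\<lambda>x. (f x)\<^sup>2"])
      (use f in \<open>auto simp: square_integrable_def indicator_def\<close>)
  have m: "(LINT x|lborel. indicator Q x :: real) = m" by (simp add: m_def)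
  have inner: "(\<integral>\<^sup>+y. ennreal (indicator Q x * indicator Q y * (f x - f y)\<^sup>2) \<partial>lborel) =
      ennreal (indicator Q x * ((f x)\<^sup>2 * m - 2 * f x * A + B))" for x
  proof -
    have eq: "indicator Q x * indicator Q y * (f x - f y)\<^sup>2 =
        indicator Q x * ((f x)\<^sup>2 * indicator Q y - 2 * f x * (f y * indicator Q y) + (f y)\<^sup>2 * indicator Q y)" for y
      by (simp add: power2_diff algebra_simps)
    have "integrable lborel (\<lambda>y. indicator Q x * indicator Q y * (f x - f y)\<^sup>2)"
      unfolding eq by (intro integrable_mult_right Bochner_Integration.integrable_add Bochner_Integration.integrable_diff i1 i2 i3)
    then have "(\<integral>\<^sup>+y. ennreal (indicator Q x * indicator Q y * (f x - f y)\<^sup>2) \<partial>lborel) =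
        ennreal (LINT y|lborel. indicator Q x * indicator Q y * (f x - f y)\<^sup>2)"
      by (rule nn_integral_eq_integral) simp
    also have "(LINT y|lborel. indicator Q x * indicator Q y * (f x - f y)\<^sup>2) =
        indicator Q x * ((f x)\<^sup>2 * m - 2 * f x * A + B)"
      unfolding eq using i1 i2 i3 by (simp add: m_def A_def B_def)
    finally show ?thesis .
  qed
  have eq: "indicator Q x * ((f x)\<^sup>2 * m - 2 * f x * A + B) =
      m * ((f x)\<^sup>2 * indicator Q x) - 2 * A * (f x * indicator Q x) + B * indicator Q x" for x
    by (simp add: algebra_simps)
  have i: "integrable lborel (\<lambda>x. indicator Q x * ((f x)\<^sup>2 * m - 2 * f x * A + B))"
    unfolding eq by (intro integrable_mult_right Bochner_Integration.integrable_add Bochner_Integration.integrable_diff i1 i2 i3)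
  \<comment> \<open>For \<open>x\<close> in \<open>Q\<close> the factor is itself the integral of a
    square; its sign allows the outer \<open>ennreal\<close> integral to be replaced by a real
    one.\<close>
  have nonneg: "0 \<le> indicator Q x * ((f x)\<^sup>2 * m - 2 * f x * A + B)" for x
  proof (cases "x \<in> Q")
    case True
    have e: "(f y)\<^sup>2 * indicator Q y - 2 * f x * (f y * indicator Q y) + (f x)\<^sup>2 * indicator Q y =
        (f x - f y)\<^sup>2 * indicator Q y" for y by (simp add: power2_diff algebra_simps)
    have "0 \<le> (LINT y|lborel. (f y)\<^sup>2 * indicator Q y - 2 * f x * (f y * indicator Q y) + (f x)\<^sup>2 * indicator Q y)"
      unfolding e by (rule Bochner_Integration.integral_nonneg) simp
    also have "\<dots> = (f x)\<^sup>2 * m - 2 * f x * A + B"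
      using i1 i2 i3 by (simp add: m_def A_def B_def)
    finally show ?thesis by simp
  qed simp
  have "(LINT x|lborel. indicator Q x * ((f x)\<^sup>2 * m - 2 * f x * A + B)) = 2 * (m * B - A\<^sup>2)"
    unfolding eq using i1 i2 i3
    by (simp add: m_def flip: A_def B_def) (simp add: power2_eq_square algebra_simps)
  then show ?thesis
    unfolding inner nn_integral_eq_integral[OF i AE_I2[OF nonneg]] by (simp add: m_def A_def B_def)
qed

text \<open>Half-open squares of side \<open>s\<close> partition the plane: the index of a point
  consists of two floors.\<close>

definition cell :: "real \<Rightarrow> int \<times> int \<Rightarrow> plane set" where
  "cell s p = {x. of_int (fst p) * s \<le> x $ 1 \<and> x $ 1 < (of_int (fst p) + 1) * s \<and>
     of_int (snd p) * s \<le> x $ 2 \<and> x $ 2 < (of_int (snd p) + 1) * s}"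

lemma cell_measurable [measurable]: "cell s p \<in> sets borel"
proof -
  have "continuous_on UNIV (\<lambda>x :: plane. x $ i)" for i by (intro continuous_intros)
  then have [measurable]: "(\<lambda>x :: plane. x $ i) \<in> borel_measurable borel" for i
    by (rule borel_measurable_continuous_onI)
  show ?thesis unfolding cell_def by measurable
qed

lemma cell_iff:
  assumes "s > 0" shows "x \<in> cell s p \<longleftrightarrow> p = (\<lfloor>x $ 1 / s\<rfloor>, \<lfloor>x $ 2 / s\<rfloor>)"
proof -
  have *: "of_int q * s \<le> y \<and> y < (of_int q + 1) * s \<longleftrightarrow> q = \<lfloor>y / s\<rfloor>" for q :: int and y
    using assms by (auto simp: eq_commute[of q] floor_eq_iff pos_le_divide_eq pos_divide_less_eq)
  show ?thesis unfolding cell_def using *[of "fst p" "x $ 1"] *[of "snd p" "x $ 2"] by (cases p) auto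
qed

lemma measure_cell:
  assumes s: "s > 0" shows "emeasure lborel (cell s p) = ennreal (s\<^sup>2)"
proof -
  define l :: plane where "l = (\<chi> i. of_int (if i = 1 then fst p else snd p) * s)"
  define r :: plane where "r = (\<chi> i. (of_int (if i = 1 then fst p else snd p) + 1) * s)"
  have lr: "l $ i \<le> r $ i" "r $ i - l $ i = s" for i using s by (auto simp: l_def r_def algebra_simps)
  have "cbox l r \<noteq> {}" using lr(1) by (simp add: interval_ne_empty_cart)
  then have c: "measure lborel (cbox l r) = s\<^sup>2"
    by (simp add: content_cbox_cart lr(2) UNIV_2 power2_eq_square)
  have e: "emeasure lborel (cbox l r) = ennreal (s\<^sup>2)"
    using emeasure_eq_ennreal_measure[of lborel "cbox l r"] emeasure_lborel_cbox_finite[of l r] c by simp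
  have "emeasure lborel (box l r) = emeasure lborel (cbox l r)"
    by (simp add: emeasure_lborel_box_eq emeasure_lborel_cbox_eq)
  moreover have "emeasure lborel (box l r) \<le> emeasure lborel (cell s p)"
    by (rule emeasure_mono) (auto simp: cell_def mem_box_cart forall_2 l_def r_def intro: less_imp_le)
  moreover have "emeasure lborel (cell s p) \<le> emeasure lborel (cbox l r)"
    by (rule emeasure_mono) (auto simp: cell_def mem_box_cart forall_2 l_def r_def intro: less_imp_le)
  ultimately show ?thesis using e by simp
qed

context planar_domain
begin

lemma norm_grad_test:
  assumes "test_function \<Omega> \<phi>"
  shows "(norm (grad \<Omega> (abs_l2 \<phi>)))\<^sup>2 = (norm (abs_l2 (partial 1 \<phi>)))\<^sup>2 + (norm (abs_l2 (partial 2 \<phi>)))\<^sup>2"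
  by (simp add: grad_test[OF assms] norm_vec_power2 UNIV_2)

lemma norm_dir_deriv_le:
  assumes \<phi>: "test_function \<Omega> \<phi>" and t: "\<And>i. \<bar>t $ i\<bar> \<le> s"
  shows "(norm (abs_l2 (dir_deriv \<phi> t)))\<^sup>2 \<le> 2 * s\<^sup>2 * (norm (grad \<Omega> (abs_l2 \<phi>)))\<^sup>2"
proof -
  have s0: "s \<ge> 0" using t[of 1] by linarith
  let ?a = "norm (abs_l2 (partial 1 \<phi>))" and ?b = "norm (abs_l2 (partial 2 \<phi>))"
  have si: "square_integrable (partial i \<phi>)" for i using test_function_partial[OF \<phi>] square_integrable_test by blast
  have "dir_deriv \<phi> t = (\<lambda>x. t $ 1 * partial 1 \<phi> x + t $ 2 * partial 2 \<phi> x)"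
    by (rule ext) (simp add: dir_deriv_def sum_2)
  then have "abs_l2 (dir_deriv \<phi> t) = t $ 1 *\<^sub>R abs_l2 (partial 1 \<phi>) + t $ 2 *\<^sub>R abs_l2 (partial 2 \<phi>)"
    by (simp add: abs_l2_scaleR abs_l2_add si square_integrable_scale)
  then have "norm (abs_l2 (dir_deriv \<phi> t)) \<le> \<bar>t $ 1\<bar> * ?a + \<bar>t $ 2\<bar> * ?b"
    by (metis norm_scaleR norm_triangle_ineq)
  also have "\<dots> \<le> s * ?a + s * ?b" by (intro add_mono mult_right_mono t) auto
  finally have "(norm (abs_l2 (dir_deriv \<phi> t)))\<^sup>2 \<le> (s * (?a + ?b))\<^sup>2"
    by (intro power_mono) (auto simp: distrib_left)
  also have "\<dots> \<le> s\<^sup>2 * (2 * (?a\<^sup>2 + ?b\<^sup>2))"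
    unfolding power_mult_distrib using sum_squares_bound[of ?a ?b]
    by (intro mult_left_mono) (auto simp: power2_sum)
  finally show ?thesis by (simp add: norm_grad_test[OF \<phi>] algebra_simps)
qed

text \<open>Points in one cell differ by some \<open>t\<close> in the square \<open>?K\<close> of
  half-side \<open>s\<close>. Summing the variances over all cells and exchanging the integrals
  leaves squared increments of \<open>\<phi>\<close> over \<open>t\<close>, each at most
  \<open>2 s\<^sup>2\<close> times the squared gradient norm, integrated over the area
  \<open>4 s\<^sup>2\<close>. The factor 2 of the variance identity reduces the resulting 8 to
  4.\<close>

lemma rellich_test:
  assumes s: "s > 0" and Z: "finite Z" "\<Omega> \<subseteq> (\<Union>p\<in>Z. cell s p)" and \<phi>: "test_function \<Omega> \<phi>"
  shows "s\<^sup>2 * (norm (abs_l2 \<phi>))\<^sup>2 \<le> (\<Sum>p\<in>Z. (LINT x|lborel. \<phi> x * indicator (cell s p) x)\<^sup>2)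
    + 4 * s^4 * (norm (grad \<Omega> (abs_l2 \<phi>)))\<^sup>2"
proof -
  have si: "square_integrable \<phi>" by (rule square_integrable_test[OF \<phi>])
  have [measurable]: "\<phi> \<in> borel_measurable borel" using si by (simp add: square_integrable_def)
  obtain R where R: "vanishes_off R \<phi>" using test_function_vanishes[OF \<phi>] by blast
  let ?A = "\<lambda>p. (LINT x|lborel. \<phi> x * indicator (cell s p) x)"
  let ?B = "\<lambda>p. (LINT x|lborel. (\<phi> x)\<^sup>2 * indicator (cell s p) x)"
  define c :: plane where "c = (\<chi> i. s)"
  let ?K = "cbox (- c) c"
  let ?g = "(norm (grad \<Omega> (abs_l2 \<phi>)))\<^sup>2"
  have iB: "integrable lborel (\<lambda>x. (\<phi> x)\<^sup>2 * indicator (cell s p) x)" for p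
    by (rule Bochner_Integration.integrable_bound[of _ "\<lambda>x. (\<phi> x)\<^sup>2"])
      (use si in \<open>auto simp: square_integrable_def indicator_def\<close>)
  \<comment> \<open>Only the cell of \<open>x\<close> can contribute, and a \<open>y\<close> in that
    cell has both coordinates within \<open>s\<close> of those of \<open>x\<close>.\<close>
  have ind_sum: "(\<Sum>p\<in>Z. indicator (cell s p) x * indicator (cell s p) y :: real) \<le> indicator ?K (y - x)" for x y
  proof -
    let ?p = "(\<lfloor>x $ 1 / s\<rfloor>, \<lfloor>x $ 2 / s\<rfloor>)"
    have "(\<Sum>p\<in>Z. indicator (cell s p) x * indicator (cell s p) y :: real) =
        (\<Sum>p\<in>Z. if p = ?p then indicator (cell s p) x * indicator (cell s p) y else 0)"
      by (intro sum.cong) (auto simp: indicator_def cell_iff[OF s, of x])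
    also have "\<dots> \<le> indicator (cell s ?p) x * indicator (cell s ?p) y" using Z(1) by (simp add: indicator_def)
    also have "\<dots> \<le> indicator ?K (y - x)"
    proof -
      have "y - x \<in> ?K" if "x \<in> cell s ?p" "y \<in> cell s ?p"
        using that by (auto simp: cell_def mem_box_cart forall_2 c_def algebra_simps)
      then show ?thesis by (auto simp: indicator_def)
    qed
    finally show ?thesis .
  qed
  have KK: "emeasure lborel ?K = ennreal (4 * s\<^sup>2)"
  proof -
    have "?K \<noteq> {}" using s by (simp add: interval_ne_empty_cart c_def)
    then have "measure lborel ?K = 4 * s\<^sup>2" by (simp add: content_cbox_cart c_def UNIV_2 power2_eq_square)
    then show ?thesis
      using emeasure_eq_ennreal_measure[of lborel ?K] emeasure_lborel_cbox_finite[of "- c" c] by simp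
  qed
  have inc: "(\<integral>\<^sup>+x. ennreal ((\<phi> x - \<phi> (x + t))\<^sup>2) \<partial>lborel) \<le> ennreal (2 * s\<^sup>2 * ?g)" if t: "t \<in> ?K" for t
  proof -
    have ti: "\<bar>t $ i\<bar> \<le> s" for i using t by (auto simp: mem_box_cart c_def abs_le_iff dest: spec[of _ i])
    have d: "square_integrable (\<lambda>x. \<phi> (x + t) - \<phi> x)"
      by (intro square_integrable_diff square_integrable_translate si)
    have "(\<integral>\<^sup>+x. ennreal ((\<phi> x - \<phi> (x + t))\<^sup>2) \<partial>lborel) = (\<integral>\<^sup>+x. ennreal ((\<phi> (x + t) - \<phi> x)\<^sup>2) \<partial>lborel)"
      by (simp add: power2_commute)
    also have "\<dots> = ennreal ((norm (abs_l2 (\<lambda>x. \<phi> (x + t) - \<phi> x)))\<^sup>2)" by (rule nn_integral_square[OF d])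
    also have "\<dots> \<le> ennreal ((norm (abs_l2 (dir_deriv \<phi> t)))\<^sup>2)"
      by (intro ennreal_leI power_mono norm_increment_le_dir_deriv[OF test_function_C1[OF \<phi>] R]) auto
    also have "\<dots> \<le> ennreal (2 * s\<^sup>2 * ?g)" by (intro ennreal_leI norm_dir_deriv_le \<phi> ti)
    finally show ?thesis .
  qed
  have pos: "0 \<le> 2 * (s\<^sup>2 * ?B p - (?A p)\<^sup>2)"
    and var: "(\<integral>\<^sup>+x. \<integral>\<^sup>+y. ennreal (indicator (cell s p) x * indicator (cell s p) y * (\<phi> x - \<phi> y)\<^sup>2) \<partial>lborel \<partial>lborel) =
      ennreal (2 * (s\<^sup>2 * ?B p - (?A p)\<^sup>2))" for p
  proof -
    have e: "emeasure lborel (cell s p) < \<infinity>" "measure lborel (cell s p) = s\<^sup>2"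
      using measure_cell[OF s, of p] by (simp_all add: measure_def)
    show "(\<integral>\<^sup>+x. \<integral>\<^sup>+y. ennreal (indicator (cell s p) x * indicator (cell s p) y * (\<phi> x - \<phi> y)\<^sup>2) \<partial>lborel \<partial>lborel) =
      ennreal (2 * (s\<^sup>2 * ?B p - (?A p)\<^sup>2))"
      using variance_identity[OF si cell_measurable e(1)] by (simp add: e(2))
    have "square_integrable (indicator (cell s p) :: plane \<Rightarrow> real)"
    proof -
      have "(\<lambda>x. (indicator (cell s p) x :: real)\<^sup>2) = indicator (cell s p)" by (auto simp: indicator_def)
      then show ?thesis using e(1) by (simp add: square_integrable_def)
    qed
    then have sq: "square_integrable (\<lambda>x. \<phi> x * indicator (cell s p) x)" "square_integrable (indicator (cell s p) :: plane \<Rightarrow> real)"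
      using restrict_L2(1)[OF si cell_measurable] by auto
    have "?A p = inner (abs_l2 (\<lambda>x. \<phi> x * indicator (cell s p) x)) (abs_l2 (indicator (cell s p)))"
      unfolding inner_abs_l2[OF sq] by (intro Bochner_Integration.integral_cong) (auto simp: indicator_def)
    then have "(?A p)\<^sup>2 \<le> (norm (abs_l2 (\<lambda>x. \<phi> x * indicator (cell s p) x)))\<^sup>2 * (norm (abs_l2 (indicator (cell s p) :: plane \<Rightarrow> real)))\<^sup>2"
      using Cauchy_Schwarz_ineq by (simp add: power2_norm_eq_inner)
    also have "(norm (abs_l2 (\<lambda>x. \<phi> x * indicator (cell s p) x)))\<^sup>2 = ?B p"
      unfolding norm_abs_l2_power2[OF sq(1)] by (intro Bochner_Integration.integral_cong) (auto simp: indicator_def)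
    also have "(norm (abs_l2 (indicator (cell s p) :: plane \<Rightarrow> real)))\<^sup>2 = (LINT x|lborel. indicator (cell s p) x)"
      unfolding norm_abs_l2_power2[OF sq(2)] by (intro Bochner_Integration.integral_cong) (auto simp: indicator_def)
    also have "\<dots> = s\<^sup>2" using e(2) by simp
    finally show "0 \<le> 2 * (s\<^sup>2 * ?B p - (?A p)\<^sup>2)" by (simp add: mult.commute)
  qed
  have "ennreal (\<Sum>p\<in>Z. 2 * (s\<^sup>2 * ?B p - (?A p)\<^sup>2)) = (\<Sum>p\<in>Z. ennreal (2 * (s\<^sup>2 * ?B p - (?A p)\<^sup>2)))"
    by (rule sum_ennreal[symmetric]) (rule pos)
  also have "\<dots> = (\<integral>\<^sup>+x. \<integral>\<^sup>+y. (\<Sum>p\<in>Z. ennreal (indicator (cell s p) x * indicator (cell s p) y * (\<phi> x - \<phi> y)\<^sup>2)) \<partial>lborel \<partial>lborel)"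
  proof -
    define F where "F p x y = ennreal (indicator (cell s p) x * indicator (cell s p) y * (\<phi> x - \<phi> y)\<^sup>2)" for p x y
    have m1: "(\<lambda>y. F p x y) \<in> borel_measurable lborel" for p x unfolding F_def by measurable
    have m2: "(\<lambda>x. \<integral>\<^sup>+y. F p x y \<partial>lborel) \<in> borel_measurable lborel" for p unfolding F_def by measurable
    have "(\<Sum>p\<in>Z. \<integral>\<^sup>+x. \<integral>\<^sup>+y. F p x y \<partial>lborel \<partial>lborel) = (\<integral>\<^sup>+x. (\<Sum>p\<in>Z. \<integral>\<^sup>+y. F p x y \<partial>lborel) \<partial>lborel)"
      by (rule nn_integral_sum[symmetric]) (rule m2)
    also have "\<dots> = (\<integral>\<^sup>+x. \<integral>\<^sup>+y. (\<Sum>p\<in>Z. F p x y) \<partial>lborel \<partial>lborel)"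
      by (intro nn_integral_cong nn_integral_sum[symmetric]) (rule m1)
    finally show ?thesis unfolding F_def var[symmetric] .
  qed
  also have "\<dots> \<le> (\<integral>\<^sup>+x. \<integral>\<^sup>+y. ennreal (indicator ?K (y - x) * (\<phi> x - \<phi> y)\<^sup>2) \<partial>lborel \<partial>lborel)"
  proof (intro nn_integral_mono)
    fix x y
    have "(\<Sum>p\<in>Z. ennreal (indicator (cell s p) x * indicator (cell s p) y * (\<phi> x - \<phi> y)\<^sup>2)) =
        ennreal ((\<Sum>p\<in>Z. indicator (cell s p) x * indicator (cell s p) y) * (\<phi> x - \<phi> y)\<^sup>2)"
      unfolding sum_distrib_right by (rule sum_ennreal) simp
    also have "\<dots> \<le> ennreal (indicator ?K (y - x) * (\<phi> x - \<phi> y)\<^sup>2)"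
      by (intro ennreal_leI mult_right_mono ind_sum) simp
    finally show "(\<Sum>p\<in>Z. ennreal (indicator (cell s p) x * indicator (cell s p) y * (\<phi> x - \<phi> y)\<^sup>2)) \<le>
        ennreal (indicator ?K (y - x) * (\<phi> x - \<phi> y)\<^sup>2)" .
  qed
  also have "\<dots> = (\<integral>\<^sup>+x. \<integral>\<^sup>+t. ennreal (indicator ?K t * (\<phi> x - \<phi> (x + t))\<^sup>2) \<partial>lborel \<partial>lborel)"
  proof (rule nn_integral_cong)
    fix x :: plane
    have "(\<integral>\<^sup>+y. ennreal (indicator ?K (y - x) * (\<phi> x - \<phi> y)\<^sup>2) \<partial>lborel) =
        (\<integral>\<^sup>+y. ennreal (indicator ?K (y - x) * (\<phi> x - \<phi> y)\<^sup>2) \<partial>distr lborel borel ((+) x))"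
      by (simp add: lborel_distr_plus)
    also have "\<dots> = (\<integral>\<^sup>+t. ennreal (indicator ?K t * (\<phi> x - \<phi> (x + t))\<^sup>2) \<partial>lborel)"
      by (subst nn_integral_distr) auto
    finally show "(\<integral>\<^sup>+y. ennreal (indicator ?K (y - x) * (\<phi> x - \<phi> y)\<^sup>2) \<partial>lborel) =
        (\<integral>\<^sup>+t. ennreal (indicator ?K t * (\<phi> x - \<phi> (x + t))\<^sup>2) \<partial>lborel)" .
  qed
  also have "\<dots> = (\<integral>\<^sup>+t. \<integral>\<^sup>+x. ennreal (indicator ?K t * (\<phi> x - \<phi> (x + t))\<^sup>2) \<partial>lborel \<partial>lborel)"
    by (rule lborel_pair.Fubini'[symmetric]) measurable
  also have "\<dots> \<le> (\<integral>\<^sup>+t. ennreal (2 * s\<^sup>2 * ?g) * indicator ?K t \<partial>lborel)"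
  proof (rule nn_integral_mono)
    fix t show "(\<integral>\<^sup>+x. ennreal (indicator ?K t * (\<phi> x - \<phi> (x + t))\<^sup>2) \<partial>lborel) \<le> ennreal (2 * s\<^sup>2 * ?g) * indicator ?K t"
      using inc[of t] by (cases "t \<in> ?K") auto
  qed
  also have "\<dots> = ennreal (2 * s\<^sup>2 * ?g) * ennreal (4 * s\<^sup>2)" by (simp add: nn_integral_cmult_indicator KK)
  also have "\<dots> = ennreal (8 * s^4 * ?g)" 
  proof -
    have "ennreal (2 * s\<^sup>2 * ?g) * ennreal (4 * s\<^sup>2) = ennreal (2 * s\<^sup>2 * ?g * (4 * s\<^sup>2))"
      by (rule ennreal_mult[symmetric]) auto
    moreover have "2 * s\<^sup>2 * ?g * (4 * s\<^sup>2) = 8 * s^4 * ?g" by (simp add: power2_eq_square power4_eq_xxxx)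
    ultimately show ?thesis by simp
  qed
  finally have "(\<Sum>p\<in>Z. 2 * (s\<^sup>2 * ?B p - (?A p)\<^sup>2)) \<le> 8 * s^4 * ?g"
    by (subst (asm) ennreal_le_iff) auto
  then have "s\<^sup>2 * (\<Sum>p\<in>Z. ?B p) \<le> (\<Sum>p\<in>Z. (?A p)\<^sup>2) + 4 * s^4 * ?g"
    by (simp add: sum_distrib_left[symmetric] sum_subtractf)
  moreover have "(norm (abs_l2 \<phi>))\<^sup>2 \<le> (\<Sum>p\<in>Z. ?B p)"
  proof -
    have "(\<Sum>p\<in>Z. ?B p) = (LINT x|lborel. (\<Sum>p\<in>Z. (\<phi> x)\<^sup>2 * indicator (cell s p) x))"
      by (rule Bochner_Integration.integral_sum[symmetric]) (rule iB)
    also have "\<dots> \<ge> (LINT x|lborel. (\<phi> x)\<^sup>2)"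
    proof (rule integral_mono)
      show "integrable lborel (\<lambda>x. (\<phi> x)\<^sup>2)" using si by (simp add: square_integrable_def)
      show "integrable lborel (\<lambda>x. \<Sum>p\<in>Z. (\<phi> x)\<^sup>2 * indicator (cell s p) x)" by (intro Bochner_Integration.integrable_sum iB)
      fix x
      show "(\<phi> x)\<^sup>2 \<le> (\<Sum>p\<in>Z. (\<phi> x)\<^sup>2 * indicator (cell s p) x)"
      proof (cases "\<phi> x = 0")
        case False
        then have "x \<in> \<Omega>" using test_function_eq_0[OF \<phi>] by blast
        then obtain p where p: "p \<in> Z" "x \<in> cell s p" using Z(2) by blast
        have "(\<phi> x)\<^sup>2 * indicator (cell s p) x \<le> (\<Sum>p\<in>Z. (\<phi> x)\<^sup>2 * indicator (cell s p) x)"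
          by (rule member_le_sum) (use p Z(1) in auto)
        then show ?thesis using p by simp
      qed (simp add: sum_nonneg)
    qed
    finally show ?thesis by (simp add: norm_abs_l2_power2[OF si])
  qed
  then have "s\<^sup>2 * (norm (abs_l2 \<phi>))\<^sup>2 \<le> s\<^sup>2 * (\<Sum>p\<in>Z. ?B p)" by (intro mult_left_mono) auto
  ultimately show ?thesis by linarith
qed

text \<open>Compactness in quantitative form: up to finitely many functionals, here cell averages,
  the norm is controlled by an arbitrarily small multiple of the gradient norm.\<close>

lemma rellich_inequality:
  assumes \<epsilon>: "\<epsilon> > 0"
  shows "\<exists>(I :: (int \<times> int) set) e. finite I \<and>
    (\<forall>u\<in>H1_0 \<Omega>. (norm u)\<^sup>2 \<le> (\<Sum>i\<in>I. (inner u (e i))\<^sup>2) + \<epsilon> * (norm (grad \<Omega> u))\<^sup>2)"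
proof -
  \<comment> \<open>Dividing the cell estimate by \<open>s\<^sup>2\<close> leaves the factor
    \<open>4 s\<^sup>2\<close> on the gradient term.\<close>
  define s where "s = sqrt \<epsilon> / 2"
  have s: "s > 0" "4 * s\<^sup>2 = \<epsilon>" using \<epsilon> by (auto simp: s_def power_divide)
  obtain R where R: "R > 0" "\<And>x. x \<in> \<Omega> \<Longrightarrow> norm x \<le> R" using bounded_domain by (auto simp: bounded_pos)
  define N where "N = \<lceil>R / s\<rceil>"
  define Z where "Z = {-N..N} \<times> {-N..N}"
  have Z: "finite Z" by (simp add: Z_def)
  have cov: "\<Omega> \<subseteq> (\<Union>p\<in>Z. cell s p)"
  proof
    fix x assume "x \<in> \<Omega>"
    have "\<lfloor>x $ i / s\<rfloor> \<in> {-N..N}" for i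
    proof -
      have "\<bar>x $ i\<bar> \<le> R" using component_le_norm_cart[of x i] R(2)[OF \<open>x \<in> \<Omega>\<close>] by linarith
      then have "\<bar>x $ i / s\<bar> \<le> R / s" using s(1) by (simp add: divide_right_mono)
      moreover have "R / s \<le> of_int N" by (simp add: N_def)
      ultimately have "- of_int N \<le> x $ i / s" "x $ i / s \<le> of_int N" by linarith+
      then show ?thesis by (auto simp: le_floor_iff floor_le_iff)
    qed
    then have "(\<lfloor>x $ 1 / s\<rfloor>, \<lfloor>x $ 2 / s\<rfloor>) \<in> Z" by (simp add: Z_def)
    then show "x \<in> (\<Union>p\<in>Z. cell s p)" using cell_iff[OF s(1)] by blast
  qed
  define e where "e p = (1 / s) *\<^sub>R abs_l2 (indicator (cell s p) :: plane \<Rightarrow> real)" for p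
  have sq: "square_integrable (indicator (cell s p) :: plane \<Rightarrow> real)" for p
  proof -
    have "(\<lambda>x. (indicator (cell s p) x :: real)\<^sup>2) = indicator (cell s p)" by (auto simp: indicator_def)
    then show ?thesis using measure_cell[OF s(1), of p] by (simp add: square_integrable_def)
  qed
  have "(norm u)\<^sup>2 \<le> (\<Sum>p\<in>Z. (inner u (e p))\<^sup>2) + \<epsilon> * (norm (grad \<Omega> u))\<^sup>2" if u: "u \<in> H1_0 \<Omega>" for u
  proof -
    have "graph u \<in> {z. (norm (fst z))\<^sup>2 \<le> (\<Sum>p\<in>Z. (inner (fst z) (e p))\<^sup>2) + \<epsilon> * (norm (snd z))\<^sup>2}"
    proof (rule H1_0_closed_property[OF _ _ u])
      show "closed {z :: plane l2 \<times> ((plane l2)^2). (norm (fst z))\<^sup>2 \<le> (\<Sum>p\<in>Z. (inner (fst z) (e p))\<^sup>2) + \<epsilon> * (norm (snd z))\<^sup>2}"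
        by (intro closed_Collect_le continuous_intros)
      fix \<phi> assume \<phi>: "test_function \<Omega> \<phi>"
      let ?A = "\<lambda>p. (LINT x|lborel. \<phi> x * indicator (cell s p) x)"
      let ?g = "(norm (grad \<Omega> (abs_l2 \<phi>)))\<^sup>2"
      have ip: "s\<^sup>2 * (inner (abs_l2 \<phi>) (e p))\<^sup>2 = (?A p)\<^sup>2" for p
        using s(1) by (simp add: e_def inner_abs_l2[OF square_integrable_test[OF \<phi>] sq] power_divide)
      have "s\<^sup>2 * (norm (abs_l2 \<phi>))\<^sup>2 \<le> (\<Sum>p\<in>Z. (?A p)\<^sup>2) + 4 * s^4 * ?g"
        by (rule rellich_test[OF s(1) Z cov \<phi>])
      also have "\<dots> = s\<^sup>2 * ((\<Sum>p\<in>Z. (inner (abs_l2 \<phi>) (e p))\<^sup>2) + \<epsilon> * ?g)"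
      proof -
        have "(\<Sum>p\<in>Z. (?A p)\<^sup>2) = s\<^sup>2 * (\<Sum>p\<in>Z. (inner (abs_l2 \<phi>) (e p))\<^sup>2)" by (simp only: sum_distrib_left ip)
        moreover have "4 * s^4 = s\<^sup>2 * \<epsilon>" unfolding s(2)[symmetric] by (simp add: power2_eq_square power4_eq_xxxx)
        ultimately show ?thesis by (simp add: distrib_left mult.assoc)
      qed
      finally show "graph (abs_l2 \<phi>) \<in> {z. (norm (fst z))\<^sup>2 \<le> (\<Sum>p\<in>Z. (inner (fst z) (e p))\<^sup>2) + \<epsilon> * (norm (snd z))\<^sup>2}"
        using s(1) by (simp add: graph_def)
    qed
    then show ?thesis by (simp add: graph_def)
  qed
  then show ?thesis using Z by blast
qed

text \<open>Diagonal argument over the tolerances \<open>1 / (n + 1)\<close>. For each of them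
  finitely many inner products converge along a subsequence, and the gradient bound makes the
  remaining term small.\<close>

lemma rellich_compact:
  fixes u :: "nat \<Rightarrow> plane l2"
  assumes u: "\<And>n. u n \<in> H1_0 \<Omega>" and K: "\<And>n. norm (u n) \<le> K" "\<And>n. norm (grad \<Omega> (u n)) \<le> K"
  shows "\<exists>r l. strict_mono r \<and> (\<lambda>n. u (r n)) \<longlonglongrightarrow> l"
proof -
  have K0: "K \<ge> 0" using K(1)[of 0] norm_ge_zero order_trans by blast
  define P where "P n s \<longleftrightarrow> (\<exists>N. \<forall>i\<ge>N. \<forall>j\<ge>N. (norm (u (s i) - u (s j)))\<^sup>2 < 1 / real (Suc n))" for n and s :: "nat \<Rightarrow> nat"
  interpret subseqs P
  proof
    fix n and s :: "nat \<Rightarrow> nat" assume "strict_mono s"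
    \<comment> \<open>Differences have gradient norm at most \<open>2 * K\<close>, so
      \<open>\<epsilon>\<close> times its square is at most half the tolerance; the summand 1 covers
      \<open>K = 0\<close>.\<close>
    define \<epsilon> where "\<epsilon> = 1 / real (Suc n) / (2 * (4 * K\<^sup>2 + 1))"
    have \<epsilon>: "\<epsilon> > 0" using K0 by (simp add: \<epsilon>_def add_nonneg_pos)
    obtain I :: "(int \<times> int) set" and e where I: "finite I"
      "\<And>v. v \<in> H1_0 \<Omega> \<Longrightarrow> (norm v)\<^sup>2 \<le> (\<Sum>i\<in>I. (inner v (e i))\<^sup>2) + \<epsilon> * (norm (grad \<Omega> v))\<^sup>2"
      using rellich_inequality[OF \<epsilon>] by blast
    have "\<exists>r. strict_mono r \<and> (\<forall>i\<in>J. convergent (\<lambda>k. inner (u (s (r k))) (e i)))" if "finite J" for J using that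
    proof (induction J rule: finite_induct)
      case empty
      then show ?case by (intro exI[of _ id]) (simp add: strict_mono_def)
    next
      case (insert i J)
      then obtain r where r: "strict_mono r" "\<forall>i\<in>J. convergent (\<lambda>k. inner (u (s (r k))) (e i))" by blast
      have "bounded (range (\<lambda>k. inner (u (s (r k))) (e i)))"
        unfolding bounded_iff
      proof (intro exI ballI)
        fix x assume "x \<in> range (\<lambda>k. inner (u (s (r k))) (e i))"
        then obtain k where "x = inner (u (s (r k))) (e i)" by blast
        then have "norm x \<le> norm (u (s (r k))) * norm (e i)" using Cauchy_Schwarz_ineq2 by simp
        also have "\<dots> \<le> K * norm (e i)" by (intro mult_right_mono K) auto
        finally show "norm x \<le> K * norm (e i)" .
      qed
      then obtain l q where q: "strict_mono q" "((\<lambda>k. inner (u (s (r k))) (e i)) \<circ> q) \<longlonglongrightarrow> l"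
        using bounded_imp_convergent_subsequence by blast
      have "convergent (\<lambda>k. inner (u (s ((r \<circ> q) k))) (e j))" if j: "j \<in> insert i J" for j
      proof (cases "j = i")
        case True
        then show ?thesis using q(2) by (auto simp: convergent_def o_def)
      next
        case False
        then have "convergent (\<lambda>k. inner (u (s (r k))) (e j))" using r(2) j by blast
        from convergent_subseq_convergent[OF this q(1)] show ?thesis by (simp add: o_def)
      qed
      then show ?case using strict_mono_o[OF r(1) q(1)] by blast
    qed
    then obtain r where r: "strict_mono r" "\<forall>i\<in>I. convergent (\<lambda>k. inner (u (s (r k))) (e i))" using I(1) by blast
    then obtain l where l: "\<And>i. i \<in> I \<Longrightarrow> (\<lambda>k. inner (u (s (r k))) (e i)) \<longlonglongrightarrow> l i"
      unfolding convergent_def by metis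
    \<comment> \<open>Two deviations from the limits, each entering with the factor 2, add up to
      less than \<open>4 * \<eta>\<close>, the other half of the tolerance.\<close>
    define \<eta> where "\<eta> = 1 / real (Suc n) / 8"
    have \<eta>: "\<eta> > 0" by (simp add: \<eta>_def)
    have "(\<lambda>k. \<Sum>i\<in>I. (inner (u (s (r k))) (e i) - l i)\<^sup>2) \<longlonglongrightarrow> (\<Sum>i\<in>I. (l i - l i)\<^sup>2)"
      by (intro tendsto_intros l)
    then have "\<forall>\<^sub>F k in sequentially. (\<Sum>i\<in>I. (inner (u (s (r k))) (e i) - l i)\<^sup>2) < \<eta>"
      using \<eta> by (intro order_tendstoD(2)) auto
    then obtain N where N: "\<And>k. k \<ge> N \<Longrightarrow> (\<Sum>i\<in>I. (inner (u (s (r k))) (e i) - l i)\<^sup>2) < \<eta>"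
      by (auto simp: eventually_sequentially)
    have "P n (s \<circ> r)" unfolding P_def
    proof (intro exI[of _ N] allI impI)
      fix i j assume ij: "i \<ge> N" "j \<ge> N"
      let ?v = "u (s (r i)) - u (s (r j))"
      have v: "?v \<in> H1_0 \<Omega>" using u subspace_H1_0 by (simp add: subspace_diff)
      have sq: "(x - y)\<^sup>2 \<le> 2 * (x - z)\<^sup>2 + 2 * (y - z)\<^sup>2" for x y z :: real
        using zero_le_power2[of "(x - z) + (y - z)"] by (simp add: power2_eq_square algebra_simps)
      have "(\<Sum>q\<in>I. (inner ?v (e q))\<^sup>2) \<le> (\<Sum>q\<in>I. 2 * (inner (u (s (r i))) (e q) - l q)\<^sup>2 + 2 * (inner (u (s (r j))) (e q) - l q)\<^sup>2)"
        unfolding inner_diff_left by (intro sum_mono sq)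
      also have "\<dots> = 2 * (\<Sum>q\<in>I. (inner (u (s (r i))) (e q) - l q)\<^sup>2) + 2 * (\<Sum>q\<in>I. (inner (u (s (r j))) (e q) - l q)\<^sup>2)"
        by (simp add: sum.distrib sum_distrib_left)
      also have "\<dots> < 4 * \<eta>" using N[OF ij(1)] N[OF ij(2)] by linarith
      finally have 1: "(\<Sum>q\<in>I. (inner ?v (e q))\<^sup>2) < 4 * \<eta>" .
      have "norm (grad \<Omega> ?v) \<le> 2 * K"
        using norm_triangle_ineq4[of "grad \<Omega> (u (s (r i)))" "grad \<Omega> (u (s (r j)))"] K(2)[of "s (r i)"] K(2)[of "s (r j)"]
        by (simp add: grad_diff(2)[OF H1_0_H1[OF u] H1_0_H1[OF u]])
      then have "(norm (grad \<Omega> ?v))\<^sup>2 \<le> (2 * K)\<^sup>2" by (intro power_mono) auto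
      then have "\<epsilon> * (norm (grad \<Omega> ?v))\<^sup>2 \<le> \<epsilon> * (4 * K\<^sup>2 + 1)" using \<epsilon> by (intro mult_left_mono) (auto simp: power_mult_distrib)
      also have "\<dots> = 1 / real (Suc n) / 2"
      proof -
        have "4 * K\<^sup>2 + 1 \<noteq> 0" using zero_le_power2[of K] by linarith
        moreover have "x / (2 * q) * q = x / 2" if "q \<noteq> 0" for x q :: real using that by simp
        ultimately show ?thesis unfolding \<epsilon>_def by blast
      qed
      finally have 2: "\<epsilon> * (norm (grad \<Omega> ?v))\<^sup>2 \<le> 1 / real (Suc n) / 2" .
      have "(norm ?v)\<^sup>2 < 4 * \<eta> + 1 / real (Suc n) / 2" using I(2)[OF v] 1 2 by linarith
      also have "\<dots> = 1 / real (Suc n)" by (simp add: \<eta>_def del: of_nat_Suc)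
      finally show "(norm (u ((s \<circ> r) i) - u ((s \<circ> r) j)))\<^sup>2 < 1 / real (Suc n)" by simp
    qed
    then show "\<exists>r'. strict_mono r' \<and> P n (s \<circ> r')" using r(1) by blast
  qed
  \<comment> \<open>The diagonal sequence refines the subsequence chosen for \<open>n\<close> only
    from position \<open>Suc n\<close> on, hence the shift.\<close>
  have hold: "P n (diagseq \<circ> ((+) (Suc n)))" for n
  proof (rule diagseq_holds)
    fix r s :: "nat \<Rightarrow> nat" and n assume r: "strict_mono r" and "P n s"
    then obtain N where N: "\<And>i j. i \<ge> N \<Longrightarrow> j \<ge> N \<Longrightarrow> (norm (u (s i) - u (s j)))\<^sup>2 < 1 / real (Suc n)"
      unfolding P_def by blast
    have "r i \<ge> N" if "i \<ge> N" for i using that seq_suble[OF r, of i] by linarith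
    then show "P n (s \<circ> r)" unfolding P_def using N by (intro exI[of _ N]) auto
  qed
  have "Cauchy (\<lambda>n. u (diagseq n))"
  proof (rule metric_CauchyI)
    fix e :: real assume e: "e > 0"
    then obtain n where n: "1 / real (Suc n) < e\<^sup>2" using nat_approx_posE[of "e\<^sup>2"] by auto
    obtain N where N: "\<And>i j. i \<ge> N \<Longrightarrow> j \<ge> N \<Longrightarrow>
        (norm (u (diagseq (Suc n + i)) - u (diagseq (Suc n + j))))\<^sup>2 < 1 / real (Suc n)"
      using hold[of n] unfolding P_def o_def by blast
    have "dist (u (diagseq i)) (u (diagseq j)) < e" if ij: "i \<ge> Suc n + N" "j \<ge> Suc n + N" for i j
    proof -
      have "(norm (u (diagseq i) - u (diagseq j)))\<^sup>2 < 1 / real (Suc n)"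
        using N[of "i - Suc n" "j - Suc n"] ij by (simp del: of_nat_Suc)
      then have "(dist (u (diagseq i)) (u (diagseq j)))\<^sup>2 < e\<^sup>2" using n by (simp add: dist_norm del: of_nat_Suc)
      then show ?thesis using e by (simp add: power_less_imp_less_base)
    qed
    then show "\<exists>M. \<forall>m\<ge>M. \<forall>n\<ge>M. dist (u (diagseq m)) (u (diagseq n)) < e" by blast
  qed
  then obtain l where "(\<lambda>n. u (diagseq n)) \<longlonglongrightarrow> l" using Cauchy_convergent convergent_def by blast
  then show ?thesis using subseq_diagseq by blast
qed

end

section \<open>The mixed formulation\<close>

text \<open>Injectivity is asked on the eigenspaces only: the maps to be used, \<open>coords\<close>
  and \<open>fst\<close>, are linear everywhere but forget components.\<close>

lemma kth_eigenvalue_linear_image: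
  fixes R :: "'a::real_vector \<Rightarrow> 'b::real_vector"
  assumes R: "linear R" and inj: "\<And>\<mu>. inj_on R (eigenspace X a b \<mu>)"
    and sub: "\<And>\<mu>. subspace (eigenspace X a b \<mu>)"
    and eq: "\<And>\<mu>. eigenspace X' a' b' \<mu> = R ` eigenspace X a b \<mu>"
  shows "kth_eigenvalue X' a' b' k lam \<longleftrightarrow> kth_eigenvalue X a b k lam"
proof -
  have "(\<exists>U\<in>R ` eigenspace X a b \<mu>. U \<noteq> 0) \<longleftrightarrow> (\<exists>U\<in>eigenspace X a b \<mu>. U \<noteq> 0)" for \<mu>
  proof -
    have "R U = 0 \<longleftrightarrow> U = 0" if "U \<in> eigenspace X a b \<mu>" for U
      using inj_onD[OF inj, of U 0] that subspace_0[OF sub] linear_0[OF R] by auto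
    then show ?thesis by auto
  qed
  then have ev: "eigenvalues X' a' b' = eigenvalues X a b"
    by (auto simp: eigenvalues_def eigenpair_def eq)
  have *: "dim (R ` E) = dim E \<and> (finite_dimensional (R ` E) \<longleftrightarrow> finite_dimensional E)"
    if E: "subspace E" "inj_on R E" for E
  proof -
    obtain S where S: "S \<subseteq> E" "independent S" "E \<subseteq> span S" "card S = dim E" using basis_exists[of E] by blast
    have sp: "span S = E" using S E(1) by (simp add: span_minimal subset_antisym)
    have injS: "inj_on R (span S)" using E(2) sp by simp
    have ind: "independent (R ` S)" by (rule linear_independent_injective_image[OF R S(2) injS])
    have cS: "card (R ` S) = card S" by (rule card_image) (use E(2) S(1) inj_on_subset in blast)
    have spR: "span (R ` S) = R ` E" by (simp add: linear_span_image[OF R] sp)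
    have "dim (R ` E) = card (R ` S)" using dim_eq_card[of "R ` S" "R ` E"] ind spR by (metis span_span)
    moreover have "finite S" if "finite_dimensional (R ` E)"
    proof -
      have "finite (R ` S)"
        by (rule card_independent_le_dim(1)[OF that linear_subspace_image[OF R E(1)] ind]) (use S(1) in auto)
      then show ?thesis by (rule finite_imageD) (use E(2) S(1) inj_on_subset in blast)
    qed
    then have "finite_dimensional (R ` E) \<longrightarrow> finite_dimensional E" using S(3) unfolding finite_dimensional_def by blast
    ultimately show ?thesis using cS S(4) finite_dimensional_linear_image[OF _ R] by auto
  qed
  show ?thesis unfolding kth_eigenvalue_def ev eq using *[OF sub inj] by simp
qed

lemma finite_dimensional_Times:
  assumes "finite_dimensional X" "finite_dimensional Y"
  shows "finite_dimensional (X \<times> Y)"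
proof -
  obtain S T where ST: "finite S" "X \<subseteq> span S" "finite T" "Y \<subseteq> span T"
    using assms by (auto simp: finite_dimensional_def)
  let ?F = "(\<lambda>x. (x, 0)) ` S \<union> (\<lambda>y. (0, y)) ` T"
  have l1: "linear (\<lambda>x :: 'a. (x, 0 :: 'b))" and l2: "linear (\<lambda>y :: 'b. (0 :: 'a, y))"
    by (rule linearI; simp)+
  have "X \<times> Y \<subseteq> span ?F"
  proof
    fix z assume "z \<in> X \<times> Y"
    then obtain x y where z: "z = (x, 0) + (0, y)" "x \<in> span S" "y \<in> span T" using ST by (cases z) auto
    have 1: "(x, 0 :: 'b) \<in> span ((\<lambda>x. (x, 0)) ` S)" unfolding linear_span_image[OF l1] using z(2) by simp
    have 2: "(0 :: 'a, y) \<in> span ((\<lambda>y. (0, y)) ` T)" unfolding linear_span_image[OF l2] using z(3) by simp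
    show "z \<in> span ?F"
      unfolding z(1) using subsetD[OF span_mono 1, of ?F] subsetD[OF span_mono 2, of ?F] by (intro span_add) auto
  qed
  then show ?thesis using ST unfolding finite_dimensional_def by (intro exI[of _ ?F]) auto
qed

text \<open>Meant for \<open>embed\<close>, whose linearity is available only on a subspace, because
  weak derivatives add where they exist.\<close>

lemma finite_dimensional_image_on_subspace:
  fixes f :: "'a::real_vector \<Rightarrow> 'b::real_vector"
  assumes W: "finite_dimensional W" "subspace W"
    and add: "\<And>x y. x \<in> W \<Longrightarrow> y \<in> W \<Longrightarrow> f (x + y) = f x + f y"
    and scale: "\<And>c x. x \<in> W \<Longrightarrow> f (c *\<^sub>R x) = c *\<^sub>R f x"
  shows "finite_dimensional (f ` W)"
proof -
  obtain S where S: "finite S" "span S = W" using finite_dimensional_basis[OF W] by metis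
  have f0: "f 0 = 0" using scale[of 0 0] subspace_0[OF W(2)] by simp
  have "f x \<in> span (f ` S) \<and> x \<in> W" if "x \<in> span S" for x using that
  proof (induction rule: span_induct_alt)
    case base
    then show ?case using f0 subspace_0[OF W(2)] by (simp add: span_zero)
  next
    case (step c x y)
    then have "x \<in> W" "c *\<^sub>R x \<in> W" using S W(2) by (auto intro: span_base subspace_scale)
    then show ?case using step W(2)
      by (auto simp: add scale intro: span_add span_scale span_base subspace_add)
  qed
  then have "f ` W \<subseteq> span (f ` S)" using S(2) by blast
  then show ?thesis using S(1) unfolding finite_dimensional_def by blast
qed

text \<open>
  The coordinates of \<open>energy_space\<close> are \<open>u, \<nabla>u, \<phi>, \<nabla>\<phi>, p, w, \<nabla>w\<close>, so that its norm is the
  one of the mixed space.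
\<close>

type_synonym energy_space = "plane l2 \<times> ((plane l2)^2) \<times> ((plane l2)^2) \<times> ((plane l2)^2^2) \<times>
    plane l2 \<times> plane l2 \<times> ((plane l2)^2)"

definition rot_of :: "(plane l2)^2^2 \<Rightarrow> plane l2" where
  "rot_of G = G $ 2 $ 1 - G $ 1 $ 2"

text \<open>Adjoint of \<open>rot_of\<close>; entry \<open>i\<close>, \<open>j\<close> of a gradient
  matrix is the \<open>j\<close>-th derivative of the \<open>i\<close>-th component.\<close>

definition rot_adj :: "plane l2 \<Rightarrow> (plane l2)^2^2" where
  "rot_adj p = (\<chi> i j. if i = 2 \<and> j = 1 then p else if i = 1 \<and> j = 2 then - p else 0)"

text \<open>Each slot holds the factor that \<open>a\<close> pairs with the same slot of the test
  vector: \<open>\<nabla>w\<close> with \<open>\<nabla>v\<close> and with \<open>\<psi>\<close>,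
  \<open>\<nabla>\<phi>\<close> and the pressure with \<open>\<nabla>\<psi>\<close>, the rotation
  with \<open>q\<close>, and \<open>\<nabla>u + \<phi>\<close> with
  \<open>\<nabla>s\<close>.\<close>

fun mixed_op :: "energy_space \<Rightarrow> energy_space" where
  "mixed_op (u, g, \<phi>, G, p, w, r) = (0, r, r, G + rot_adj p, rot_of G, 0, g + \<phi>)"

definition source :: "plane l2 \<Rightarrow> energy_space" where
  "source f = (f, 0, 0, 0, 0, 0, 0)"

fun coords :: "energy_space \<Rightarrow> mixed" where
  "coords (u, g, \<phi>, G, p, w, r) = (u, \<phi>, p, w)"

fun embed :: "plane set \<Rightarrow> mixed \<Rightarrow> energy_space" where
  "embed \<Omega> (u, \<phi>, p, w) = (u, grad \<Omega> u, \<phi>, Grad \<Omega> \<phi>, p, w, grad \<Omega> w)"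

lemma rot_eq: "rot \<Omega> \<phi> = rot_of (Grad \<Omega> \<phi>)"
  by (simp add: rot_def rot_of_def Grad_def grad_def)

lemma inner_rot_adj: "inner (rot_adj p) G = inner p (rot_of G)"
  by (simp add: inner_vec_def rot_adj_def rot_of_def UNIV_2 inner_diff_right)

lemma bounded_linear_rot_of: "bounded_linear rot_of"
  unfolding rot_of_def
  by (intro bounded_linear_sub bounded_linear_compose[OF bounded_linear_vec_nth bounded_linear_vec_nth])

lemma bounded_linear_rot_adj: "bounded_linear rot_adj"
proof (rule bounded_linear_intro)
  show "rot_adj (x + y) = rot_adj x + rot_adj y" for x y by (simp add: rot_adj_def vec_eq_iff)
  show "rot_adj (c *\<^sub>R x) = c *\<^sub>R rot_adj x" for c x by (simp add: rot_adj_def vec_eq_iff)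
  show "norm (rot_adj x) \<le> norm x * 2" for x
  proof (rule power2_le_imp_le)
    show "(norm (rot_adj x))\<^sup>2 \<le> (norm x * 2)\<^sup>2"
      by (simp add: norm_vec_power2 rot_adj_def UNIV_2 power_mult_distrib)
  qed simp
qed

lemma bounded_linear_mixed_op: "bounded_linear mixed_op"
proof -
  have eq: "mixed_op = (\<lambda>z. (0, snd (snd (snd (snd (snd (snd z))))), snd (snd (snd (snd (snd (snd z))))),
      fst (snd (snd (snd z))) + rot_adj (fst (snd (snd (snd (snd z))))), rot_of (fst (snd (snd (snd z)))), 0,
      fst (snd z) + fst (snd (snd z))))"
    by (rule ext) (auto simp: split_paired_all)
  show ?thesis unfolding eq
    by (intro bounded_linear_Pair bounded_linear_add bounded_linear_zero
      bounded_linear_compose[OF bounded_linear_rot_adj] bounded_linear_compose[OF bounded_linear_rot_of]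
      bounded_linear_compose[OF bounded_linear_fst] bounded_linear_compose[OF bounded_linear_snd] bounded_linear_ident)
qed

lemma mixed_op_sym: "inner (mixed_op z) z' = inner z (mixed_op z')"
proof (cases z, cases z')
  fix u g \<phi> G p w r u' g' \<phi>' G' p' w' r'
  assume z: "z = (u, g, \<phi>, G, p, w, r)" "z' = (u', g', \<phi>', G', p', w', r')"
  have "inner G (rot_adj p') = inner (rot_of G) p'" by (metis inner_commute inner_rot_adj)
  then show ?thesis
    unfolding z by (simp add: inner_add_left inner_add_right inner_rot_adj inner_commute[of r'] inner_commute[of r])
qed

lemma bounded_linear_source: "bounded_linear source"
  unfolding source_def by (intro bounded_linear_Pair bounded_linear_ident bounded_linear_zero)

lemma inner_source: "inner (source f) z = inner f (fst z)"
  by (cases z) (simp add: source_def)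

lemma linear_coords: "linear coords"
  by (rule linearI) (auto simp: split_paired_all)

lemma coords_embed [simp]: "coords (embed \<Omega> U) = U"
  by (cases U) simp

lemma fst_embed [simp]: "fst (embed \<Omega> U) = fst U"
  by (cases U) simp

lemma norm_embed: "norm (embed \<Omega> U) = mixed_norm \<Omega> U"
proof (cases U)
  case (fields u \<phi> p w)
  have "norm (embed \<Omega> U) = sqrt ((norm (embed \<Omega> U))\<^sup>2)" by simp
  also have "(norm (embed \<Omega> U))\<^sup>2 = (H1_norm \<Omega> u)\<^sup>2 + (H1_vec_norm \<Omega> \<phi>)\<^sup>2 + (norm p)\<^sup>2 + (H1_norm \<Omega> w)\<^sup>2"
    by (simp add: fields norm_Pair H1_norm_def H1_vec_norm_def add_ac)
  finally show ?thesis by (simp add: fields)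
qed

lemma mixed_a_eq: "mixed_a \<Omega> U W = inner (mixed_op (embed \<Omega> U)) (embed \<Omega> W)"
proof (cases U, cases W)
  fix u \<phi> p w v \<psi> q s
  assume UW: "U = (u, \<phi>, p, w)" "W = (v, \<psi>, q, s)"
  show ?thesis unfolding UW by (simp add: rot_eq inner_add_left inner_rot_adj)
qed

lemma mixed_b_eq: "mixed_b U W = inner (fst U) (fst W)"
  by (cases U, cases W) simp

context planar_domain
begin

lemma grad_0: "grad \<Omega> 0 = 0" "0 \<in> H1 \<Omega>"
  using gradI[of 0 0] subspace_L2 by (auto simp: has_weak_deriv_def subspace_0)

lemma Grad_0: "Grad \<Omega> 0 = 0"
  by (simp add: Grad_def vec_eq_iff grad_0)

lemma H1_0_vec_H1: "\<phi> \<in> H1_0_vec \<Omega> \<Longrightarrow> \<phi> $ i \<in> H1 \<Omega>"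
  by (simp add: H1_0_vec_def H1_0_H1)

lemma subspace_H1_0_vec: "subspace (H1_0_vec \<Omega>)"
  using subspace_H1_0 by (auto simp: H1_0_vec_def subspace_def)

lemma Grad_add: "\<phi> \<in> H1_0_vec \<Omega> \<Longrightarrow> \<psi> \<in> H1_0_vec \<Omega> \<Longrightarrow> Grad \<Omega> (\<phi> + \<psi>) = Grad \<Omega> \<phi> + Grad \<Omega> \<psi>"
  by (simp add: Grad_def vec_eq_iff grad_add H1_0_vec_H1)

lemma Grad_scaleR: "\<phi> \<in> H1_0_vec \<Omega> \<Longrightarrow> Grad \<Omega> (c *\<^sub>R \<phi>) = c *\<^sub>R Grad \<Omega> \<phi>"
  by (simp add: Grad_def vec_eq_iff grad_scaleR H1_0_vec_H1)

lemma subspace_mixed_space: "subspace (mixed_space \<Omega>)"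
  unfolding mixed_space_def
  by (intro subspace_Times subspace_H1_0 subspace_H1_0_vec subspace_L2_0)

lemma embed_add: "U \<in> mixed_space \<Omega> \<Longrightarrow> W \<in> mixed_space \<Omega> \<Longrightarrow> embed \<Omega> (U + W) = embed \<Omega> U + embed \<Omega> W"
  by (cases U, cases W) (simp add: mixed_space_def grad_add H1_0_H1 Grad_add)

lemma embed_scaleR: "U \<in> mixed_space \<Omega> \<Longrightarrow> embed \<Omega> (c *\<^sub>R U) = c *\<^sub>R embed \<Omega> U"
  by (cases U) (simp add: mixed_space_def grad_scaleR H1_0_H1 Grad_scaleR)

lemma embed_diff:
  assumes "U \<in> mixed_space \<Omega>" "W \<in> mixed_space \<Omega>"
  shows "embed \<Omega> (U - W) = embed \<Omega> U - embed \<Omega> W"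
proof -
  have "(-1) *\<^sub>R W \<in> mixed_space \<Omega>" by (rule subspace_scale[OF subspace_mixed_space assms(2)])
  from embed_add[OF assms(1) this] embed_scaleR[OF assms(2), of "-1"] show ?thesis by simp
qed

lemma subspace_embed:
  assumes "subspace S" "S \<subseteq> mixed_space \<Omega>" shows "subspace (embed \<Omega> ` S)"
  unfolding subspace_def
proof (intro conjI ballI allI)
  have "embed \<Omega> 0 = 0" using embed_scaleR[of 0 0] subspace_0[OF subspace_mixed_space] by simp
  then show "0 \<in> embed \<Omega> ` S" using subspace_0[OF assms(1)] by (metis imageI)
next
  fix x y assume "x \<in> embed \<Omega> ` S" "y \<in> embed \<Omega> ` S"
  then obtain U W where UW: "U \<in> S" "W \<in> S" "x = embed \<Omega> U" "y = embed \<Omega> W" by blast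
  then have "x + y = embed \<Omega> (U + W)" using assms(2) by (simp add: embed_add subsetD)
  then show "x + y \<in> embed \<Omega> ` S" using subspace_add[OF assms(1) UW(1,2)] by blast
next
  fix c x assume "x \<in> embed \<Omega> ` S"
  then obtain U where U: "U \<in> S" "x = embed \<Omega> U" by blast
  then have "c *\<^sub>R x = embed \<Omega> (c *\<^sub>R U)" using assms(2) by (simp add: embed_scaleR subsetD)
  then show "c *\<^sub>R x \<in> embed \<Omega> ` S" using subspace_scale[OF assms(1) U(1)] by blast
qed

text \<open>The slots for gradients are tied to those for functions by the closed graph of
  \<open>H1_0 \<Omega>\<close>, so the range is cut out by closed conditions on continuous
  projections.\<close>

lemma closed_embed: "closed (embed \<Omega> ` mixed_space \<Omega>)"
proof -
  let ?K = "closure test_graphs"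
  let ?S = "{z :: energy_space. (fst z, fst (snd z)) \<in> ?K \<and>
      (\<forall>i. (fst (snd (snd z)) $ i, fst (snd (snd (snd z))) $ i) \<in> ?K) \<and>
      fst (snd (snd (snd (snd z)))) \<in> L2_0 \<Omega> \<and>
      (fst (snd (snd (snd (snd (snd z))))), snd (snd (snd (snd (snd (snd z)))))) \<in> ?K}"
  have K: "(u, g) \<in> ?K \<longleftrightarrow> u \<in> H1_0 \<Omega> \<and> g = grad \<Omega> u" for u g
    unfolding graph_H1_0[symmetric] by (auto simp: graph_def)
  have "embed \<Omega> ` mixed_space \<Omega> = ?S"
  proof (intro set_eqI iffI)
    fix z assume "z \<in> embed \<Omega> ` mixed_space \<Omega>"
    then show "z \<in> ?S" by (auto simp: mixed_space_def K H1_0_vec_def Grad_def)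
  next
    fix z assume z: "z \<in> ?S"
    obtain u g \<phi> G p w r where zz: "z = (u, g, \<phi>, G, p, w, r)" by (metis prod.collapse)
    have "(u, \<phi>, p, w) \<in> mixed_space \<Omega>" using z unfolding zz by (auto simp: mixed_space_def K H1_0_vec_def)
    moreover have "z = embed \<Omega> (u, \<phi>, p, w)" using z unfolding zz by (auto simp: K Grad_def vec_eq_iff)
    ultimately show "z \<in> embed \<Omega> ` mixed_space \<Omega>" by blast
  qed
  moreover have "closed ?S"
  proof -
    have c: "closed {z. f z \<in> S}" if "continuous_on UNIV f" "closed S" for f :: "energy_space \<Rightarrow> 'b::topological_space" and S
      using closed_vimage[OF that(2,1)] by (simp add: vimage_def)
    show ?thesis
      by (intro closed_Collect_conj closed_Collect_all c continuous_intros closed_closure closed_L2_0)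
  qed
  ultimately show ?thesis by simp
qed

lemma poincare_norms:
  obtains K where "K \<ge> 1" "\<And>u. u \<in> H1_0 \<Omega> \<Longrightarrow> H1_norm \<Omega> u \<le> K * norm (grad \<Omega> u)"
    "\<And>\<phi>. \<phi> \<in> H1_0_vec \<Omega> \<Longrightarrow> H1_vec_norm \<Omega> \<phi> \<le> K * norm (Grad \<Omega> \<phi>)"
proof -
  obtain R where R: "R \<ge> 0" "\<And>u. u \<in> H1_0 \<Omega> \<Longrightarrow> norm u \<le> R * norm (grad \<Omega> u)" using poincare by blast
  have le: "sqrt (x\<^sup>2 + y\<^sup>2) \<le> (R + 1) * y" if "x\<^sup>2 \<le> (R * y)\<^sup>2" "y \<ge> 0" for x y
  proof (rule real_le_lsqrt)
    have "2 * (R * (y * y)) \<ge> 0" using R(1) that(2) by simp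
    then show "x\<^sup>2 + y\<^sup>2 \<le> ((R + 1) * y)\<^sup>2" using that(1) by (simp add: power2_eq_square algebra_simps)
  qed (use R(1) that(2) in auto)
  show ?thesis
  proof
    show "1 \<le> R + 1" using R(1) by simp
    show "H1_norm \<Omega> u \<le> (R + 1) * norm (grad \<Omega> u)" if "u \<in> H1_0 \<Omega>" for u
      unfolding H1_norm_def using R(2)[OF that] by (intro le power_mono) auto
    show "H1_vec_norm \<Omega> \<phi> \<le> (R + 1) * norm (Grad \<Omega> \<phi>)" if "\<phi> \<in> H1_0_vec \<Omega>" for \<phi>
      unfolding H1_vec_norm_def
    proof (rule le)
      have "(norm (\<phi> $ i))\<^sup>2 \<le> R\<^sup>2 * (norm (grad \<Omega> (\<phi> $ i)))\<^sup>2" for i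
        using R(2)[of "\<phi> $ i"] that by (simp add: H1_0_vec_def power_mono flip: power_mult_distrib)
      then have "(\<Sum>i\<in>UNIV. (norm (\<phi> $ i))\<^sup>2) \<le> (\<Sum>i\<in>UNIV. R\<^sup>2 * (norm (grad \<Omega> (\<phi> $ i)))\<^sup>2)"
        by (intro sum_mono) auto
      moreover have "(norm (Grad \<Omega> \<phi>))\<^sup>2 = (\<Sum>i\<in>UNIV. (norm (grad \<Omega> (\<phi> $ i)))\<^sup>2)"
        by (subst norm_vec_power2) (simp add: Grad_def)
      ultimately show "(norm \<phi>)\<^sup>2 \<le> (R * norm (Grad \<Omega> \<phi>))\<^sup>2"
        by (simp add: norm_vec_power2[of \<phi>] power_mult_distrib sum_distrib_left)
    qed simp
  qed
qed

lemma grad_eq_0: "u \<in> H1_0 \<Omega> \<Longrightarrow> grad \<Omega> u = 0 \<Longrightarrow> u = 0"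
  using poincare by fastforce

lemma Grad_eq_0:
  assumes "\<phi> \<in> H1_0_vec \<Omega>" "Grad \<Omega> \<phi> = 0" shows "\<phi> = 0"
proof -
  have "\<phi> $ i = 0" for i
    by (rule grad_eq_0) (use assms in \<open>auto simp: H1_0_vec_def Grad_def vec_eq_iff\<close>)
  then show ?thesis by (simp add: vec_eq_iff)
qed

lemma norm_le_H1_vec_norm: "norm \<phi> \<le> H1_vec_norm \<Omega> \<phi>" "norm (Grad \<Omega> \<phi>) \<le> H1_vec_norm \<Omega> \<phi>"
  by (auto simp: H1_vec_norm_def intro!: real_le_rsqrt)

lemma mixed_norm_le: "mixed_norm \<Omega> (u, \<phi>, p, w) \<le> H1_norm \<Omega> u + H1_vec_norm \<Omega> \<phi> + norm p + H1_norm \<Omega> w"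
proof -
  have nn: "0 \<le> H1_norm \<Omega> u" "0 \<le> H1_vec_norm \<Omega> \<phi>" "0 \<le> H1_norm \<Omega> w"
    by (auto simp: H1_norm_def H1_vec_norm_def)
  have "sqrt (a\<^sup>2 + b\<^sup>2 + c\<^sup>2 + d\<^sup>2) \<le> a + b + c + d" if "a \<ge> 0" "b \<ge> 0" "c \<ge> 0" "d \<ge> 0" for a b c d :: real
  proof (rule real_le_lsqrt)
    have "0 \<le> a * b + a * c + a * d + b * c + b * d + c * d" using that by simp
    then show "a\<^sup>2 + b\<^sup>2 + c\<^sup>2 + d\<^sup>2 \<le> (a + b + c + d)\<^sup>2" by (simp add: power2_eq_square algebra_simps)
  qed (use that in auto)
  from this[OF nn(1,2) norm_ge_zero nn(3)] show ?thesis by simp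
qed

lemma mixed_norm_components:
  "mixed_norm \<Omega> (0, 0, 0, w) = H1_norm \<Omega> w" "mixed_norm \<Omega> (u, 0, 0, 0) = H1_norm \<Omega> u"
  "mixed_norm \<Omega> (0, \<psi>, 0, 0) = H1_vec_norm \<Omega> \<psi>"
  by (simp_all add: H1_norm_def H1_vec_norm_def grad_0 Grad_0)

text \<open>
  Testing successively with \<open>(w, 0, 0, 0)\<close>, the velocity from the inf-sup condition for \<open>p\<close>,
  \<open>(0, \<phi>, - p, 0)\<close> and \<open>(0, 0, 0, u)\<close> bounds \<open>\<nabla>w\<close>, \<open>p\<close>, \<open>\<nabla>\<phi>\<close> and \<open>\<nabla>u\<close>.
\<close>

lemma discrete_stability:
  assumes c: "c > 0"
  obtains C where "C > 0" "\<And>X \<Psi> Q U \<eta>. \<lbrakk>subspace X; subspace \<Psi>; subspace Q; X \<subseteq> H1_0 \<Omega>; \<Psi> \<subseteq> H1_0_vec \<Omega>;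
     \<And>q. q \<in> Q - {0} \<Longrightarrow> \<exists>\<psi>\<in>\<Psi>. 0 < norm (Grad \<Omega> \<psi>) \<and> c * (norm (Grad \<Omega> \<psi>) * norm q) \<le> inner (rot \<Omega> \<psi>) q;
     U \<in> X \<times> \<Psi> \<times> Q \<times> X; 0 \<le> \<eta>; \<And>W. W \<in> X \<times> \<Psi> \<times> Q \<times> X \<Longrightarrow> mixed_a \<Omega> U W \<le> \<eta> * mixed_norm \<Omega> W\<rbrakk>
     \<Longrightarrow> mixed_norm \<Omega> U \<le> C * \<eta>"
proof -
  obtain K where K: "K \<ge> 1" "\<And>u. u \<in> H1_0 \<Omega> \<Longrightarrow> H1_norm \<Omega> u \<le> K * norm (grad \<Omega> u)"
    "\<And>\<phi>. \<phi> \<in> H1_0_vec \<Omega> \<Longrightarrow> H1_vec_norm \<Omega> \<phi> \<le> K * norm (Grad \<Omega> \<phi>)" using poincare_norms by blast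
  \<comment> \<open>\<open>D\<close> is chosen to bring the estimate for \<open>x\<close>, the norm
    of \<open>\<nabla>\<phi>\<close>, into the form
    \<open>x\<^sup>2 \<le> D \<eta> x + (D \<eta>)\<^sup>2\<close>; \<open>P\<close> results from
    inserting \<open>x \<le> 2 D \<eta>\<close> into the bound for
    \<open>c * norm p\<close>.\<close>
  define D where "D = 2 * K\<^sup>2 + 1 / c"
  define P where "P = (2 * K\<^sup>2 + 2 * D) / c"
  define C where "C = K * (K + K * (2 * D)) + K * (2 * D) + P + K * K"
  have D: "D > 0" using K(1) c by (simp add: D_def add_pos_pos)
  have P: "P > 0" using K(1) c D by (simp add: P_def add_pos_pos)
  have KK: "K \<le> K\<^sup>2" "1 \<le> K\<^sup>2" using K(1) by (auto simp: power2_eq_square mult_le_cancel_left1 intro: order_trans)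
  show ?thesis
  proof
    show "C > 0" unfolding C_def using K(1) D P by (intro add_pos_pos add_nonneg_pos) auto
    fix X \<Psi> Q U \<eta>
    assume sub: "subspace X" "subspace \<Psi>" "subspace Q" and in_H: "X \<subseteq> H1_0 \<Omega>" "\<Psi> \<subseteq> H1_0_vec \<Omega>"
      and infsup: "\<And>q. q \<in> Q - {0} \<Longrightarrow> \<exists>\<psi>\<in>\<Psi>. 0 < norm (Grad \<Omega> \<psi>) \<and> c * (norm (Grad \<Omega> \<psi>) * norm q) \<le> inner (rot \<Omega> \<psi>) q"
      and U: "U \<in> X \<times> \<Psi> \<times> Q \<times> X" and \<eta>: "0 \<le> \<eta>"
      and bd: "\<And>W. W \<in> X \<times> \<Psi> \<times> Q \<times> X \<Longrightarrow> mixed_a \<Omega> U W \<le> \<eta> * mixed_norm \<Omega> W"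
    obtain u \<phi> p w where UU: "U = (u, \<phi>, p, w)" "u \<in> X" "\<phi> \<in> \<Psi>" "p \<in> Q" "w \<in> X" using U by (cases U) auto
    have z: "0 \<in> X" "0 \<in> \<Psi>" "0 \<in> Q" using sub subspace_0 by blast+
    have rot0: "rot \<Omega> 0 = 0" by (simp add: rot_eq Grad_0 rot_of_def)
    let ?w = "norm (grad \<Omega> w)" and ?x = "norm (Grad \<Omega> \<phi>)" and ?p = "norm p" and ?u = "norm (grad \<Omega> u)"
    have cancel: "x \<le> y" if "x\<^sup>2 \<le> y * x" "0 \<le> x" "0 \<le> y" for x y :: real
      using that by (cases "x = 0") (auto simp: power2_eq_square)
    \<comment> \<open>\<open>w\<close> is admissible in the first slot of a test vector because the
      first and fourth factors are the same space.\<close>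
    have w: "?w \<le> K * \<eta>"
    proof (rule cancel)
      have "?w\<^sup>2 = mixed_a \<Omega> U (w, 0, 0, 0)"
        by (simp add: UU grad_0 Grad_0 rot0 power2_norm_eq_inner)
      also have "\<dots> \<le> \<eta> * mixed_norm \<Omega> (w, 0, 0, 0)" using UU z by (intro bd) auto
      also have "mixed_norm \<Omega> (w, 0, 0, 0) = H1_norm \<Omega> w" by (rule mixed_norm_components)
      also have "\<eta> * H1_norm \<Omega> w \<le> \<eta> * (K * ?w)" using UU in_H \<eta> by (intro mult_left_mono K(2)) auto
      finally show "?w\<^sup>2 \<le> K * \<eta> * ?w" by (simp add: mult_ac)
    qed (use K(1) \<eta> in auto)
    have p: "c * ?p \<le> 2 * K\<^sup>2 * \<eta> + ?x"
    proof (cases "p = 0")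
      case True
      then show ?thesis using \<eta> by simp
    next
      case False
      then obtain \<psi> where \<psi>: "\<psi> \<in> \<Psi>" "0 < norm (Grad \<Omega> \<psi>)" "c * (norm (Grad \<Omega> \<psi>) * ?p) \<le> inner (rot \<Omega> \<psi>) p"
        using infsup[of p] UU by blast
      let ?g = "norm (Grad \<Omega> \<psi>)"
      have H: "\<psi> \<in> H1_0_vec \<Omega>" using \<psi>(1) in_H by blast
      have "inner (rot \<Omega> \<psi>) p = mixed_a \<Omega> U (0, \<psi>, 0, 0) - inner (Grad \<Omega> \<phi>) (Grad \<Omega> \<psi>) - inner (grad \<Omega> w) \<psi>"
        by (simp add: UU grad_0 inner_commute)
      also have "\<dots> \<le> \<eta> * (K * ?g) + ?x * ?g + (K * \<eta>) * (K * ?g)"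
      proof -
        have "mixed_a \<Omega> U (0, \<psi>, 0, 0) \<le> \<eta> * mixed_norm \<Omega> (0, \<psi>, 0, 0)" using \<psi> z by (intro bd) auto
        also have "\<dots> \<le> \<eta> * (K * ?g)" unfolding mixed_norm_components using \<eta> by (intro mult_left_mono K(3) H)
        finally have 1: "mixed_a \<Omega> U (0, \<psi>, 0, 0) \<le> \<eta> * (K * ?g)" .
        have 2: "- inner (Grad \<Omega> \<phi>) (Grad \<Omega> \<psi>) \<le> ?x * ?g"
          using Cauchy_Schwarz_ineq2[of "Grad \<Omega> \<phi>" "Grad \<Omega> \<psi>"] by linarith
        have "- inner (grad \<Omega> w) \<psi> \<le> ?w * norm \<psi>" using Cauchy_Schwarz_ineq2[of "grad \<Omega> w" \<psi>] by linarith
        also have "\<dots> \<le> (K * \<eta>) * (K * ?g)"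
          using w K(1) \<eta> norm_le_H1_vec_norm(1)[of \<psi>] K(3)[OF H] by (intro mult_mono) auto
        finally show ?thesis using 1 2 by linarith
      qed
      finally have "(c * ?p) * ?g \<le> (\<eta> * K + ?x + K\<^sup>2 * \<eta>) * ?g"
        using \<psi>(3) by (simp add: algebra_simps power2_eq_square)
      then have "c * ?p \<le> \<eta> * K + ?x + K\<^sup>2 * \<eta>" using \<psi>(2) by simp
      moreover have "\<eta> * K \<le> K\<^sup>2 * \<eta>" using mult_left_mono[OF KK(1) \<eta>] by (simp add: mult.commute)
      ultimately show ?thesis by (simp add: algebra_simps)
    qed
    have H\<phi>: "\<phi> \<in> H1_0_vec \<Omega>" using UU in_H by blast
    have x: "?x \<le> 2 * D * \<eta>"
    proof -
      \<comment> \<open>The sign of \<open>- p\<close> makes the two terms with the rotation of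
        \<open>\<phi>\<close> cancel.\<close>
      have "?x\<^sup>2 = mixed_a \<Omega> U (0, \<phi>, - p, 0) - inner (grad \<Omega> w) \<phi>"
        by (simp add: UU grad_0 power2_norm_eq_inner inner_commute)
      also have "\<dots> \<le> \<eta> * (K * ?x + ?p) + (K * \<eta>) * (K * ?x)"
      proof -
        have "mixed_a \<Omega> U (0, \<phi>, - p, 0) \<le> \<eta> * mixed_norm \<Omega> (0, \<phi>, - p, 0)"
          using UU z sub by (intro bd) (auto intro: subspace_neg)
        also have "\<dots> \<le> \<eta> * (K * ?x + ?p)"
          using mixed_norm_le[of 0 \<phi> "- p" 0] K(3)[OF H\<phi>] \<eta>
          by (intro mult_left_mono) (auto simp: H1_norm_def grad_0)
        finally have 1: "mixed_a \<Omega> U (0, \<phi>, - p, 0) \<le> \<eta> * (K * ?x + ?p)" .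
        have "- inner (grad \<Omega> w) \<phi> \<le> ?w * norm \<phi>" using Cauchy_Schwarz_ineq2[of "grad \<Omega> w" \<phi>] by linarith
        also have "\<dots> \<le> (K * \<eta>) * (K * ?x)"
          using w K(1) \<eta> norm_le_H1_vec_norm(1)[of \<phi>] K(3)[OF H\<phi>] by (intro mult_mono) auto
        finally show ?thesis using 1 by linarith
      qed
      also have "\<dots> \<le> D * \<eta> * ?x + (D * \<eta>)\<^sup>2"
      proof -
        have "?p \<le> (2 * K\<^sup>2 * \<eta> + ?x) / c" using p c by (simp add: field_simps)
        then have "\<eta> * ?p \<le> \<eta> * ((2 * K\<^sup>2 * \<eta> + ?x) / c)" using \<eta> by (intro mult_left_mono)
        moreover have "\<eta> * (K * ?x) \<le> \<eta> * (K\<^sup>2 * ?x)" using KK \<eta> by (intro mult_left_mono mult_right_mono) auto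
        moreover have "\<eta> * ((2 * K\<^sup>2 * \<eta> + ?x) / c) = (2 * K\<^sup>2 * (1 / c)) * \<eta>\<^sup>2 + (1 / c) * \<eta> * ?x"
          using c by (simp add: field_simps power2_eq_square)
        moreover have "(2 * K\<^sup>2 * (1 / c)) * \<eta>\<^sup>2 \<le> (D * \<eta>)\<^sup>2"
        proof -
          define k where "k = 2 * K\<^sup>2" define d where "d = 1 / c"
          have kd: "k \<ge> 0" "d \<ge> 0" using c by (auto simp: k_def d_def)
          have "k * d \<le> (k + d)\<^sup>2" using kd mult_nonneg_nonneg[OF kd] by (simp add: power2_sum)
          then have "(k * d) * \<eta>\<^sup>2 \<le> (k + d)\<^sup>2 * \<eta>\<^sup>2" by (rule mult_right_mono) simp
          then show ?thesis by (simp add: D_def k_def d_def power_mult_distrib)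
        qed
        moreover have "D * \<eta> * ?x = 2 * (\<eta> * (K\<^sup>2 * ?x)) + (1 / c) * \<eta> * ?x" by (simp add: D_def algebra_simps)
        moreover have "(K * \<eta>) * (K * ?x) = \<eta> * (K\<^sup>2 * ?x)" by (simp add: power2_eq_square mult_ac)
        ultimately show ?thesis unfolding distrib_left[of \<eta>] by linarith
      qed
      finally have q: "?x\<^sup>2 \<le> D * \<eta> * ?x + (D * \<eta>)\<^sup>2" .
      show ?thesis
      \<comment> \<open>The inequality \<open>q\<close> bounds \<open>x\<close> by the golden ratio
        times \<open>D * \<eta>\<close>; the factor 2 is a convenient larger number.\<close>
      proof (rule ccontr)
        assume "\<not> ?thesis"
        then have gt: "?x > 2 * (D * \<eta>)" by simp
        define y where "y = D * \<eta>"
        have y: "y \<ge> 0" "?x > 2 * y" "?x\<^sup>2 \<le> y * ?x + y\<^sup>2" using q gt D \<eta> by (auto simp: y_def)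
        have "0 < ?x * (?x - 2 * y)" using y by (intro mult_pos_pos) auto
        moreover have "0 \<le> y * (?x - y)" using y by (intro mult_nonneg_nonneg) auto
        ultimately show False using y(3) by (simp add: power2_eq_square algebra_simps)
      qed
    qed
    have p': "?p \<le> P * \<eta>"
    proof -
      have "c * ?p \<le> (2 * K\<^sup>2 + 2 * D) * \<eta>" using p x by (simp add: algebra_simps)
      then show ?thesis using c by (simp add: P_def field_simps)
    qed
    have u: "?u \<le> K * \<eta> + K * (2 * D * \<eta>)"
    proof (rule cancel)
      have "?u\<^sup>2 = mixed_a \<Omega> U (0, 0, 0, u) - inner \<phi> (grad \<Omega> u)"
        by (simp add: UU grad_0 Grad_0 rot0 power2_norm_eq_inner)
      also have "\<dots> \<le> \<eta> * (K * ?u) + (K * (2 * D * \<eta>)) * ?u"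
      proof -
        have "mixed_a \<Omega> U (0, 0, 0, u) \<le> \<eta> * mixed_norm \<Omega> (0, 0, 0, u)" using UU z by (intro bd) auto
        also have "\<dots> \<le> \<eta> * (K * ?u)" unfolding mixed_norm_components using UU in_H \<eta> by (intro mult_left_mono K(2)) auto
        finally have 1: "mixed_a \<Omega> U (0, 0, 0, u) \<le> \<eta> * (K * ?u)" .
        have "norm \<phi> \<le> K * ?x" using norm_le_H1_vec_norm(1)[of \<phi>] K(3)[OF H\<phi>] by linarith
        also have "\<dots> \<le> K * (2 * D * \<eta>)" using x K(1) by (intro mult_left_mono) auto
        finally have "norm \<phi> * ?u \<le> (K * (2 * D * \<eta>)) * ?u" by (rule mult_right_mono) simp
        then show ?thesis using 1 Cauchy_Schwarz_ineq2[of \<phi> "grad \<Omega> u"] by linarith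
      qed
      finally show "?u\<^sup>2 \<le> (K * \<eta> + K * (2 * D * \<eta>)) * ?u" by (simp add: algebra_simps)
    qed (use K(1) \<eta> D in auto)
    have "mixed_norm \<Omega> U \<le> H1_norm \<Omega> u + H1_vec_norm \<Omega> \<phi> + ?p + H1_norm \<Omega> w"
      unfolding UU(1) by (rule mixed_norm_le)
    also have "\<dots> \<le> K * ?u + K * ?x + ?p + K * ?w"
      using UU in_H by (intro add_mono K H\<phi>) auto
    also have "\<dots> \<le> K * (K * \<eta> + K * (2 * D * \<eta>)) + K * (2 * D * \<eta>) + P * \<eta> + K * (K * \<eta>)"
      using K(1) by (intro add_mono mult_left_mono u x p' w) auto
    also have "\<dots> = C * \<eta>" by (simp add: C_def algebra_simps)
    finally show "mixed_norm \<Omega> U \<le> C * \<eta>" .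
  qed
qed

text \<open>The tests \<open>(0, 0, 0, w)\<close> and \<open>(0, 0, p, 0)\<close> have zero first
  component, so the load does not see them; they remove every term of \<open>a(U, U)\<close> except
  the squared norm of \<open>\<nabla>\<phi>\<close>.\<close>

lemma mixed_a_nonneg:
  assumes "0 \<in> X" "0 \<in> \<Psi>" "0 \<in> Q" and U: "U \<in> X \<times> \<Psi> \<times> Q \<times> X"
    and eq: "\<And>W. W \<in> X \<times> \<Psi> \<times> Q \<times> X \<Longrightarrow> mixed_a \<Omega> U W = inner f (fst W)"
  shows "0 \<le> mixed_a \<Omega> U U"
proof -
  obtain u \<phi> p w where UU: "U = (u, \<phi>, p, w)" "u \<in> X" "\<phi> \<in> \<Psi>" "p \<in> Q" "w \<in> X" using U by (cases U) auto
  have rot0: "rot \<Omega> 0 = 0" by (simp add: rot_eq Grad_0 rot_of_def)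
  have "inner (grad \<Omega> u) (grad \<Omega> w) + inner \<phi> (grad \<Omega> w) = 0"
    using eq[of "(0, 0, 0, w)"] UU assms(1-3) by (simp add: grad_0 Grad_0 rot0)
  moreover have "inner (rot \<Omega> \<phi>) p = 0"
    using eq[of "(0, 0, p, 0)"] UU assms(1-3) by (simp add: grad_0 Grad_0 rot0)
  ultimately have "mixed_a \<Omega> U U = inner (Grad \<Omega> \<phi>) (Grad \<Omega> \<phi>)"
    by (simp add: UU inner_commute[of "grad \<Omega> w"] inner_commute[of p])
  then show ?thesis by simp
qed

text \<open>The hypothesis on rotation-free fields identifies gradients; the Poincare inequality
  recovers the function itself. That \<open>H2_0 \<Omega>\<close> lies in
  \<open>H1_0 \<Omega>\<close> follows from the comparison of the norms.\<close>

lemma H2_0_iff: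
  assumes rot_free: "grad \<Omega> ` H2_0 \<Omega> = {\<psi> \<in> H1_0_vec \<Omega>. rot \<Omega> \<psi> = 0}"
  shows "v \<in> H2_0 \<Omega> \<longleftrightarrow> v \<in> H1_0 \<Omega> \<and> grad \<Omega> v \<in> H1_0_vec \<Omega> \<and> rot \<Omega> (grad \<Omega> v) = 0"
proof -
  have sub: "H2_0 \<Omega> \<subseteq> H1_0 \<Omega>"
  proof
    fix u assume u: "u \<in> H2_0 \<Omega>"
    have "\<exists>\<phi>. test_function \<Omega> \<phi> \<and> H1_norm \<Omega> (u - abs_l2 \<phi>) < e" if e: "e > 0" for e
    proof -
      obtain \<phi> where \<phi>: "test_function \<Omega> \<phi>" "H2_norm \<Omega> (u - abs_l2 \<phi>) < e" using u e unfolding H2_0_def by blast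
      have "H1_norm \<Omega> (u - abs_l2 \<phi>) \<le> H2_norm \<Omega> (u - abs_l2 \<phi>)" by (simp add: H1_norm_def H2_norm_def)
      then show ?thesis using \<phi> by force
    qed
    then show "u \<in> H1_0 \<Omega>" using u by (simp add: H1_0_def H2_0_def H2_def)
  qed
  show ?thesis
  proof
    assume "v \<in> H2_0 \<Omega>"
    then show "v \<in> H1_0 \<Omega> \<and> grad \<Omega> v \<in> H1_0_vec \<Omega> \<and> rot \<Omega> (grad \<Omega> v) = 0" using sub rot_free by blast
  next
    assume v: "v \<in> H1_0 \<Omega> \<and> grad \<Omega> v \<in> H1_0_vec \<Omega> \<and> rot \<Omega> (grad \<Omega> v) = 0"
    then have "grad \<Omega> v \<in> grad \<Omega> ` H2_0 \<Omega>" using rot_free by blast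
    then obtain z where z: "z \<in> H2_0 \<Omega>" "grad \<Omega> v = grad \<Omega> z" by blast
    have "v - z = 0"
    proof (rule grad_eq_0)
      show "v - z \<in> H1_0 \<Omega>" using v z sub subspace_H1_0 by (auto intro: subspace_diff)
      show "grad \<Omega> (v - z) = 0" using v z sub by (subst grad_diff) (auto intro: H1_0_H1)
    qed
    then show "v \<in> H2_0 \<Omega>" using z by simp
  qed
qed

text \<open>The mixed source problem encodes \<open>\<phi> = - \<nabla>u\<close>.\<close>

lemma mixed_solution_biharmonic:
  assumes rot_free: "grad \<Omega> ` H2_0 \<Omega> = {\<psi> \<in> H1_0_vec \<Omega>. rot \<Omega> \<psi> = 0}"
    and U: "U \<in> mixed_space \<Omega>" and eq: "\<And>W. W \<in> mixed_space \<Omega> \<Longrightarrow> mixed_a \<Omega> U W = inner f (fst W)"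
  shows "fst U \<in> H2_0 \<Omega>" "\<And>v. v \<in> H2_0 \<Omega> \<Longrightarrow> biharmonic_form \<Omega> (fst U) v = inner f v"
proof -
  note iff = H2_0_iff[OF rot_free]
  obtain u \<phi> p w where UU: "U = (u, \<phi>, p, w)" "u \<in> H1_0 \<Omega>" "\<phi> \<in> H1_0_vec \<Omega>" "p \<in> L2_0 \<Omega>" "w \<in> H1_0 \<Omega>"
    using U by (cases U) (auto simp: mixed_space_def)
  have z: "0 \<in> H1_0 \<Omega>" "0 \<in> H1_0_vec \<Omega>" "0 \<in> L2_0 \<Omega>"
    using subspace_H1_0 subspace_H1_0_vec subspace_L2_0 subspace_0 by blast+
  have rot0: "rot \<Omega> 0 = 0" by (simp add: rot_eq Grad_0 rot_of_def)
  \<comment> \<open>The rotation of \<open>\<phi>\<close> is itself an admissible test function for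
    the pressure and is thus orthogonal to itself.\<close>
  have "rot \<Omega> \<phi> \<in> L2_0 \<Omega>"
    unfolding rot_eq rot_of_def Grad_def using UU(3) subspace_L2_0
    by (auto simp: H1_0_vec_def intro!: subspace_diff grad_mean_zero)
  then have "inner (rot \<Omega> \<phi>) (rot \<Omega> \<phi>) = 0"
    using eq[of "(0, 0, rot \<Omega> \<phi>, 0)"] z by (simp add: UU(1) mixed_space_def grad_0 Grad_0 rot0)
  then have rot\<phi>: "rot \<Omega> \<phi> = 0" by simp
  then have "\<phi> \<in> grad \<Omega> ` H2_0 \<Omega>" unfolding rot_free using UU(3) by blast
  then obtain y where y: "y \<in> H2_0 \<Omega>" "\<phi> = grad \<Omega> y" by blast
  have yH: "y \<in> H1_0 \<Omega>" using y(1) iff by blast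
  \<comment> \<open>Since \<open>\<phi> = \<nabla>y\<close>, the fourth row of the system tested
    with \<open>u + y\<close> says that \<open>\<nabla>(u + y)\<close> is orthogonal to
    itself.\<close>
  have "u + y = 0"
  proof (rule grad_eq_0)
    show s: "u + y \<in> H1_0 \<Omega>" using UU(2) yH subspace_H1_0 by (simp add: subspace_add)
    have "inner (grad \<Omega> u) (grad \<Omega> (u + y)) + inner \<phi> (grad \<Omega> (u + y)) = 0"
      using eq[of "(0, 0, 0, u + y)"] s z by (simp add: UU(1) mixed_space_def grad_0 Grad_0 rot0)
    then have "inner (grad \<Omega> (u + y)) (grad \<Omega> (u + y)) = 0"
      by (simp add: y(2) grad_add(2)[OF H1_0_H1[OF UU(2)] H1_0_H1[OF yH]] inner_add_left)
    then show "grad \<Omega> (u + y) = 0" by simp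
  qed
  then have uy: "y = (-1) *\<^sub>R u" by (simp add: eq_neg_iff_add_eq_0 add.commute)
  have \<phi>u: "\<phi> = (-1) *\<^sub>R grad \<Omega> u" unfolding y(2) uy by (rule grad_scaleR(2)[OF H1_0_H1[OF UU(2)]])
  then have gu: "grad \<Omega> u = (-1) *\<^sub>R \<phi>" by simp
  have "grad \<Omega> u \<in> H1_0_vec \<Omega>" unfolding gu by (rule subspace_scale[OF subspace_H1_0_vec UU(3)])
  moreover have "rot \<Omega> (grad \<Omega> u) = 0"
    unfolding gu rot_eq Grad_scaleR[OF UU(3)] using rot\<phi> by (simp add: rot_eq rot_of_def)
  ultimately show u: "fst U \<in> H2_0 \<Omega>" using iff UU by simp
  fix v assume "v \<in> H2_0 \<Omega>"
  then have v: "v \<in> H1_0 \<Omega>" "grad \<Omega> v \<in> H1_0_vec \<Omega>" "rot \<Omega> (grad \<Omega> v) = 0" using iff by blast+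
  \<comment> \<open>For the pair \<open>(v, - \<nabla>v)\<close> the two terms with
    \<open>\<nabla>w\<close> cancel and the pressure term drops out, which leaves the biharmonic
    form.\<close>
  let ?\<psi> = "(-1) *\<^sub>R grad \<Omega> v"
  have \<psi>: "?\<psi> \<in> H1_0_vec \<Omega>" by (rule subspace_scale[OF subspace_H1_0_vec v(2)])
  have r\<psi>: "rot \<Omega> ?\<psi> = 0" unfolding rot_eq Grad_scaleR[OF v(2)] using v(3) by (simp add: rot_eq rot_of_def)
  have "mixed_a \<Omega> U (v, ?\<psi>, 0, 0) = inner f v" using eq[of "(v, ?\<psi>, 0, 0)"] v \<psi> z by (simp add: mixed_space_def)
  then have "inner (Grad \<Omega> \<phi>) (Grad \<Omega> ?\<psi>) = inner f v" unfolding UU(1) using r\<psi> by (simp add: grad_0)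
  moreover have "Grad \<Omega> (grad \<Omega> u) = (-1) *\<^sub>R Grad \<Omega> \<phi>" unfolding gu by (rule Grad_scaleR[OF UU(3)])
  ultimately show "biharmonic_form \<Omega> (fst U) v = inner f v"
    unfolding biharmonic_form_def using Grad_scaleR[OF v(2), of "-1"] by (simp add: UU(1))
qed

end

text \<open>Expressed through \<open>coords\<close>, since the transfer of
  \<open>kth_eigenvalue\<close> asks for a map that is linear on the whole type.\<close>

lemma eigenspace_embed:
  assumes "S \<subseteq> mixed_space \<Omega>"
  shows "eigenspace S (mixed_a \<Omega>) mixed_b \<mu> =
    coords ` eigenspace (embed \<Omega> ` S) (\<lambda>U W. inner (mixed_op U) W) (\<lambda>U W. inner (fst U) (fst W)) \<mu>"
proof (intro set_eqI iffI)
  fix U assume U: "U \<in> eigenspace S (mixed_a \<Omega>) mixed_b \<mu>"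
  then have "embed \<Omega> U \<in> eigenspace (embed \<Omega> ` S) (\<lambda>U W. inner (mixed_op U) W) (\<lambda>U W. inner (fst U) (fst W)) \<mu>"
    by (auto simp: eigenspace_def mixed_a_eq mixed_b_eq)
  then show "U \<in> coords ` eigenspace (embed \<Omega> ` S) (\<lambda>U W. inner (mixed_op U) W) (\<lambda>U W. inner (fst U) (fst W)) \<mu>"
    by (rule image_eqI[rotated]) simp
next
  fix U assume "U \<in> coords ` eigenspace (embed \<Omega> ` S) (\<lambda>U W. inner (mixed_op U) W) (\<lambda>U W. inner (fst U) (fst W)) \<mu>"
  then show "U \<in> eigenspace S (mixed_a \<Omega>) mixed_b \<mu>"
    by (auto simp: eigenspace_def mixed_a_eq mixed_b_eq)
qed

lemma kth_eigenvalue_embed: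
  assumes "\<And>\<mu>. subspace (eigenspace (embed \<Omega> ` S) (\<lambda>U W. inner (mixed_op U) W) (\<lambda>U W. inner (fst U) (fst W)) \<mu>)"
    and "S \<subseteq> mixed_space \<Omega>"
  shows "kth_eigenvalue S (mixed_a \<Omega>) mixed_b k lam \<longleftrightarrow>
    kth_eigenvalue (embed \<Omega> ` S) (\<lambda>U W. inner (mixed_op U) W) (\<lambda>U W. inner (fst U) (fst W)) k lam"
proof (rule kth_eigenvalue_linear_image[OF linear_coords _ assms(1) eigenspace_embed[OF assms(2)]])
  show "inj_on coords (eigenspace (embed \<Omega> ` S) (\<lambda>U W. inner (mixed_op U) W) (\<lambda>U W. inner (fst U) (fst W)) \<mu>)" for \<mu>
    by (rule inj_onI) (auto simp: eigenspace_def)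
qed

text \<open>The supremum need not be attained; giving up half of \<open>c\<close> provides an actual
  \<open>\<psi>\<close>. Its gradient is nonzero because a quotient with denominator 0 is 0 and
  cannot exceed \<open>c / 2\<close>.\<close>

lemma inf_sup_constD:
  assumes "inf_sup_const \<Omega> \<Psi> Q \<ge> ereal c" "c > 0" "q \<in> Q - {0}"
  shows "\<exists>\<psi>\<in>\<Psi>. 0 < norm (Grad \<Omega> \<psi>) \<and> (c / 2) * (norm (Grad \<Omega> \<psi>) * norm q) \<le> inner (rot \<Omega> \<psi>) q"
proof -
  have "ereal (c / 2) < ereal c" using assms(2) by simp
  also have "\<dots> \<le> (INF q\<in>Q - {0}. SUP \<psi>\<in>\<Psi> - {0}. ereal (inner (rot \<Omega> \<psi>) q / (norm (Grad \<Omega> \<psi>) * norm q)))"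
    using assms(1) by (simp add: inf_sup_const_def)
  also have "\<dots> \<le> (SUP \<psi>\<in>\<Psi> - {0}. ereal (inner (rot \<Omega> \<psi>) q / (norm (Grad \<Omega> \<psi>) * norm q)))"
    by (rule INF_lower[OF assms(3)])
  finally obtain \<psi> where \<psi>: "\<psi> \<in> \<Psi>" "c / 2 < inner (rot \<Omega> \<psi>) q / (norm (Grad \<Omega> \<psi>) * norm q)"
    unfolding less_SUP_iff by auto
  have "norm (Grad \<Omega> \<psi>) \<noteq> 0" using \<psi>(2) assms(2) by auto
  then have g: "0 < norm (Grad \<Omega> \<psi>)" by simp
  then have "0 < norm (Grad \<Omega> \<psi>) * norm q" using assms(3) by simp
  then show ?thesis using \<psi> g by (intro bexI[of _ \<psi>]) (auto simp: pos_less_divide_eq)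
qed

context planar_domain
begin

lemma infdist_embed:
  assumes "U \<in> mixed_space \<Omega>" "N \<subseteq> mixed_space \<Omega>" "N \<noteq> {}"
  shows "infdist (embed \<Omega> U) (embed \<Omega> ` N) = mixed_dist \<Omega> U N"
proof -
  have "dist (embed \<Omega> U) (embed \<Omega> W) = mixed_norm \<Omega> (U - W)" if "W \<in> N" for W
    using that assms embed_diff[of U W] by (simp add: dist_norm subsetD flip: norm_embed)
  then show ?thesis using assms(3)
    unfolding infdist_def mixed_dist_def by (simp add: image_image cong: image_cong)
qed

lemma mixed_norm_nonneg: "0 \<le> mixed_norm \<Omega> U"
  unfolding norm_embed[symmetric] by simp

text \<open>The unit vectors of the line are \<open>U\<close> and \<open>- U\<close>, so a single
  nearby element of the subspace \<open>M\<close> bounds the whole gap.\<close>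

lemma gap_span_le:
  assumes M: "subspace M" "M \<subseteq> mixed_space \<Omega>" and U: "U \<in> mixed_space \<Omega>" "mixed_norm \<Omega> U = 1"
    and W: "W \<in> M" "mixed_norm \<Omega> (U - W) \<le> d"
  shows "gap \<Omega> (span {U}) M \<le> d"
  unfolding gap_def
proof (rule cSUP_least)
  have "U \<in> {V \<in> span {U}. mixed_norm \<Omega> V = 1}" using U(2) by (simp add: span_base)
  then show "{V \<in> span {U}. mixed_norm \<Omega> V = 1} \<noteq> {}" by blast
  fix V assume V: "V \<in> {V \<in> span {U}. mixed_norm \<Omega> V = 1}"
  then obtain c where c: "V = c *\<^sub>R U" by (auto simp: span_singleton)
  have "mixed_norm \<Omega> V = \<bar>c\<bar> * mixed_norm \<Omega> U"
    unfolding norm_embed[symmetric] c embed_scaleR[OF U(1)] by simp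
  then have c1: "\<bar>c\<bar> = 1" using V U(2) by simp
  have UW: "U - W \<in> mixed_space \<Omega>" using subspace_diff[OF subspace_mixed_space U(1)] W M by blast
  have "mixed_dist \<Omega> V M \<le> mixed_norm \<Omega> (V - c *\<^sub>R W)"
    unfolding mixed_dist_def
    by (intro cINF_lower bdd_belowI2[where m = 0] mixed_norm_nonneg subspace_scale M W)
  also have "V - c *\<^sub>R W = c *\<^sub>R (U - W)" by (simp add: c scaleR_diff_right)
  also have "mixed_norm \<Omega> \<dots> = mixed_norm \<Omega> (U - W)"
    unfolding norm_embed[symmetric] embed_scaleR[OF UW] by (simp add: c1)
  finally show "mixed_dist \<Omega> V M \<le> d" using W(2) by simp
qed

end

theorem theorem36:
  fixes \<Omega> :: "plane set"
    and H :: "real set"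
    and X :: "real \<Rightarrow> plane l2 set"
    and \<Psi> :: "real \<Rightarrow> ((plane l2)^2) set"
    and Q :: "real \<Rightarrow> plane l2 set"
    and Vh :: "real \<Rightarrow> mixed set"
    and M :: "mixed set"
    and c lam :: real
    and k :: nat
    and lamh :: "real \<Rightarrow> real"
    and uh ph wh :: "real \<Rightarrow> plane l2"
    and \<phi>h :: "real \<Rightarrow> (plane l2)^2"
    and Uh :: "real \<Rightarrow> mixed"
  assumes domain: "polygonal_domain \<Omega>"
    and rot_free: "grad \<Omega> ` H2_0 \<Omega> = {\<psi> \<in> H1_0_vec \<Omega>. rot \<Omega> \<psi> = 0}"
    and mesh_sizes: "H \<subseteq> {0<..}" "0 islimpt H"
    and X: "\<And>h. h \<in> H \<Longrightarrow> subspace (X h) \<and> finite_dimensional (X h) \<and> X h \<subseteq> H1_0 \<Omega>"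
    and \<Psi>: "\<And>h. h \<in> H \<Longrightarrow> subspace (\<Psi> h) \<and> finite_dimensional (\<Psi> h) \<and> \<Psi> h \<subseteq> H1_0_vec \<Omega>"
    and Q: "\<And>h. h \<in> H \<Longrightarrow> subspace (Q h) \<and> finite_dimensional (Q h) \<and> Q h \<subseteq> L2_0 \<Omega>"
    and Vh: "\<And>h. Vh h = X h \<times> \<Psi> h \<times> Q h \<times> X h"
    and inf_sup: "c > 0" "\<And>h. h \<in> H \<Longrightarrow> inf_sup_const \<Omega> (\<Psi> h) (Q h) \<ge> ereal c"
    and approx: "\<And>U. U \<in> mixed_space \<Omega> \<Longrightarrow>
          ((\<lambda>h. mixed_dist \<Omega> U (Vh h)) \<longlongrightarrow> 0) (at 0 within H)"
    and eigenvalue: "kth_eigenvalue (mixed_space \<Omega>) (mixed_a \<Omega>) mixed_b k lam"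
    and M: "M = eigenspace (mixed_space \<Omega>) (mixed_a \<Omega>) mixed_b lam"
    and Uh: "\<And>h. Uh h = (uh h, \<phi>h h, ph h, wh h)"
    and discrete: "\<forall>\<^sub>F h in at 0 within H.
          kth_eigenvalue (Vh h) (mixed_a \<Omega>) mixed_b k (lamh h) \<and>
          eigenpair (Vh h) (mixed_a \<Omega>) mixed_b (lamh h) (Uh h) \<and>
          mixed_norm \<Omega> (Uh h) = 1"
  shows "kth_eigenvalue (H2_0 \<Omega>) (biharmonic_form \<Omega>) inner k lam \<and>
    (lamh \<longlongrightarrow> lam) (at 0 within H) \<and>
    (\<exists>C. \<forall>\<^sub>F h in at 0 within H.
          \<bar>lamh h - lam\<bar> \<le> C * (gap \<Omega> M (Vh h))\<^sup>2 \<and>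
          gap \<Omega> (span {Uh h}) M \<le> C * gap \<Omega> M (Vh h) \<and>
          (\<exists>u. eigenpair (H2_0 \<Omega>) (biharmonic_form \<Omega>) inner lam u \<and>
               H1_norm \<Omega> (uh h - u) \<le> C * gap \<Omega> M (Vh h)))"
proof -
  interpret planar_domain \<Omega> using domain by unfold_locales (simp_all add: polygonal_domain_def)

  \<comment> \<open>The embedded spaces as an instance of the abstract Galerkin setting\<close>
  let ?V = "embed \<Omega> ` mixed_space \<Omega>" and ?Vh = "\<lambda>h. embed \<Omega> ` Vh h"
  have VhV: "Vh h \<subseteq> mixed_space \<Omega>" if "h \<in> H" for h
    unfolding Vh mixed_space_def using X[OF that] \<Psi>[OF that] Q[OF that] by blast
  have sub_Vh: "subspace (Vh h)" if "h \<in> H" for h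
    unfolding Vh using X[OF that] \<Psi>[OF that] Q[OF that] by (intro subspace_Times) auto
  have fin_Vh: "finite_dimensional (Vh h)" if "h \<in> H" for h
    unfolding Vh using X[OF that] \<Psi>[OF that] Q[OF that] by (intro finite_dimensional_Times) auto
  have "c / 2 > 0" using inf_sup(1) by simp
  from discrete_stability[OF this] obtain C where C: "C > 0"
    and stab: "\<And>X \<Psi> Q U \<eta>. \<lbrakk>subspace X; subspace \<Psi>; subspace Q; X \<subseteq> H1_0 \<Omega>; \<Psi> \<subseteq> H1_0_vec \<Omega>;
     \<And>q. q \<in> Q - {0} \<Longrightarrow> \<exists>\<psi>\<in>\<Psi>. 0 < norm (Grad \<Omega> \<psi>) \<and> (c / 2) * (norm (Grad \<Omega> \<psi>) * norm q) \<le> inner (rot \<Omega> \<psi>) q;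
     U \<in> X \<times> \<Psi> \<times> Q \<times> X; 0 \<le> \<eta>; \<And>W. W \<in> X \<times> \<Psi> \<times> Q \<times> X \<Longrightarrow> mixed_a \<Omega> U W \<le> \<eta> * mixed_norm \<Omega> W\<rbrakk>
     \<Longrightarrow> mixed_norm \<Omega> U \<le> C * \<eta>" by metis
  interpret G: galerkin mixed_op fst source ?V ?Vh H C
  proof (intro galerkin.intro symmetric_form.intro galerkin_axioms.intro)
    show "bounded_linear mixed_op" by (rule bounded_linear_mixed_op)
    show "inner (mixed_op U) W = inner U (mixed_op W)" for U W by (rule mixed_op_sym)
    show "bounded_linear (fst :: energy_space \<Rightarrow> plane l2)" by (rule bounded_linear_fst)
    show "bounded_linear source" by (rule bounded_linear_source)
    show "inner (source f) U = inner f (fst U)" for f U by (rule inner_source)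
    show "closed ?V" by (rule closed_embed)
    show "subspace ?V" by (rule subspace_embed[OF subspace_mixed_space order_refl])
    show "C > 0" by (rule C)
    show "0 islimpt H" by (rule mesh_sizes)
    show "subspace (?Vh h) \<and> finite_dimensional (?Vh h) \<and> ?Vh h \<subseteq> ?V" if h: "h \<in> H" for h
    proof (intro conjI image_mono VhV h)
      show "subspace (?Vh h)" by (rule subspace_embed[OF sub_Vh[OF h] VhV[OF h]])
      show "finite_dimensional (?Vh h)"
        by (rule finite_dimensional_image_on_subspace[OF fin_Vh[OF h] sub_Vh[OF h]])
          (use VhV[OF h] embed_add embed_scaleR in blast)+
    qed
    show "norm U \<le> C * \<eta>" if h: "h \<in> H" and U: "U \<in> ?Vh h" and \<eta>: "0 \<le> \<eta>"
      and bd: "\<And>W. W \<in> ?Vh h \<Longrightarrow> inner (mixed_op U) W \<le> \<eta> * norm W" for h U \<eta>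
    proof -
      obtain U' where U': "U' \<in> Vh h" "U = embed \<Omega> U'" using U by blast
      have "mixed_norm \<Omega> U' \<le> C * \<eta>"
      proof (rule stab[of "X h" "\<Psi> h" "Q h"])
        show "\<exists>\<psi>\<in>\<Psi> h. 0 < norm (Grad \<Omega> \<psi>) \<and> (c / 2) * (norm (Grad \<Omega> \<psi>) * norm q) \<le> inner (rot \<Omega> \<psi>) q"
          if "q \<in> Q h - {0}" for q by (rule inf_sup_constD[OF inf_sup(2)[OF h] inf_sup(1) that])
        show "U' \<in> X h \<times> \<Psi> h \<times> Q h \<times> X h" using U'(1) by (simp add: Vh)
        show "mixed_a \<Omega> U' W \<le> \<eta> * mixed_norm \<Omega> W" if "W \<in> X h \<times> \<Psi> h \<times> Q h \<times> X h" for W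
          using bd[of "embed \<Omega> W"] that by (simp add: mixed_a_eq U'(2) norm_embed flip: Vh)
      qed (use X[OF h] \<Psi>[OF h] Q[OF h] \<eta> in auto)
      then show ?thesis by (simp add: U'(2) norm_embed)
    qed
    show "0 \<le> inner (mixed_op U) U"
      if Y: "Y = ?V \<or> (\<exists>h\<in>H. Y = ?Vh h)" and U: "U \<in> Y"
        and eq: "\<And>W. W \<in> Y \<Longrightarrow> inner (mixed_op U) W = inner f (fst W)" for Y U f
    proof -
      \<comment> \<open>The continuous and the discrete spaces are treated together as products with
        equal outer factors and 0 in each factor.\<close>
      have "\<exists>X' \<Psi>' Q'. Y = embed \<Omega> ` (X' \<times> \<Psi>' \<times> Q' \<times> X') \<and> 0 \<in> X' \<and> 0 \<in> \<Psi>' \<and> 0 \<in> Q'"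
      proof (cases "Y = ?V")
        case True
        then show ?thesis
          using subspace_0[OF subspace_H1_0] subspace_0[OF subspace_H1_0_vec] subspace_0[OF subspace_L2_0]
          unfolding mixed_space_def by blast
      next
        case False
        then obtain h where h: "h \<in> H" "Y = ?Vh h" using Y by blast
        have "0 \<in> X h" "0 \<in> \<Psi> h" "0 \<in> Q h"
          using X[OF h(1)] \<Psi>[OF h(1)] Q[OF h(1)] by (auto intro: subspace_0)
        then show ?thesis using h(2) Vh[of h] by (intro exI[of _ "X h"] exI[of _ "\<Psi> h"] exI[of _ "Q h"]) simp
      qed
      then obtain X' \<Psi>' Q' where Y': "Y = embed \<Omega> ` (X' \<times> \<Psi>' \<times> Q' \<times> X')" "0 \<in> X'" "0 \<in> \<Psi>'" "0 \<in> Q'" by blast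
      obtain U' where U': "U' \<in> X' \<times> \<Psi>' \<times> Q' \<times> X'" "U = embed \<Omega> U'" using U unfolding Y'(1) by blast
      have "0 \<le> mixed_a \<Omega> U' U'"
      proof (rule mixed_a_nonneg[OF Y'(2-4) U'(1)])
        fix W assume "W \<in> X' \<times> \<Psi>' \<times> Q' \<times> X'"
        then have "embed \<Omega> W \<in> Y" unfolding Y'(1) by blast
        from eq[OF this] show "mixed_a \<Omega> U' W = inner f (fst W)" by (simp add: mixed_a_eq U'(2))
      qed
      then show ?thesis by (simp add: mixed_a_eq U'(2))
    qed
    show "((\<lambda>h. infdist U (?Vh h)) \<longlongrightarrow> 0) (at 0 within H)" if "U \<in> ?V" for U
    proof -
      obtain U' where U': "U' \<in> mixed_space \<Omega>" "U = embed \<Omega> U'" using \<open>U \<in> ?V\<close> by blast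
      have "\<forall>\<^sub>F h in at 0 within H. h \<in> H" by (simp add: eventually_at_topological) blast
      then have "\<forall>\<^sub>F h in at 0 within H. mixed_dist \<Omega> U' (Vh h) = infdist U (?Vh h)"
      proof eventually_elim
        case (elim h)
        have "Vh h \<noteq> {}" using subspace_0[OF sub_Vh[OF elim]] by blast
        then show ?case using infdist_embed[OF U'(1) VhV[OF elim]] U'(2) by simp
      qed
      from Lim_transform_eventually[OF approx[OF U'(1)] this] show ?thesis .
    qed
    show "\<exists>r l. strict_mono r \<and> (\<lambda>n. fst (U (r n))) \<longlonglongrightarrow> l"
      if U: "\<And>n. U n \<in> ?V" and b: "bounded (range U)" for U :: "nat \<Rightarrow> energy_space"
    proof -
      obtain K where K: "\<And>n. norm (U n) \<le> K" using b by (auto simp: bounded_iff)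
      have comp: "fst (U n) \<in> H1_0 \<Omega>" "fst (snd (U n)) = grad \<Omega> (fst (U n))" for n
        using U[of n] by (auto simp: mixed_space_def)
      have "norm (fst (U n)) \<le> norm (U n)" "norm (fst (snd (U n))) \<le> norm (snd (U n))" "norm (snd (U n)) \<le> norm (U n)" for n
        using norm_fst_le[of "fst (U n)" "snd (U n)"] norm_fst_le[of "fst (snd (U n))" "snd (snd (U n))"]
          norm_snd_le[of "snd (U n)" "fst (U n)"] by (simp_all only: prod.collapse)
      then have "norm (fst (U n)) \<le> K" "norm (grad \<Omega> (fst (U n))) \<le> K" for n
        using K[of n] unfolding comp(2)[of n, symmetric] by (meson order_trans)+
      then show ?thesis by (rule rellich_compact[OF comp(1)])
    qed
  qed

  \<comment> \<open>Transfer of eigenvalues, eigenspaces and gaps to the embedded problem\<close>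
  let ?a = "\<lambda>U W. inner (mixed_op U) W" and ?b = "\<lambda>U W :: energy_space. inner (fst U) (fst W)"
  have kth: "kth_eigenvalue ?V ?a ?b k lam"
    using kth_eigenvalue_embed[OF G.V.subspace_eigenspace order_refl] eigenvalue by blast
  have sub_h: "subspace (eigenspace (?Vh h) ?a ?b \<mu>)" if "h \<in> H" for h \<mu>
    by (rule stable_subspace.subspace_eigenspace[OF G.Vh_space[OF that]])
  have kth_h: "\<forall>\<^sub>F h in at 0 within H. kth_eigenvalue (?Vh h) ?a ?b k (lamh h)"
    using discrete G.in_H
  proof eventually_elim
    case (elim h)
    then show ?case using kth_eigenvalue_embed[OF sub_h VhV] by blast
  qed
  have lam: "lam > 0" by (rule G.kth_eigenvalue_pos[OF kth])
  have lim: "(lamh \<longlongrightarrow> lam) (at 0 within H)" by (rule G.eigenvalue_tendsto[OF kth kth_h])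
  let ?M = "eigenspace ?V ?a ?b lam"
  have M_mixed: "M \<subseteq> mixed_space \<Omega>" by (auto simp: M eigenspace_def)
  have M': "M = coords ` ?M" unfolding M by (rule eigenspace_embed[OF order_refl])
  have M_embed: "?M = embed \<Omega> ` M"
  proof -
    have "embed \<Omega> (coords z) = z" if "z \<in> ?M" for z using that by (auto simp: eigenspace_def)
    then show ?thesis unfolding M' by (simp add: image_image)
  qed
  have subM: "subspace M" unfolding M' by (rule linear_subspace_image[OF linear_coords G.V.subspace_eigenspace])
  have finM: "finite_dimensional ?M" using kth by (auto simp: kth_eigenvalue_def)
  have M0: "?M \<noteq> {0}" using kth by (auto simp: kth_eigenvalue_def eigenvalues_def eigenpair_def)
  have Uh_eig: "\<forall>\<^sub>F h in at 0 within H. embed \<Omega> (Uh h) \<in> eigenspace (?Vh h) ?a ?b (lamh h) \<and> norm (embed \<Omega> (Uh h)) = 1"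
    using discrete G.in_H
  proof eventually_elim
    case (elim h)
    then have "Uh h \<in> eigenspace (Vh h) (mixed_a \<Omega>) mixed_b (lamh h)" by (simp add: eigenpair_def)
    then have "embed \<Omega> (Uh h) \<in> eigenspace (?Vh h) ?a ?b (lamh h)"
      by (auto simp: eigenspace_def mixed_a_eq mixed_b_eq)
    then show ?case using elim by (simp add: norm_embed)
  qed
  obtain K where K: "\<forall>\<^sub>F h in at 0 within H. \<exists>U\<in>?M. norm (embed \<Omega> (Uh h) - U) \<le> K * G.gap_to_Vh ?M h"
    using G.eigenvector_estimate[OF lam refl finM M0 lim Uh_eig] by blast
  obtain K' where K': "\<forall>\<^sub>F h in at 0 within H. \<bar>lamh h - lam\<bar> \<le> K' * (G.gap_to_Vh ?M h)\<^sup>2"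
    using G.eigenvalue_estimate[OF lam refl lim Uh_eig K] by blast
  have gap0: "(G.gap_to_Vh ?M \<longlongrightarrow> 0) (at 0 within H)"
    by (rule G.gap_tendsto_0[OF G.V.subspace_eigenspace finM G.V.eigenspace_subset M0])
  have gap_eq: "gap \<Omega> M (Vh h) = G.gap_to_Vh ?M h" if h: "h \<in> H" for h
  proof -
    have ne: "Vh h \<noteq> {}" using subspace_0[OF sub_Vh[OF h]] by blast
    have "{z \<in> ?M. norm z = 1} = embed \<Omega> ` {U \<in> M. mixed_norm \<Omega> U = 1}"
      unfolding M_embed by (simp only: Compr_image_eq norm_embed)
    then have "G.gap_to_Vh ?M h = (SUP U\<in>{U \<in> M. mixed_norm \<Omega> U = 1}. infdist (embed \<Omega> U) (?Vh h))"
      unfolding G.gap_to_Vh_def by (simp only: image_image)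
    also have "\<dots> = gap \<Omega> M (Vh h)"
      unfolding gap_def by (intro SUP_cong refl infdist_embed VhV h ne) (use M_mixed in blast)
    finally show ?thesis by simp
  qed

  \<comment> \<open>Identification with the biharmonic eigenvalue problem\<close>
  have biharm: "eigenspace (H2_0 \<Omega>) (biharmonic_form \<Omega>) inner \<mu> = fst ` eigenspace ?V ?a ?b \<mu>" for \<mu>
  proof (intro set_eqI iffI)
    fix u assume "u \<in> fst ` eigenspace ?V ?a ?b \<mu>"
    then obtain U where U: "U \<in> mixed_space \<Omega>" "u = fst U" "embed \<Omega> U \<in> eigenspace ?V ?a ?b \<mu>"
      by (auto simp: eigenspace_def)
    have eq: "mixed_a \<Omega> U W = inner (\<mu> *\<^sub>R u) (fst W)" if "W \<in> mixed_space \<Omega>" for W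
      using U that by (auto simp: eigenspace_def mixed_a_eq)
    show "u \<in> eigenspace (H2_0 \<Omega>) (biharmonic_form \<Omega>) inner \<mu>"
      using mixed_solution_biharmonic[OF rot_free U(1) eq] U(2) by (simp add: eigenspace_def)
  next
    fix u assume "u \<in> eigenspace (H2_0 \<Omega>) (biharmonic_form \<Omega>) inner \<mu>"
    then have u: "u \<in> H2_0 \<Omega>" "\<And>v. v \<in> H2_0 \<Omega> \<Longrightarrow> biharmonic_form \<Omega> u v = \<mu> * inner u v"
      by (auto simp: eigenspace_def)
    \<comment> \<open>The first component of \<open>Z\<close> solves the biharmonic source problem
      with the load of \<open>u\<close>. The difference of the two lies in
      \<open>H2_0 \<Omega>\<close>; testing with itself annihilates its second derivatives, and the
      Poincare inequality, applied twice, shows that it is 0.\<close>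
    define Z where "Z = G.V.sol (source (\<mu> *\<^sub>R u))"
    have ZV: "Z \<in> ?V" unfolding Z_def by (rule G.V.sol(1))
    have ZW: "?a Z W = inner (\<mu> *\<^sub>R u) (fst W)" if "W \<in> ?V" for W
      using G.V.sol(2)[OF that] unfolding Z_def by (simp only: inner_source)
    obtain U where U: "U \<in> mixed_space \<Omega>" "Z = embed \<Omega> U" using ZV by blast
    have eq: "mixed_a \<Omega> U W = inner (\<mu> *\<^sub>R u) (fst W)" if "W \<in> mixed_space \<Omega>" for W
      using ZW[OF imageI[OF that]] by (simp add: mixed_a_eq U(2))
    have sol1: "fst U \<in> H2_0 \<Omega>" by (rule mixed_solution_biharmonic(1)[OF rot_free U(1) eq])
    have sol2: "biharmonic_form \<Omega> (fst U) v = inner (\<mu> *\<^sub>R u) v" if "v \<in> H2_0 \<Omega>" for v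
      by (rule mixed_solution_biharmonic(2)[OF rot_free U(1) eq that])
    let ?d = "u - fst U"
    note iff = H2_0_iff[OF rot_free]
    have uH: "u \<in> H1_0 \<Omega>" "grad \<Omega> u \<in> H1_0_vec \<Omega>" "rot \<Omega> (grad \<Omega> u) = 0"
      and UH: "fst U \<in> H1_0 \<Omega>" "grad \<Omega> (fst U) \<in> H1_0_vec \<Omega>" "rot \<Omega> (grad \<Omega> (fst U)) = 0"
      using iff u(1) sol1 by blast+
    have gd: "grad \<Omega> ?d = grad \<Omega> u - grad \<Omega> (fst U)" by (rule grad_diff(2)[OF H1_0_H1[OF uH(1)] H1_0_H1[OF UH(1)]])
    have "grad \<Omega> u - grad \<Omega> (fst U) = grad \<Omega> u + (-1) *\<^sub>R grad \<Omega> (fst U)" by simp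
    then have Gd: "Grad \<Omega> (grad \<Omega> ?d) = Grad \<Omega> (grad \<Omega> u) - Grad \<Omega> (grad \<Omega> (fst U))"
      unfolding gd using Grad_add[OF uH(2) subspace_scale[OF subspace_H1_0_vec UH(2), of "-1"]] Grad_scaleR[OF UH(2), of "-1"] by simp
    have dH: "?d \<in> H1_0 \<Omega>" by (rule subspace_diff[OF subspace_H1_0 uH(1) UH(1)])
    have gH: "grad \<Omega> ?d \<in> H1_0_vec \<Omega>" unfolding gd by (rule subspace_diff[OF subspace_H1_0_vec uH(2) UH(2)])
    have "rot \<Omega> (grad \<Omega> ?d) = 0" using uH(3) UH(3) unfolding rot_eq Gd by (simp add: rot_of_def)
    then have d: "?d \<in> H2_0 \<Omega>" using iff dH gH by blast
    have "inner (Grad \<Omega> (grad \<Omega> ?d)) (Grad \<Omega> (grad \<Omega> ?d)) = biharmonic_form \<Omega> u ?d - biharmonic_form \<Omega> (fst U) ?d"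
      by (simp add: biharmonic_form_def Gd inner_diff_left)
    also have "\<dots> = 0" using u(2)[OF d] sol2[OF d] by simp
    finally have "Grad \<Omega> (grad \<Omega> ?d) = 0" by simp
    then have "?d = 0" using Grad_eq_0[OF gH] grad_eq_0[OF dH] by blast
    then have uU: "u = fst Z" by (simp add: U(2))
    then have "Z \<in> eigenspace ?V ?a ?b \<mu>" using ZV ZW by (simp add: eigenspace_def)
    then show "u \<in> fst ` eigenspace ?V ?a ?b \<mu>" using uU by blast
  qed
  have bi: "kth_eigenvalue (H2_0 \<Omega>) (biharmonic_form \<Omega>) inner k lam"
    using kth_eigenvalue_linear_image[OF bounded_linear.linear[OF bounded_linear_fst]
        G.V.inj_on_B_eigenspace G.V.subspace_eigenspace biharm] kth by blast

  \<comment> \<open>Error estimates with one common constant\<close>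
  define C' where "C' = max K K'"
  have "((\<lambda>h. C' * G.gap_to_Vh ?M h) \<longlongrightarrow> C' * 0) (at 0 within H)" by (intro tendsto_intros gap0)
  \<comment> \<open>Below 1, the element of \<open>M\<close> that approximates the unit vector
    \<open>Uh h\<close> cannot be 0, so its first component is a genuine eigenvector.\<close>
  then have small: "\<forall>\<^sub>F h in at 0 within H. C' * G.gap_to_Vh ?M h < 1" by (rule order_tendstoD) simp
  have "\<forall>\<^sub>F h in at 0 within H.
          \<bar>lamh h - lam\<bar> \<le> C' * (gap \<Omega> M (Vh h))\<^sup>2 \<and>
          gap \<Omega> (span {Uh h}) M \<le> C' * gap \<Omega> M (Vh h) \<and>
          (\<exists>u. eigenpair (H2_0 \<Omega>) (biharmonic_form \<Omega>) inner lam u \<and>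
               H1_norm \<Omega> (uh h - u) \<le> C' * gap \<Omega> M (Vh h))"
    using K K' small discrete G.in_H
  proof eventually_elim
    case (elim h)
    let ?\<delta> = "G.gap_to_Vh ?M h"
    have \<delta>: "0 \<le> ?\<delta>" by (rule G.gap_nonneg[OF elim(5) G.V.subspace_eigenspace M0])
    obtain U where U: "U \<in> M" "norm (embed \<Omega> (Uh h) - embed \<Omega> U) \<le> K * ?\<delta>"
      using elim(1) unfolding M_embed by blast
    have UV: "U \<in> mixed_space \<Omega>" "Uh h \<in> mixed_space \<Omega>"
      using U(1) M_mixed elim(4) VhV[OF elim(5)] by (auto simp: eigenpair_def eigenspace_def)
    have "K * ?\<delta> \<le> C' * ?\<delta>" "K' * ?\<delta>\<^sup>2 \<le> C' * ?\<delta>\<^sup>2" using \<delta> by (auto simp: C'_def intro!: mult_right_mono)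
    then have dU: "mixed_norm \<Omega> (Uh h - U) \<le> C' * ?\<delta>" and dl: "\<bar>lamh h - lam\<bar> \<le> C' * ?\<delta>\<^sup>2"
      using U(2) elim(2) by (auto simp: embed_diff[OF UV(2,1)] simp flip: norm_embed)
    have nU: "mixed_norm \<Omega> (Uh h) = 1" using elim(4) by blast
    have "U \<noteq> 0"
    proof
      assume "U = 0"
      then have "mixed_norm \<Omega> (Uh h - U) = 1" using nU by simp
      then show False using dU elim(3) by linarith
    qed
    moreover have eU: "embed \<Omega> U \<in> ?M" using U(1) M_embed by blast
    moreover have "embed \<Omega> U \<noteq> 0"
    proof
      assume "embed \<Omega> U = 0"
      then have "U = coords 0" by (metis coords_embed)
      then show False using \<open>U \<noteq> 0\<close> linear_0[OF linear_coords] by simp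
    qed
    ultimately have "fst U \<noteq> 0" using G.V.eigen_pos(2) by fastforce
    moreover have "fst U \<in> eigenspace (H2_0 \<Omega>) (biharmonic_form \<Omega>) inner lam"
      using imageI[OF eU, of fst] unfolding biharm by (simp only: fst_embed)
    ultimately have ep: "eigenpair (H2_0 \<Omega>) (biharmonic_form \<Omega>) inner lam (fst U)" by (simp add: eigenpair_def)
    obtain u \<phi> p w where Ut: "U = (u, \<phi>, p, w)" by (cases U)
    have "H1_norm \<Omega> (uh h - fst U) \<le> mixed_norm \<Omega> (Uh h - U)"
      by (simp add: Uh Ut H1_norm_def real_le_rsqrt)
    then have "H1_norm \<Omega> (uh h - fst U) \<le> C' * ?\<delta>" using dU by linarith
    moreover have "gap \<Omega> (span {Uh h}) M \<le> C' * ?\<delta>"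
      by (rule gap_span_le[OF subM M_mixed UV(2) nU U(1) dU])
    ultimately show ?case using dl ep unfolding gap_eq[OF elim(5)] by blast
  qed
  then show ?thesis using bi lim by blast
qed

end
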